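(* Let $N\ge 1$, $0<\alpha<1$ and $\lambda\in\mathbb{C}\setminus\{0\}$. There exists an initial value $u_0\in C^\infty_c(\mathbb{R}^N)$ such that the corresponding maximal solution $u\in C([0,T_{\max}),C_0(\mathbb{R}^N))$ of $$u_t=\Delta u+\lambda|u|^\alpha u,\qquad u(0,\cdot)=u_0,$$ is three times continuously differentiable with respect to the space variable and there exists $t_0\in(0,T_{\max})$ such that $$\int_s^t |\partial_y\Delta u(\sigma)|_\beta\,d\sigma=+\infty$$ for all $\alpha<\beta\le 1$ and all $0\le s<t<t_0$.
   Context: All functions are complex-valued. $C_0(\mathbb{R}^N)$ is the space of continuous functions on $\mathbb{R}^N$ vanishing at infinity, with the sup norm. $C^\infty_c(\mathbb{R}^N)$ is the space of smooth compactly supported functions. The variable in $\mathbb{R}^N$ is written $x=(x',y)$ with $x'\in\mathbb{R}^{N-1}$, $y\in\mathbb{R}$, so $\partial_y$ is the derivative with respect to the last coordinate. For $\ell>0$ and $w\in C(\mathbb{R}^N)$, $$|w|_\ell=\sup_{x\ne y}\frac{|w(x)-w(y)|}{|x-y|^\ell}\in[0,\infty].$$ The Cauchy problem is locally well posed in $C_0(\mathbb{R}^N)$: for every $u_0\in C_0(\mathbb{R}^N)$ there exist a maximal existence time $T_{\max}=T_{\max}(u_0)\in(0,\infty]$ and a unique maximal solution $u\in C([0,T_{\max}),C_0(\mathbb{R}^N))$, i.e. a solution of $u(t)=e^{t\Delta}u_0+\lambda\int_0^t e^{(t-\sigma)\Delta}(|u(\sigma)|^\alpha u(\sigma))\,d\sigma$,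 where $(e^{t\Delta})_{t\ge0}$ is the heat semigroup on $\mathbb{R}^N$. *)

theory Defs
  imports "HOL-Analysis.Analysis" "HOL-Probability.Distributions"
begin

text \<open>
  The space \<open>\<real>\<^sup>N\<close> is \<^typ>\<open>real^'n\<close> with \<open>N = CARD('n)\<close>. Complex-valued bounded continuous
  functions on it form the Banach space \<^typ>\<open>(real^'n) \<Rightarrow>\<^sub>C complex\<close>, normed by the sup norm, and
  \<open>C\<^sub>0(\<real>\<^sup>N)\<close> is the closed subspace \<open>C0\<close> below.
\<close>

section \<open>Function spaces\<close>

definition C0 :: "((real^'n) \<Rightarrow>\<^sub>C complex) set" where
  "C0 = {f. (apply_bcontfun f \<longlongrightarrow> 0) at_infinity}"

definition partial_differentiable :: "'n \<Rightarrow> (real^'n \<Rightarrow> complex) \<Rightarrow> bool" where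
  "partial_differentiable i f \<longleftrightarrow>
     (\<forall>x. (\<lambda>h::real. f (x + h *\<^sub>R axis i 1)) differentiable (at 0))"

definition partial :: "'n \<Rightarrow> (real^'n \<Rightarrow> complex) \<Rightarrow> real^'n \<Rightarrow> complex" where
  "partial i f x = vector_derivative (\<lambda>h::real. f (x + h *\<^sub>R axis i 1)) (at 0)"

text \<open>\<open>Ck m f\<close>: all iterated partial derivatives of \<open>f\<close> of order \<open>\<le> m\<close> exist and are
  continuous on the whole space.\<close>

primrec Ck :: "nat \<Rightarrow> (real^'n \<Rightarrow> complex) \<Rightarrow> bool" where
  "Ck 0 f \<longleftrightarrow> continuous_on UNIV f"
| "Ck (Suc m) f \<longleftrightarrow>
     continuous_on UNIV f \<and> (\<forall>i. partial_differentiable i f \<and> Ck m (partial i f))"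

definition Cc_infinity :: "((real^'n) \<Rightarrow>\<^sub>C complex) set" where
  "Cc_infinity = {f. (\<forall>m. Ck m (apply_bcontfun f)) \<and> compact (closure {x. apply_bcontfun f x \<noteq> 0})}"

definition laplacian :: "(real^'n \<Rightarrow> complex) \<Rightarrow> real^'n \<Rightarrow> complex" where
  "laplacian f x = (\<Sum>i\<in>UNIV. partial i (partial i f) x)"

definition holder_seminorm :: "real \<Rightarrow> (real^'n \<Rightarrow> complex) \<Rightarrow> ennreal" where
  "holder_seminorm l w =
     (SUP (x, y) \<in> {(x, y). x \<noteq> y}. ennreal (norm (w x - w y) / norm (x - y) powr l))"


section \<open>The heat semigroup and the nonlinearity\<close>

definition heat_kernel :: "real \<Rightarrow> real^'n \<Rightarrow> real" where
  "heat_kernel t z =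
     (4 * pi * t) powr (- (real CARD('n) / 2)) * exp (- (norm z)\<^sup>2 / (4 * t))"

text \<open>
  The operators below send bounded continuous functions to bounded continuous functions, and
  \<^const>\<open>Bcontfun\<close> only repackages the displayed function as an element of the Banach space; see
  the lemmas \<open>apply_heat\<close>, \<open>apply_nonlin\<close> and \<open>apply_cscale\<close>. The semigroup is only used
  for \<open>t \<ge> 0\<close>.
\<close>

definition heat :: "real \<Rightarrow> ((real^'n) \<Rightarrow>\<^sub>C complex) \<Rightarrow> ((real^'n) \<Rightarrow>\<^sub>C complex)" where
  "heat t f =
     (if t = 0 then f
      else Bcontfun (\<lambda>x. \<integral>y. heat_kernel t (x - y) *\<^sub>R apply_bcontfun f y \<partial>lborel))"

definition nonlin :: "real \<Rightarrow> ((real^'n) \<Rightarrow>\<^sub>C complex) \<Rightarrow> ((real^'n) \<Rightarrow>\<^sub>C complex)" where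
  "nonlin \<alpha> f =
     Bcontfun (\<lambda>x. (norm (apply_bcontfun f x) powr \<alpha>) *\<^sub>R apply_bcontfun f x)"

definition cscale :: "complex \<Rightarrow> ((real^'n) \<Rightarrow>\<^sub>C complex) \<Rightarrow> ((real^'n) \<Rightarrow>\<^sub>C complex)" where
  "cscale c f = Bcontfun (\<lambda>x. c * apply_bcontfun f x)"

lemma apply_cscale: "apply_bcontfun (cscale c f) x = c * apply_bcontfun f x"
proof -
  have "bounded (range (\<lambda>x. c * apply_bcontfun f x))"
    using bounded_linear_image[OF bounded_apply_bcontfun[of f] bounded_linear_mult_right[of c]]
    by (simp add: image_image)
  then have "(\<lambda>x. c * apply_bcontfun f x) \<in> bcontfun"
    by (auto simp: bcontfun_def intro!: continuous_intros)
  then show ?thesis by (simp add: cscale_def Bcontfun_inverse)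
qed

lemma apply_nonlin:
  assumes "\<alpha> > 0"
  shows "apply_bcontfun (nonlin \<alpha> f) x = (norm (apply_bcontfun f x) powr \<alpha>) *\<^sub>R apply_bcontfun f x"
proof -
  obtain B where B: "\<And>x. norm (apply_bcontfun f x) \<le> B"
    using bounded_apply_bcontfun[of f] by (auto simp: bounded_iff)
  have "norm ((norm (apply_bcontfun f x) powr \<alpha>) *\<^sub>R apply_bcontfun f x) \<le> B powr \<alpha> * B" for x
    using B[of x] assms by (auto intro!: mult_mono powr_mono2)
  then have "bounded (range (\<lambda>x. (norm (apply_bcontfun f x) powr \<alpha>) *\<^sub>R apply_bcontfun f x))"
    unfolding bounded_iff by blast
  moreover have "continuous_on UNIV (\<lambda>x. (norm (apply_bcontfun f x) powr \<alpha>) *\<^sub>R apply_bcontfun f x)"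
    using assms by (intro continuous_intros continuous_on_powr') auto
  ultimately show ?thesis by (simp add: nonlin_def Bcontfun_inverse bcontfun_def)
qed

lemma integrable_heat_kernel:
  assumes t: "t > 0"
  shows "integrable lborel (heat_kernel t :: real^'n \<Rightarrow> real)"
proof -
  interpret product_sigma_finite "\<lambda>_::real^'n. lborel :: real measure"
    by standard
  have "integrable lborel (normal_density 0 (sqrt (2 * t)))"
    using t by (intro integrable_normal_density) auto
  then have "integrable lborel (\<lambda>x. sqrt (4 * pi * t) * normal_density 0 (sqrt (2 * t)) x)"
    by (rule integrable_mult_right)
  also have "(\<lambda>x. sqrt (4 * pi * t) * normal_density 0 (sqrt (2 * t)) x) = (\<lambda>x. exp (- x\<^sup>2 / (4 * t)))"
    using t by (auto simp: normal_density_def fun_eq_iff field_simps real_sqrt_mult)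
  finally have 1: "integrable lborel (\<lambda>x::real. exp (- x\<^sup>2 / (4 * t)))" .
  have "integrable (\<Pi>\<^sub>M b\<in>(Basis :: (real^'n) set). lborel)
          (\<lambda>x. \<Prod>b\<in>Basis. exp (- (x b)\<^sup>2 / (4 * t)))"
    by (intro product_integrable_prod 1) auto
  also have "(\<lambda>x. \<Prod>b\<in>(Basis :: (real^'n) set). exp (- (x b)\<^sup>2 / (4 * t))) =
      (\<lambda>x. exp (- (norm (\<Sum>b\<in>(Basis :: (real^'n) set). x b *\<^sub>R b))\<^sup>2 / (4 * t)))"
  proof
    fix x :: "real^'n \<Rightarrow> real"
    have "(norm (\<Sum>b\<in>Basis. x b *\<^sub>R b))\<^sup>2 = (\<Sum>b\<in>Basis. (x b)\<^sup>2)"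
      unfolding power2_norm_eq_inner
      by (subst euclidean_inner) (simp add: power2_eq_square)
    then show "(\<Prod>b\<in>Basis. exp (- (x b)\<^sup>2 / (4 * t))) =
        exp (- (norm (\<Sum>b\<in>Basis. x b *\<^sub>R b))\<^sup>2 / (4 * t))"
      by (simp add: exp_sum[symmetric] sum_negf sum_divide_distrib)
  qed
  finally have "integrable lborel (\<lambda>z::real^'n. exp (- (norm z)\<^sup>2 / (4 * t)))"
    by (subst lborel_eq, subst integrable_distr_eq) auto
  then show ?thesis unfolding heat_kernel_def by simp
qed

lemma apply_heat:
  fixes f :: "(real^'n) \<Rightarrow>\<^sub>C complex"
  assumes t: "t > 0"
  shows "apply_bcontfun (heat t f) x = (\<integral>y. heat_kernel t (x - y) *\<^sub>R apply_bcontfun f y \<partial>lborel)"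
proof -
  let ?K = "heat_kernel t :: real^'n \<Rightarrow> real" and ?f = "apply_bcontfun f"
  let ?F = "\<lambda>x. \<integral>y. ?K (x - y) *\<^sub>R ?f y \<partial>lborel"
  obtain B where B: "\<And>x. norm (?f x) \<le> B"
    using bounded_apply_bcontfun[of f] by (auto simp: bounded_iff)
  have [measurable]: "?K \<in> borel_measurable borel" "?f \<in> borel_measurable borel"
    by (auto simp: heat_kernel_def[abs_def] intro!: borel_measurable_continuous_onI)
  have K0: "?K z \<ge> 0" for z by (simp add: heat_kernel_def)
  have lb: "distr lborel borel (\<lambda>z. x - z) = (lborel :: (real^'n) measure)" for x :: "real^'n"
    using lborel_affine[of "-1" x] by (simp add: density_1)
  have F: "?F x = (\<integral>z. ?K z *\<^sub>R ?f (x - z) \<partial>lborel)" for x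
    by (subst (1) lb[of x, symmetric], subst integral_distr) auto
  have bnd: "norm (?K z *\<^sub>R ?f (x - z)) \<le> B * ?K z" for x z
    using mult_left_mono[OF B[of "x - z"] K0[of z]] K0[of z] by (simp add: mult.commute)
  have int: "integrable lborel (\<lambda>z::real^'n. B * ?K z)"
    by (intro integrable_mult_right integrable_heat_kernel t)
  have "norm (?F x) \<le> (\<integral>z. B * ?K z \<partial>lborel)" for x
  proof -
    have i: "integrable lborel (\<lambda>z. ?K z *\<^sub>R ?f (x - z))"
      by (rule Bochner_Integration.integrable_bound[OF int])
         (auto intro!: always_eventually order_trans[OF bnd] abs_ge_self simp del: norm_scaleR)
    have "norm (?F x) \<le> (\<integral>z. norm (?K z *\<^sub>R ?f (x - z)) \<partial>lborel)"
      unfolding F by (rule integral_norm_bound)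
    also have "\<dots> \<le> (\<integral>z. B * ?K z \<partial>lborel)"
      by (intro integral_mono integrable_norm i int bnd)
    finally show ?thesis .
  qed
  then have 1: "bounded (range ?F)" unfolding bounded_iff by blast
  have "isCont ?F x" for x
    unfolding continuous_at_sequentially
  proof (intro allI impI)
    fix X :: "nat \<Rightarrow> real^'n" assume X: "X \<longlonglongrightarrow> x"
    have "isCont ?f y" for y
      using continuous_on_apply_bcontfun[of UNIV f] continuous_on_eq_continuous_at[OF open_UNIV] by blast
    then have lim: "(\<lambda>n. ?f (X n - z)) \<longlonglongrightarrow> ?f (x - z)" for z
      by (intro isCont_tendsto_compose[where g = ?f] tendsto_intros X)
    have "(\<lambda>n. \<integral>z. ?K z *\<^sub>R ?f (X n - z) \<partial>lborel) \<longlonglongrightarrow> (\<integral>z. ?K z *\<^sub>R ?f (x - z) \<partial>lborel)"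
      by (rule integral_dominated_convergence[where w = "\<lambda>z. B * ?K z"])
         (use int bnd in \<open>auto intro!: tendsto_intros lim\<close>)
    then show "(?F \<circ> X) \<longlonglongrightarrow> ?F x" by (simp add: F o_def)
  qed
  then have 2: "continuous_on UNIV ?F" by (simp add: continuous_at_imp_continuous_on)
  from 1 2 show ?thesis using t by (simp add: heat_def Bcontfun_inverse bcontfun_def)
qed


section \<open>Mild solutions\<close>

text \<open>
  \<open>mild_solution lam \<alpha> u\<^sub>0 T u\<close>: on \<open>[0, T)\<close>, \<open>0 < T \<le> \<infinity>\<close>, the curve \<open>u\<close> is continuous with
  values in \<open>C\<^sub>0(\<real>\<^sup>N)\<close> and satisfies Duhamel's formula. The time integral is the integral of a
  continuous curve in the Banach space \<^typ>\<open>(real^'n) \<Rightarrow>\<^sub>C complex\<close>. Values of \<open>u\<close> outside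
  \<open>[0, T)\<close> are irrelevant.
\<close>

definition mild_solution ::
    "complex \<Rightarrow> real \<Rightarrow> ((real^'n) \<Rightarrow>\<^sub>C complex) \<Rightarrow> ereal \<Rightarrow> (real \<Rightarrow> ((real^'n) \<Rightarrow>\<^sub>C complex)) \<Rightarrow> bool"
  where
  "mild_solution lam \<alpha> u0 T u \<longleftrightarrow>
     0 < T \<and>
     continuous_on {t. 0 \<le> t \<and> ereal t < T} u \<and>
     (\<forall>t. 0 \<le> t \<and> ereal t < T \<longrightarrow>
        u t \<in> C0 \<and>
        u t = heat t u0 + cscale lam (integral {0..t} (\<lambda>\<sigma>. heat (t - \<sigma>) (nonlin \<alpha> (u \<sigma>)))))"

text \<open>
  \<open>u\<close> on \<open>[0, T)\<close> is the maximal solution, and \<open>T\<close> the maximal existence time, when every other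
  solution with the same initial value is a restriction of it. This determines \<open>T\<close>, and \<open>u\<close> on
  \<open>[0, T)\<close>, uniquely.
\<close>

definition maximal_solution ::
    "complex \<Rightarrow> real \<Rightarrow> ((real^'n) \<Rightarrow>\<^sub>C complex) \<Rightarrow> ereal \<Rightarrow> (real \<Rightarrow> ((real^'n) \<Rightarrow>\<^sub>C complex)) \<Rightarrow> bool"
  where
  "maximal_solution lam \<alpha> u0 T u \<longleftrightarrow>
     mild_solution lam \<alpha> u0 T u \<and>
     (\<forall>T' v. mild_solution lam \<alpha> u0 T' v \<longrightarrow>
        T' \<le> T \<and> (\<forall>t. 0 \<le> t \<and> ereal t < T' \<longrightarrow> v t = u t))"

end

theory Submission
  imports Defs
begin

text \<open>
  Take an initial value that is odd under \<open>x \<mapsto> -x\<close> and whose \<open>y\<close>-derivative at the origin is 1. Then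
  \<open>u(\<sigma>, 0) = 0\<close>, and \<open>u(\<sigma>, (0, h))\<close> is close to \<open>h\<close> for small \<open>\<sigma>\<close> and \<open>h\<close>, so \<open>\<partial>\<^sub>y(|u|\<^sup>\<alpha>u)\<close> is at least of order
  \<open>h\<^sup>\<alpha>\<close> at \<open>(0, h)\<close> and vanishes at the origin. Integrating \<open>\<partial>\<^sub>y\<close> of the equation over \<open>[s, t]\<close> and comparing
  these two points, all terms except \<open>\<integral> \<partial>\<^sub>y\<Delta>u\<close> and the nonlinear one are \<open>O(h)\<close>; hence the integral of the
  \<open>\<beta>\<close>-seminorm exceeds \<open>c h\<^bsup>\<alpha>-\<beta>\<^esup> - C\<close> for every small \<open>h\<close>.

  For the regularity, \<open>\<nabla>(|u|\<^sup>\<alpha>u)\<close> is \<open>\<alpha>\<close>-Hoelder in space, because \<open>z \<mapsto> |z|\<^sup>\<alpha>z\<close> has an \<open>\<alpha>\<close>-Hoelder derivative.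
  Two further derivatives fall on the heat kernel and cost \<open>\<tau>\<^bsup>\<alpha>/2-1\<^esup>\<close>, which is integrable.
\<close>

section \<open>Directional derivatives\<close>

text \<open>Oddness is built in: the contraction runs in the closed space of odd functions in
  \<open>C0\<close>, and the maximal solution agrees with its fixed point near time 0. The
  comparison of two points uses the equation for the y-derivative of u integrated in time. It is
  reached without a time derivative of u: only the heat semigroup is differentiated in time, Fubini
  carries the result through Duhamel's integral, and the identity for u is then differentiated in
  space under the time integral. Each derivative on the kernel costs
  \<open>\<tau> powr (-1/2)\<close>, so two of them just fail to be integrable. Second derivatives
  of the kernel have mean zero, so the value of the source at the evaluation point can be
  subtracted, and its Hoelder exponent supplies the missing power. Moving the first derivative to
  the source presupposes that u is differentiable, hence the stepwise ascent. Derivatives are taken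
  along lines in arbitrary directions: this matches \<open>partial\<close>, turns the transfer from
  kernel to source into uniqueness of derivatives, and suits the time derivative of the semigroup,
  which moves along the integration variable.\<close>

definition dir_deriv :: "'a::real_normed_vector \<Rightarrow> ('a \<Rightarrow> 'b::real_normed_vector) \<Rightarrow> ('a \<Rightarrow> 'b) \<Rightarrow> bool" where
  "dir_deriv v f f' \<longleftrightarrow> (\<forall>x. ((\<lambda>h::real. f (x + h *\<^sub>R v)) has_vector_derivative f' x) (at 0))"

lemma dir_deriv_at:
  assumes "dir_deriv v f f'"
  shows "((\<lambda>h::real. f (x + h *\<^sub>R v)) has_vector_derivative f' (x + h0 *\<^sub>R v)) (at h0 within A)"
proof -
  have "((\<lambda>h::real. f ((x + h0 *\<^sub>R v) + h *\<^sub>R v)) has_vector_derivative f' (x + h0 *\<^sub>R v)) (at (h0 - h0))"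
    using assms unfolding dir_deriv_def by auto
  then have "((\<lambda>h::real. f ((x + h0 *\<^sub>R v) + h *\<^sub>R v)) \<circ> (\<lambda>h. h - h0) has_vector_derivative 1 *\<^sub>R f' (x + h0 *\<^sub>R v)) (at h0)"
    by (intro vector_diff_chain_at) (auto intro!: derivative_eq_intros)
  moreover have "(\<lambda>h::real. f ((x + h0 *\<^sub>R v) + h *\<^sub>R v)) \<circ> (\<lambda>h. h - h0) = (\<lambda>h. f (x + h *\<^sub>R v))"
    by (auto simp: fun_eq_iff algebra_simps scaleR_diff_left)
  ultimately show ?thesis by (auto intro: has_vector_derivative_at_within)
qed

lemma dir_deriv_unique:
  assumes "dir_deriv v f f'" "dir_deriv v f f''" shows "f' = f''"
  using assms unfolding dir_deriv_def by (auto intro!: ext vector_derivative_unique_at)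

lemma dir_deriv_bound:
  fixes f :: "'a::real_normed_vector \<Rightarrow> 'b::real_normed_vector"
  assumes "dir_deriv v f f'" "\<And>x. norm (f' x) \<le> B"
  shows "norm (f (x + h *\<^sub>R v) - f x) \<le> B * \<bar>h\<bar>"
proof -
  have "norm ((\<lambda>h. f (x + h *\<^sub>R v)) h - (\<lambda>h. f (x + h *\<^sub>R v)) 0) \<le> B * norm (h - 0)"
  proof (rule differentiable_bound[where S = UNIV and f' = "\<lambda>h y. y *\<^sub>R f' (x + h *\<^sub>R v)"])
    show "((\<lambda>h. f (x + h *\<^sub>R v)) has_derivative (\<lambda>y. y *\<^sub>R f' (x + h *\<^sub>R v))) (at h within UNIV)" for h
      using dir_deriv_at[OF assms(1)] by (simp add: has_vector_derivative_def)
    show "onorm (\<lambda>y. y *\<^sub>R f' (x + h *\<^sub>R v)) \<le> B" for h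
      by (rule onorm_le) (use assms(2) in \<open>auto simp: mult.commute[of B] intro!: mult_left_mono\<close>)
  qed auto
  then show ?thesis by simp
qed

text \<open>This is the form of differentiability to which dominated convergence applies.\<close>

lemma has_vector_derivative_iff_quotient:
  fixes f :: "real \<Rightarrow> 'b::real_normed_vector"
  shows "(f has_vector_derivative f') (at h0) \<longleftrightarrow> ((\<lambda>h. (1 / (h - h0)) *\<^sub>R (f h - f h0)) \<longlongrightarrow> f') (at h0)"
proof -
  have e: "norm (f h - f h0 - (h - h0) *\<^sub>R f') / norm (h - h0) = norm ((1 / (h - h0)) *\<^sub>R (f h - f h0) - f')"
    if "h \<noteq> h0" for h
  proof -
    have "(1 / (h - h0)) *\<^sub>R (f h - f h0) - f' = (1 / (h - h0)) *\<^sub>R (f h - f h0 - (h - h0) *\<^sub>R f')"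
      using that by (simp add: scaleR_diff_right)
    then show ?thesis by (simp add: divide_inverse mult.commute)
  qed
  have "(f has_vector_derivative f') (at h0) \<longleftrightarrow>
      ((\<lambda>h. norm (f h - f h0 - (h - h0) *\<^sub>R f') / norm (h - h0)) \<longlongrightarrow> 0) (at h0)"
    unfolding has_vector_derivative_def has_derivative_iff_norm by (simp add: bounded_linear_scaleR_left)
  also have "\<dots> \<longleftrightarrow> ((\<lambda>h. norm ((1 / (h - h0)) *\<^sub>R (f h - f h0) - f')) \<longlongrightarrow> 0) (at h0)"
    by (rule Lim_cong_within[OF refl refl refl]) (rule e)
  also have "\<dots> \<longleftrightarrow> ((\<lambda>h. (1 / (h - h0)) *\<^sub>R (f h - f h0)) \<longlongrightarrow> f') (at h0)"
    by (simp only: tendsto_norm_zero_iff LIM_zero_iff)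
  finally show ?thesis .
qed

text \<open>The mean value inequality bounds every difference quotient by the bound \<open>g\<close>
  of the derivatives, so dominated convergence along an arbitrary sequence gives the limit.
  Measurability of \<open>f' h0\<close> is obtained rather than assumed: it is a limit of difference
  quotients.\<close>

lemma has_vector_derivative_integral_dominated:
  fixes f f' :: "real \<Rightarrow> 'a \<Rightarrow> 'b::{banach, second_countable_topology}"
  assumes "\<delta> > 0"
    and f: "\<And>h. \<bar>h - h0\<bar> < \<delta> \<Longrightarrow> integrable M (f h)"
    and f': "\<And>h w. \<bar>h - h0\<bar> < \<delta> \<Longrightarrow> ((\<lambda>h. f h w) has_vector_derivative f' h w) (at h)"
    and bnd: "\<And>h w. \<bar>h - h0\<bar> < \<delta> \<Longrightarrow> norm (f' h w) \<le> g w"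
    and g: "integrable M g"
  shows "((\<lambda>h. \<integral>w. f h w \<partial>M) has_vector_derivative (\<integral>w. f' h0 w \<partial>M)) (at h0)"
proof -
  have "((\<lambda>h. (1 / (h - h0)) *\<^sub>R ((\<integral>w. f h w \<partial>M) - (\<integral>w. f h0 w \<partial>M))) \<longlongrightarrow> (\<integral>w. f' h0 w \<partial>M)) (at h0)"
    unfolding tendsto_at_iff_sequentially
  proof (intro allI impI)
    fix X :: "nat \<Rightarrow> real" assume X: "\<forall>i. X i \<in> UNIV - {h0}" "X \<longlonglongrightarrow> h0"
    have "eventually (\<lambda>i. \<bar>X i - h0\<bar> < \<delta>) sequentially"
      using X(2) assms(1) by (auto simp: tendsto_iff dist_real_def)
    then obtain N where N: "\<And>i. i \<ge> N \<Longrightarrow> \<bar>X i - h0\<bar> < \<delta>" by (auto simp: eventually_sequentially)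
    \<comment> \<open>Dropping the first \<open>N\<close> terms puts the whole sequence into the
      ball where the hypotheses hold; \<open>LIMSEQ_offset\<close> restores them at the end.\<close>
    define Y where "Y i = X (i + N)" for i
    have Y: "\<bar>Y i - h0\<bar> < \<delta>" "Y i \<noteq> h0" for i using N[of "i+N"] X(1) by (auto simp: Y_def)
    have Yl: "Y \<longlonglongrightarrow> h0" unfolding Y_def by (rule LIMSEQ_ignore_initial_segment[OF X(2)])
    have lim: "(\<lambda>i. (1 / (Y i - h0)) *\<^sub>R (f (Y i) w - f h0 w)) \<longlonglongrightarrow> f' h0 w" for w
      using f'[of h0 w] assms(1) Y Yl
      by (auto simp: has_vector_derivative_iff_quotient tendsto_at_iff_sequentially o_def)
    have bq: "norm ((1 / (Y i - h0)) *\<^sub>R (f (Y i) w - f h0 w)) \<le> g w" for i w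
    proof -
      have "norm (f (Y i) w - f h0 w) \<le> g w * norm (Y i - h0)"
      proof (rule differentiable_bound[where S = "ball h0 \<delta>" and f' = "\<lambda>h y. y *\<^sub>R f' h w"])
        show "((\<lambda>h. f h w) has_derivative (\<lambda>y. y *\<^sub>R f' h w)) (at h within ball h0 \<delta>)" if "h \<in> ball h0 \<delta>" for h
          using f'[of h w] that by (auto simp: has_vector_derivative_def dist_real_def abs_minus_commute intro: has_derivative_at_withinI)
        show "onorm (\<lambda>y. y *\<^sub>R f' h w) \<le> g w" if "h \<in> ball h0 \<delta>" for h
          by (rule onorm_le) (use bnd[of h w] that in \<open>auto simp: mult.commute[of "g w"] dist_real_def abs_minus_commute intro!: mult_left_mono\<close>)
      qed (use Y[of i] assms(1) in \<open>auto simp: dist_real_def abs_minus_commute\<close>)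
      then show ?thesis using Y[of i] by (simp add: divide_le_eq mult.commute del: scaleR_diff_right)
    qed
    have meas: "(\<lambda>w. (1 / (Y i - h0)) *\<^sub>R (f (Y i) w - f h0 w)) \<in> borel_measurable M" for i
      using f[OF Y(1)] f[of h0] assms(1) by (intro borel_measurable_scaleR borel_measurable_diff) auto
    have "(\<lambda>i. \<integral>w. (1 / (Y i - h0)) *\<^sub>R (f (Y i) w - f h0 w) \<partial>M) \<longlonglongrightarrow> (\<integral>w. f' h0 w \<partial>M)"
    proof (rule integral_dominated_convergence[where w = g])
      show "(\<lambda>w. f' h0 w) \<in> borel_measurable M"
        by (rule borel_measurable_LIMSEQ_metric[OF meas lim])
    qed (use meas g lim bq in auto)
    also have "(\<lambda>i. \<integral>w. (1 / (Y i - h0)) *\<^sub>R (f (Y i) w - f h0 w) \<partial>M) =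
       (\<lambda>i. (1 / (Y i - h0)) *\<^sub>R ((\<integral>w. f (Y i) w \<partial>M) - (\<integral>w. f h0 w \<partial>M)))"
      using f[OF Y(1)] f[of h0] assms(1) by (subst integral_scaleR_right) (auto simp: Bochner_Integration.integral_diff)
    finally have "(\<lambda>i. ((\<lambda>h. (1 / (h - h0)) *\<^sub>R ((\<integral>w. f h w \<partial>M) - (\<integral>w. f h0 w \<partial>M))) \<circ> X) (i + N)) \<longlonglongrightarrow> (\<integral>w. f' h0 w \<partial>M)"
      by (simp add: Y_def o_def)
    then show "((\<lambda>h. (1 / (h - h0)) *\<^sub>R ((\<integral>w. f h w \<partial>M) - (\<integral>w. f h0 w \<partial>M))) \<circ> X) \<longlonglongrightarrow> (\<integral>w. f' h0 w \<partial>M)"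
      by (rule LIMSEQ_offset)
  qed
  then show ?thesis by (simp add: has_vector_derivative_iff_quotient)
qed

section \<open>Gaussian weights\<close>

definition kern :: "real^'n \<Rightarrow> real" where "kern = heat_kernel 1"

text \<open>\<open>kern1 v\<close> and \<open>kern2 v v'\<close> are the derivatives of \<open>kern\<close> in the directions \<open>v\<close>, and \<open>v\<close>, \<open>v'\<close>.\<close>

definition kern1 :: "real^'n \<Rightarrow> real^'n \<Rightarrow> real" where
  "kern1 v w = - ((w \<bullet> v) / 2) * kern w"

definition kern2 :: "real^'n \<Rightarrow> real^'n \<Rightarrow> real^'n \<Rightarrow> real" where
  "kern2 v v' w = ((w \<bullet> v) * (w \<bullet> v') / 4 - (v \<bullet> v') / 2) * kern w"

lemma kern_eq: "kern (w::real^'n) = (4 * pi) powr (- (real CARD('n) / 2)) * exp (- (norm w)\<^sup>2 / 4)"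
  by (simp add: kern_def heat_kernel_def)

lemma kern_pos: "kern w > 0" by (simp add: kern_eq)

lemma continuous_kern: "continuous_on A kern" "continuous_on A (kern1 v)" "continuous_on A (kern2 v v')"
  unfolding kern2_def[abs_def] kern1_def[abs_def] kern_eq[abs_def] by (intro continuous_intros; simp)+

lemma integrable_kern: "integrable lborel (kern :: real^'n \<Rightarrow> real)"
  unfolding kern_def by (rule integrable_heat_kernel) simp

text \<open>The kernel is a product of centred normal densities of variance 2, one per coordinate,
  so the integral factorises.\<close>

lemma integral_kern: "(\<integral>w. kern w \<partial>(lborel :: (real^'n) measure)) = 1"
proof -
  interpret product_sigma_finite "\<lambda>_::real^'n. lborel :: real measure"
    by standard
  let ?g = "normal_density 0 (sqrt 2)"
  have k: "kern (\<Sum>b\<in>Basis. x b *\<^sub>R b) = (\<Prod>b\<in>(Basis :: (real^'n) set). ?g (x b))" for x :: "real^'n \<Rightarrow> real"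
  proof -
    have "(norm (\<Sum>b\<in>Basis. x b *\<^sub>R b))\<^sup>2 = (\<Sum>b\<in>(Basis :: (real^'n) set). (x b)\<^sup>2)"
      unfolding power2_norm_eq_inner by (subst euclidean_inner) (simp add: power2_eq_square)
    moreover have "(\<Prod>b\<in>(Basis :: (real^'n) set). ?g (x b)) =
        (1 / sqrt (4 * pi)) ^ CARD('n) * exp (- (\<Sum>b\<in>(Basis :: (real^'n) set). (x b)\<^sup>2) / 4)"
      by (simp add: normal_density_def prod.distrib exp_sum[symmetric] sum_negf sum_divide_distrib power_divide prod_dividef)
    moreover have "(1 / sqrt (4 * pi)) ^ CARD('n) = (4 * pi) powr (- (real CARD('n) / 2))"
      by (simp add: powr_half_sqrt[symmetric] powr_minus_divide powr_powr powr_realpow[symmetric] powr_divide power_divide)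
    ultimately show ?thesis by (simp add: kern_eq)
  qed
  have "(\<integral>w. kern w \<partial>(lborel :: (real^'n) measure)) =
      (\<integral>x. kern (\<Sum>b\<in>Basis. x b *\<^sub>R b) \<partial>(\<Pi>\<^sub>M b\<in>(Basis :: (real^'n) set). lborel))"
    by (subst lborel_eq, subst integral_distr) (auto intro!: borel_measurable_continuous_onI continuous_kern)
  also have "\<dots> = (\<Prod>b\<in>(Basis :: (real^'n) set). (\<integral>y. ?g y \<partial>lborel))"
    unfolding k by (rule product_integral_prod) (auto intro: integrable_normal_density)
  also have "\<dots> = 1" by (simp add: integral_normal_density)
  finally show ?thesis .
qed

lemma kern_deriv: "((\<lambda>a. kern (w + a *\<^sub>R v)) has_real_derivative kern1 v (w + a *\<^sub>R v)) (at a)"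
  "((\<lambda>a. kern1 v (w + a *\<^sub>R v')) has_real_derivative kern2 v v' (w + a *\<^sub>R v')) (at a)"
proof -
  have n: "(norm (w + a *\<^sub>R v))\<^sup>2 = w \<bullet> w + 2 * a * (w \<bullet> v) + a * a * (v \<bullet> v)" for a v
    by (simp add: power2_norm_eq_inner inner_add_left inner_add_right inner_commute algebra_simps)
  show 1: "((\<lambda>a. kern (w + a *\<^sub>R v)) has_real_derivative kern1 v (w + a *\<^sub>R v)) (at a)" for v
    unfolding kern_eq kern1_def n
    by (auto intro!: derivative_eq_intros simp: inner_add_left field_simps)
  show "((\<lambda>a. kern1 v (w + a *\<^sub>R v')) has_real_derivative kern2 v v' (w + a *\<^sub>R v')) (at a)"
  proof -
    have e: "- (b / 2) * k + - (c / 2) * k * - (d / 2) = (d * c / 4 - b / 2) * k" for b c d k :: real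
      by (simp add: field_simps)
    have "((\<lambda>a. - ((w + a *\<^sub>R v') \<bullet> v / 2)) has_real_derivative - (v' \<bullet> v / 2)) (at a)"
      unfolding inner_add_left inner_scaleR_left by (auto intro!: derivative_eq_intros)
    from DERIV_mult[OF this 1[of v']] have "((\<lambda>a. kern1 v (w + a *\<^sub>R v')) has_real_derivative
      - (v' \<bullet> v / 2) * kern (w + a *\<^sub>R v') + kern1 v' (w + a *\<^sub>R v') * - ((w + a *\<^sub>R v') \<bullet> v / 2)) (at a)"
      by (simp only: kern1_def)
    then show ?thesis
      by (rule DERIV_cong) (simp only: kern1_def kern2_def inner_commute[of v' v] e)
  qed
qed

text \<open>Translates of a weight by vectors of bounded length are dominated by multiples of \<open>gdom\<close>.\<close>

definition gdom :: "real^'n \<Rightarrow> real" where "gdom w = (1 + norm w) ^ 3 * exp (- (norm w)\<^sup>2 / 8)"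

text \<open>Quadratic growth accommodates two derivatives of the Gaussian. Compared with
  \<open>gdom\<close>, half of the Gaussian decay is kept in reserve for translations, and the third
  power there leaves room for one extra factor \<open>1 + norm w\<close>.\<close>

definition weight :: "real \<Rightarrow> (real^'n \<Rightarrow> real) \<Rightarrow> bool" where
  "weight C m \<longleftrightarrow> continuous_on UNIV m \<and> 0 \<le> C \<and> (\<forall>w. \<bar>m w\<bar> \<le> C * (1 + norm w) ^ 2 * exp (- (norm w)\<^sup>2 / 4))"

lemma integrable_gdom: "integrable lborel (gdom :: real^'n \<Rightarrow> real)"
proof -
  have i: "integrable lborel (\<lambda>w::real^'n. exp (- (norm w)\<^sup>2 / 16))"
  proof -
    have "integrable lborel (\<lambda>w::real^'n. heat_kernel 4 w / (16 * pi) powr (- (real CARD('n) / 2)))"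
      by (intro integrable_divide integrable_heat_kernel) auto
    then show ?thesis by (simp add: heat_kernel_def)
  qed
  \<comment> \<open>The cube is at most \<open>exp (3 * norm w)\<close>, and
    \<open>3 * r \<le> 36 + r\<^sup>2 / 16\<close> by completing the square. This costs half of the
    exponent 1/8 and leaves the heat kernel at time 4.\<close>
  have "integrable lborel (\<lambda>w::real^'n. exp 36 * exp (- (norm w)\<^sup>2 / 16))" using i by simp
  then show ?thesis
  proof (rule Bochner_Integration.integrable_bound)
    show "AE w in lborel. norm (gdom w) \<le> norm (exp 36 * exp (- (norm (w::real^'n))\<^sup>2 / 16))"
    proof (rule AE_I2)
      fix w :: "real^'n"
      let ?r = "norm w"
      have "(1 + ?r) ^ 3 \<le> exp ?r ^ 3" by (intro power_mono exp_ge_add_one_self) auto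
      also have "\<dots> = exp (3 * ?r)" by (simp flip: exp_of_nat_mult)
      also have "\<dots> \<le> exp (36 + ?r\<^sup>2 / 16)"
      proof -
        have "(?r / 4 - 6)\<^sup>2 \<ge> 0" by simp
        then show ?thesis by (simp add: power2_eq_square field_simps)
      qed
      finally have "(1 + ?r) ^ 3 * exp (- ?r\<^sup>2 / 8) \<le> exp (36 + ?r\<^sup>2 / 16) * exp (- ?r\<^sup>2 / 8)"
        by (intro mult_right_mono) auto
      also have "\<dots> = exp 36 * exp (- ?r\<^sup>2 / 16)" by (simp flip: exp_add)
      finally show "norm (gdom w) \<le> norm (exp 36 * exp (- ?r\<^sup>2 / 16))" by (simp add: gdom_def)
    qed
  qed (auto simp: gdom_def[abs_def] intro!: borel_measurable_continuous_onI continuous_intros)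
qed

lemma weight_gdom:
  assumes "weight C m" shows "\<bar>m w\<bar> * (1 + norm w) \<le> C * gdom w"
proof -
  have "\<bar>m w\<bar> * (1 + norm w) \<le> C * (1 + norm w) ^ 2 * exp (- (norm w)\<^sup>2 / 4) * (1 + norm w)"
    using assms by (intro mult_right_mono) (auto simp: weight_def)
  also have "\<dots> = C * (1 + norm w) ^ 3 * exp (- (norm w)\<^sup>2 / 4)"
    by (simp add: power2_eq_square power3_eq_cube)
  also have "\<dots> \<le> C * (1 + norm w) ^ 3 * exp (- (norm w)\<^sup>2 / 8)"
    using assms by (intro mult_left_mono) (auto simp: weight_def)
  finally show ?thesis by (simp add: gdom_def)
qed

lemma weight_gdom': assumes "weight C m" shows "\<bar>m w\<bar> \<le> C * gdom w" "\<bar>m w\<bar> * norm w \<le> C * gdom w"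
proof -
  have "\<bar>m w\<bar> * (1 + norm w) = \<bar>m w\<bar> + \<bar>m w\<bar> * norm w" by (simp add: algebra_simps)
  moreover have "\<bar>m w\<bar> * norm w \<ge> 0" by simp
  ultimately show "\<bar>m w\<bar> \<le> C * gdom w" "\<bar>m w\<bar> * norm w \<le> C * gdom w"
    using weight_gdom[OF assms, of w] by linarith+
qed

lemma weight_shift:
  assumes "weight C m" "\<bar>a\<bar> \<le> 1"
  shows "\<bar>m (w + a *\<^sub>R v)\<bar> \<le> C * (1 + norm v) ^ 2 * exp ((norm v)\<^sup>2 / 4) * gdom w"
proof -
  let ?z = "w + a *\<^sub>R v"
  have av: "norm (a *\<^sub>R v) \<le> norm v" using assms(2) by (simp add: mult_left_le_one_le)
  have 1: "1 + norm ?z \<le> (1 + norm v) * (1 + norm w)"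
  proof -
    have "norm ?z \<le> norm w + norm v" using norm_triangle_ineq[of w "a *\<^sub>R v"] av by linarith
    moreover have "norm v * norm w \<ge> 0" by simp
    moreover have "(1 + norm v) * (1 + norm w) = 1 + norm w + norm v + norm v * norm w" by (simp add: algebra_simps)
    ultimately show ?thesis by linarith
  qed
  \<comment> \<open>This is where the 8 in \<open>gdom\<close> comes from: it turns the exponent
    \<open>- (norm ?z)\<^sup>2 / 4\<close> into
    \<open>(norm v)\<^sup>2 / 4 - (norm w)\<^sup>2 / 8\<close>.\<close>
  have 2: "(norm w)\<^sup>2 \<le> 2 * (norm ?z)\<^sup>2 + 2 * (norm v)\<^sup>2"
  proof -
    have "norm w \<le> norm ?z + norm v" using norm_triangle_ineq4[of ?z "a *\<^sub>R v"] av by simp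
    then have "(norm w)\<^sup>2 \<le> (norm ?z + norm v)\<^sup>2" by (intro power_mono) auto
    also have "\<dots> \<le> 2 * (norm ?z)\<^sup>2 + 2 * (norm v)\<^sup>2"
      using zero_le_power2[of "norm ?z - norm v"] by (simp add: power2_eq_square algebra_simps)
    finally show ?thesis .
  qed
  have "\<bar>m ?z\<bar> \<le> C * (1 + norm ?z) ^ 2 * exp (- (norm ?z)\<^sup>2 / 4)"
    using assms(1) by (auto simp: weight_def)
  also have "\<dots> \<le> C * ((1 + norm v) * (1 + norm w)) ^ 2 * exp ((norm v)\<^sup>2 / 4 + (- (norm w)\<^sup>2 / 8))"
    using 1 2 assms(1) by (intro mult_mono power_mono) (auto simp: weight_def)
  also have "\<dots> = C * (1 + norm v) ^ 2 * exp ((norm v)\<^sup>2 / 4) * ((1 + norm w)^2 * exp (- (norm w)\<^sup>2 / 8))"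
    by (simp only: exp_add power_mult_distrib mult_ac)
  also have "\<dots> \<le> C * (1 + norm v) ^ 2 * exp ((norm v)\<^sup>2 / 4) * gdom w"
    unfolding gdom_def using assms(1) by (intro mult_left_mono mult_right_mono power_increasing) (auto simp: weight_def)
  finally show ?thesis .
qed

lemma weight_kern: "\<exists>C. weight C (kern :: real^'n \<Rightarrow> real)"
proof -
  have "weight ((4 * pi) powr (- (real CARD('n) / 2))) (kern :: real^'n \<Rightarrow> real)"
    unfolding weight_def
  proof (intro conjI allI)
    fix w :: "real^'n"
    have "1 \<le> (1 + norm w)^2" by (simp add: one_le_power)
    then have "(4 * pi) powr (- (real CARD('n) / 2)) * exp (- (norm w)\<^sup>2 / 4) * 1 \<le> (4 * pi) powr (- (real CARD('n) / 2)) * exp (- (norm w)\<^sup>2 / 4) * (1 + norm w)^2"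
      by (intro mult_left_mono) auto
    then show "\<bar>kern w\<bar> \<le> (4 * pi) powr (- (real CARD('n) / 2)) * (1 + norm w)^2 * exp (- (norm w)\<^sup>2 / 4)"
      by (simp add: kern_eq mult_ac)
  qed (auto intro: continuous_kern)
  then show ?thesis ..
qed

lemma weight_poly_kern:
  fixes m :: "real^'n \<Rightarrow> real"
  assumes m: "continuous_on UNIV m" "\<And>w. \<bar>m w\<bar> \<le> B * (1 + norm w)^2 * kern w" "B \<ge> 0"
  shows "\<exists>C. weight C m"
proof -
  let ?c = "(4 * pi) powr (- (real CARD('n) / 2))"
  have "weight (B * ?c) m"
    unfolding weight_def
  proof (intro conjI allI)
    show "\<bar>m w\<bar> \<le> B * ?c * (1 + norm w)\<^sup>2 * exp (- (norm w)\<^sup>2 / 4)" for w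
      using m(2)[of w] by (simp only: kern_eq mult_ac)
  qed (use m in auto)
  then show ?thesis ..
qed

lemma weight_kern1: "\<exists>C. weight C (kern1 (v::real^'n))"
proof (rule weight_poly_kern[where B = "norm v"])
  fix w :: "real^'n"
  have "\<bar>w \<bullet> v\<bar> / 2 \<le> norm v * (1 + norm w)^2"
  proof -
    have "\<bar>w \<bullet> v\<bar> \<le> norm w * norm v" by (rule Cauchy_Schwarz_ineq2)
    also have "\<dots> \<le> (1 + norm w)^2 * norm v" by (intro mult_right_mono) (auto simp: power2_eq_square algebra_simps)
    finally show ?thesis by (simp add: mult.commute)
  qed
  then have "\<bar>w \<bullet> v\<bar> / 2 * kern w \<le> norm v * (1 + norm w)^2 * kern w" using kern_pos[of w] by (intro mult_right_mono) auto
  then show "\<bar>kern1 v w\<bar> \<le> norm v * (1 + norm w)^2 * kern w"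
    using kern_pos[of w] by (simp add: kern1_def abs_mult)
qed (auto intro: continuous_kern)

lemma weight_kern2: "\<exists>C. weight C (kern2 (v::real^'n) v')"
proof (rule weight_poly_kern[where B = "norm v * norm v'"])
  fix w :: "real^'n"
  have "\<bar>(w \<bullet> v) * (w \<bullet> v') / 4 - (v \<bullet> v') / 2\<bar> \<le> norm v * norm v' * (1 + norm w)^2"
  proof -
    have "\<bar>(w \<bullet> v) * (w \<bullet> v')\<bar> \<le> (norm w * norm v) * (norm w * norm v')"
      unfolding abs_mult by (intro mult_mono Cauchy_Schwarz_ineq2) auto
    moreover have "\<bar>v \<bullet> v'\<bar> \<le> norm v * norm v'" by (rule Cauchy_Schwarz_ineq2)
    moreover have "norm v * norm v' * (1 + norm w)^2 = (norm w * norm v) * (norm w * norm v') + norm v * norm v' + 2 * (norm w * (norm v * norm v'))"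
      by (simp add: power2_eq_square algebra_simps)
    moreover have "norm w * (norm v * norm v') \<ge> 0" "(norm w * norm v) * (norm w * norm v') \<ge> 0" by simp_all
    ultimately show ?thesis by linarith
  qed
  then show "\<bar>kern2 v v' w\<bar> \<le> norm v * norm v' * (1 + norm w)^2 * kern w"
    using kern_pos[of w] by (simp add: kern2_def abs_mult)
qed (auto intro: continuous_kern)

lemma weight_integrable:
  assumes "weight C m"
  shows "integrable lborel m" "integrable lborel (\<lambda>w. \<bar>m w\<bar>)" "integrable lborel (\<lambda>w. \<bar>m w\<bar> * norm w)"
    "integrable lborel (\<lambda>w. \<bar>m w\<bar> * (1 + norm w))"
proof -
  have [measurable]: "m \<in> borel_measurable borel"
    using assms by (auto simp: weight_def intro: borel_measurable_continuous_onI)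
  have g: "integrable lborel (\<lambda>w. C * gdom w)" by (intro integrable_mult_right integrable_gdom)
  have b: "norm x \<le> norm (C * gdom w)" if "\<bar>x\<bar> \<le> C * gdom w" for x :: real and w using that by simp
  show "integrable lborel m" "integrable lborel (\<lambda>w. \<bar>m w\<bar>)" "integrable lborel (\<lambda>w. \<bar>m w\<bar> * norm w)"
    "integrable lborel (\<lambda>w. \<bar>m w\<bar> * (1 + norm w))"
    by (rule Bochner_Integration.integrable_bound[OF g]; (intro AE_I2 b)?;
      use weight_gdom'[OF assms] weight_gdom[OF assms] in \<open>auto simp: abs_mult\<close>)+
qed

section \<open>The heat semigroup in parabolic scaling\<close>

text \<open>After the substitution \<open>y = x - sqrt \<tau> w\<close> the heat semigroup is \<open>gconv kern\<close>, which also makes sense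
  at \<open>\<tau> = 0\<close>.\<close>

definition gconv :: "(real^'n \<Rightarrow> real) \<Rightarrow> (real^'n \<Rightarrow> complex) \<Rightarrow> real \<Rightarrow> real^'n \<Rightarrow> complex" where
  "gconv m f \<tau> x = (\<integral>w. m w *\<^sub>R f (x - sqrt \<tau> *\<^sub>R w) \<partial>lborel)"

lemma gconv_integrable:
  fixes f :: "real^'n \<Rightarrow> complex"
  assumes m: "weight C m" and f: "continuous_on UNIV f" "\<And>x. norm (f x) \<le> M"
  shows "integrable lborel (\<lambda>w. m w *\<^sub>R f (x - c *\<^sub>R w))"
proof (rule Bochner_Integration.integrable_bound)
  show "integrable lborel (\<lambda>w. M * \<bar>m w\<bar>)" using weight_integrable[OF m] by simp
  show "AE w in lborel. norm (m w *\<^sub>R f (x - c *\<^sub>R w)) \<le> norm (M * \<bar>m w\<bar>)"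
    using f(2) by (auto simp: mult.commute[of M] intro!: AE_I2 mult_left_mono order_trans[OF f(2) abs_ge_self] simp: abs_mult)
  show "(\<lambda>w. m w *\<^sub>R f (x - c *\<^sub>R w)) \<in> borel_measurable lborel"
    using m unfolding measurable_lborel1 measurable_lborel2
    by (intro borel_measurable_continuous_onI continuous_intros continuous_on_compose2[OF f(1)]) (auto simp: weight_def)
qed

lemma gconv_bound:
  assumes m: "weight C m" and f: "continuous_on UNIV f" "\<And>x. norm (f x) \<le> M"
  shows "norm (gconv m f \<tau> x) \<le> M * (\<integral>w. \<bar>m w\<bar> \<partial>lborel)"
proof -
  have "norm (gconv m f \<tau> x) \<le> (\<integral>w. M * \<bar>m w\<bar> \<partial>lborel)"
    unfolding gconv_def
    by (rule Bochner_Integration.integral_norm_bound_integral[OF gconv_integrable[OF m f]])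
       (use weight_integrable[OF m] f(2) in \<open>auto simp: mult.commute[of M] intro!: mult_left_mono\<close>)
  then show ?thesis by simp
qed

text \<open>Since \<open>m\<close> has mean zero, the constant \<open>f x\<close> can be subtracted
  under the integral. What remains is an increment of \<open>f\<close> over the distance
  \<open>sqrt \<tau> * norm w\<close>, which yields the factor
  \<open>\<tau> powr (l / 2)\<close>.\<close>

lemma gconv_holder_bound:
  assumes m: "weight C m" and f: "continuous_on UNIV f" "\<And>x. norm (f x) \<le> M"
    and h: "\<And>x y. norm (f x - f y) \<le> H * norm (x - y) powr l" and l: "0 < l" "l \<le> 1"
    and m0: "(\<integral>w. m w \<partial>lborel) = 0" and "\<tau> \<ge> 0"
  shows "norm (gconv m f \<tau> x) \<le> H * \<tau> powr (l / 2) * (\<integral>w. \<bar>m w\<bar> * (1 + norm w) \<partial>lborel)"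
proof -
  \<comment> \<open>Two points at distance 1 force the Hoelder constant to be nonnegative.\<close>
  have H: "H \<ge> 0" using order_trans[OF norm_ge_zero h[of "axis undefined 1" 0]] by (simp add: norm_axis_1)
  have e: "gconv m f \<tau> x = (\<integral>w. m w *\<^sub>R (f (x - sqrt \<tau> *\<^sub>R w) - f x) \<partial>lborel)"
  proof -
    have "(\<integral>w. m w *\<^sub>R (f (x - sqrt \<tau> *\<^sub>R w) - f x) \<partial>lborel) = gconv m f \<tau> x - (\<integral>w. m w *\<^sub>R f x \<partial>lborel)"
      unfolding gconv_def scaleR_diff_right
      using weight_integrable[OF m] by (intro Bochner_Integration.integral_diff gconv_integrable[OF m f]) auto
    also have "(\<integral>w. m w *\<^sub>R f x \<partial>lborel) = 0" using weight_integrable[OF m] by (simp add: m0)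
    finally show ?thesis by simp
  qed
  have i: "integrable lborel (\<lambda>w. m w *\<^sub>R (f (x - sqrt \<tau> *\<^sub>R w) - f x))"
    unfolding scaleR_diff_right using weight_integrable[OF m] by (intro Bochner_Integration.integrable_diff gconv_integrable[OF m f]) auto
  have b: "norm (m w *\<^sub>R (f (x - sqrt \<tau> *\<^sub>R w) - f x)) \<le> H * \<tau> powr (l / 2) * (\<bar>m w\<bar> * (1 + norm w))" for w
  proof -
    have "norm (f (x - sqrt \<tau> *\<^sub>R w) - f x) \<le> H * (sqrt \<tau> * norm w) powr l"
      using h[of "x - sqrt \<tau> *\<^sub>R w" x] \<open>\<tau> \<ge> 0\<close> by simp
    also have "(sqrt \<tau> * norm w) powr l = \<tau> powr (l / 2) * norm w powr l"
      using \<open>\<tau> \<ge> 0\<close> by (simp add: powr_mult powr_half_sqrt[symmetric] powr_powr)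
    also have "norm w powr l \<le> (1 + norm w) powr 1"
      using l by (intro order_trans[OF powr_mono2[of l "norm w" "1 + norm w"] powr_mono]) auto
    finally have "norm (f (x - sqrt \<tau> *\<^sub>R w) - f x) \<le> H * (\<tau> powr (l / 2) * (1 + norm w))"
      using H by (auto simp: mult_left_mono)
    then have "\<bar>m w\<bar> * norm (f (x - sqrt \<tau> *\<^sub>R w) - f x) \<le> \<bar>m w\<bar> * (H * (\<tau> powr (l / 2) * (1 + norm w)))"
      by (rule mult_left_mono) simp
    then show ?thesis by (simp add: mult_ac)
  qed
  have "norm (gconv m f \<tau> x) \<le> (\<integral>w. H * \<tau> powr (l / 2) * (\<bar>m w\<bar> * (1 + norm w)) \<partial>lborel)"
    unfolding e by (rule Bochner_Integration.integral_norm_bound_integral[OF i _ b]) (use weight_integrable[OF m] in simp)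
  then show ?thesis by simp
qed

text \<open>The substituted form has no singular factor, so continuity extends to \<tau> = 0. It
  covers negative \<tau> as well, because \<open>sqrt\<close> is continuous on the whole
  line.\<close>

lemma gconv_continuous:
  fixes F :: "'s::metric_space \<Rightarrow> real^'n \<Rightarrow> complex"
  assumes m: "weight C m" and F: "continuous_on UNIV (\<lambda>(s, x). F s x)" "\<And>s x. norm (F s x) \<le> M"
  shows "continuous_on UNIV (\<lambda>(\<tau>, s, x). gconv m (F s) \<tau> x)"
  unfolding continuous_on_sequentially
proof (intro allI impI ballI)
  fix X :: "nat \<Rightarrow> real \<times> 's \<times> (real^'n)" and a :: "real \<times> 's \<times> (real^'n)"
  assume "(\<forall>n. X n \<in> UNIV) \<and> X \<longlonglongrightarrow> a"
  then have X: "X \<longlonglongrightarrow> a" by simp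
  obtain \<tau> s x where a: "a = (\<tau>, s, x)" by (cases a) auto
  define T S Y where "T n = fst (X n)" and "S n = fst (snd (X n))" and "Y n = snd (snd (X n))" for n
  have l: "T \<longlonglongrightarrow> \<tau>" "S \<longlonglongrightarrow> s" "Y \<longlonglongrightarrow> x"
    unfolding T_def S_def Y_def using tendsto_fst[OF X] tendsto_fst[OF tendsto_snd[OF X]] tendsto_snd[OF tendsto_snd[OF X]]
    by (auto simp: a)
  have c: "continuous_on UNIV (F s)" for s
    using continuous_on_compose2[OF F(1), of UNIV "\<lambda>x. (s, x)"] by (simp add: continuous_on_Pair continuous_on_id)
  have "(\<lambda>n. \<integral>w. m w *\<^sub>R F (S n) (Y n - sqrt (T n) *\<^sub>R w) \<partial>lborel) \<longlonglongrightarrow> (\<integral>w. m w *\<^sub>R F s (x - sqrt \<tau> *\<^sub>R w) \<partial>lborel)"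
  proof (rule integral_dominated_convergence[where w = "\<lambda>w. M * \<bar>m w\<bar>"])
    show "AE w in lborel. (\<lambda>n. m w *\<^sub>R F (S n) (Y n - sqrt (T n) *\<^sub>R w)) \<longlonglongrightarrow> m w *\<^sub>R F s (x - sqrt \<tau> *\<^sub>R w)"
    proof (rule AE_I2)
      fix w
      have "(\<lambda>n. (S n, Y n - sqrt (T n) *\<^sub>R w)) \<longlonglongrightarrow> (s, x - sqrt \<tau> *\<^sub>R w)"
        by (intro tendsto_intros l)
      from continuous_on_tendsto_compose[OF F(1) this]
      show "(\<lambda>n. m w *\<^sub>R F (S n) (Y n - sqrt (T n) *\<^sub>R w)) \<longlonglongrightarrow> m w *\<^sub>R F s (x - sqrt \<tau> *\<^sub>R w)"
        by (intro tendsto_intros) auto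
    qed
    show "AE w in lborel. norm (m w *\<^sub>R F (S n) (Y n - sqrt (T n) *\<^sub>R w)) \<le> M * \<bar>m w\<bar>" for n
      using F(2) by (auto simp: mult.commute[of M] intro!: AE_I2 mult_left_mono)
  qed (use gconv_integrable[OF m c F(2)] weight_integrable[OF m] in auto)
  then show "((\<lambda>(\<tau>, s, x). gconv m (F s) \<tau> x) \<circ> X) \<longlonglongrightarrow> (\<lambda>(\<tau>, s, x). gconv m (F s) \<tau> x) a"
    by (simp add: o_def case_prod_beta gconv_def a T_def S_def Y_def)
qed

lemma gconv_continuous':
  assumes m: "weight C m" and f: "continuous_on UNIV f" "\<And>x. norm (f x) \<le> M"
  shows "continuous_on UNIV (\<lambda>(\<tau>, x). gconv m f \<tau> x)"
proof -
  have "continuous_on UNIV (\<lambda>(\<tau>, s::real, x). gconv m f \<tau> x)"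
    by (rule gconv_continuous[OF m, where F = "\<lambda>_. f"]) (use f in \<open>auto simp: case_prod_beta intro!: continuous_on_compose2[OF f(1)] continuous_intros\<close>)
  from continuous_on_compose2[OF this, of UNIV "\<lambda>p. (fst p, 0, snd p)"] show ?thesis
    by (simp add: case_prod_beta continuous_on_Pair continuous_on_fst continuous_on_snd continuous_on_id)
qed

lemma gconv_deriv_comm:
  assumes m: "weight C m" and f: "continuous_on UNIV f" "\<And>x. norm (f x) \<le> M"
    and f': "continuous_on UNIV f'" "\<And>x. norm (f' x) \<le> M'" and d: "dir_deriv v f f'"
  shows "dir_deriv v (gconv m f \<tau>) (gconv m f' \<tau>)"
  unfolding dir_deriv_def
proof
  fix x
  have "((\<lambda>h. \<integral>w. m w *\<^sub>R f (x + h *\<^sub>R v - sqrt \<tau> *\<^sub>R w) \<partial>lborel) has_vector_derivative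
      (\<integral>w. m w *\<^sub>R f' (x + 0 *\<^sub>R v - sqrt \<tau> *\<^sub>R w) \<partial>lborel)) (at 0)"
  proof (rule has_vector_derivative_integral_dominated[where g = "\<lambda>w. M' * \<bar>m w\<bar>" and \<delta> = 1])
    show "((\<lambda>h. m w *\<^sub>R f (x + h *\<^sub>R v - sqrt \<tau> *\<^sub>R w)) has_vector_derivative m w *\<^sub>R f' (x + h *\<^sub>R v - sqrt \<tau> *\<^sub>R w)) (at h)" for w h
      using dir_deriv_at[OF d, of "x - sqrt \<tau> *\<^sub>R w" h]
      by (intro bounded_linear.has_vector_derivative[OF bounded_linear_scaleR_right]) (simp add: algebra_simps)
    show "norm (m w *\<^sub>R f' (x + h *\<^sub>R v - sqrt \<tau> *\<^sub>R w)) \<le> M' * \<bar>m w\<bar>" for w h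
      using f'(2) by (auto simp: mult.commute[of M'] intro!: mult_left_mono)
  qed (use gconv_integrable[OF m f] weight_integrable[OF m] in auto)
  then show "((\<lambda>h. gconv m f \<tau> (x + h *\<^sub>R v)) has_vector_derivative gconv m f' \<tau> x) (at 0)"
    by (simp add: gconv_def)
qed

text \<open>For \<open>\<tau> > 0\<close> the derivative falls on the weight: translating \<open>x\<close> by \<open>h v\<close> amounts to
  translating \<open>w\<close> by \<open>(h / sqrt \<tau>) v\<close>.\<close>

lemma gconv_deriv_weight:
  fixes m :: "real^'n \<Rightarrow> real"
  assumes m: "weight C m" and m': "weight C' m'"
    and mm: "\<And>w a. ((\<lambda>a. m (w + a *\<^sub>R v)) has_real_derivative m' (w + a *\<^sub>R v)) (at a)"
    and f: "continuous_on UNIV f" "\<And>x. norm (f x) \<le> M" and "\<tau> > 0"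
  shows "dir_deriv v (gconv m f \<tau>) (\<lambda>x. (1 / sqrt \<tau>) *\<^sub>R gconv m' f \<tau> x)"
  unfolding dir_deriv_def
proof
  fix x
  let ?r = "sqrt \<tau>"
  have r: "?r > 0" using \<open>\<tau> > 0\<close> by simp
  have s: "gconv m f \<tau> (x + h *\<^sub>R v) = (\<integral>w. m (w + (h / ?r) *\<^sub>R v) *\<^sub>R f (x - ?r *\<^sub>R w) \<partial>lborel)" for h
  proof -
    have [measurable]: "m \<in> borel_measurable borel" "f \<in> borel_measurable borel"
      using m f by (auto simp: weight_def intro!: borel_measurable_continuous_onI)
    have e: "lborel = distr lborel borel (\<lambda>w. (h / ?r) *\<^sub>R v + w)" by (simp add: lborel_distr_plus)
    have "gconv m f \<tau> (x + h *\<^sub>R v) = (\<integral>w. m ((h / ?r) *\<^sub>R v + w) *\<^sub>R f (x + h *\<^sub>R v - ?r *\<^sub>R ((h / ?r) *\<^sub>R v + w)) \<partial>lborel)"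
      unfolding gconv_def by (subst e, subst integral_distr) auto
    then show ?thesis using r by (simp add: algebra_simps)
  qed
  let ?K = "C' * (1 + norm v) ^ 2 * exp ((norm v)\<^sup>2 / 4)"
  have "((\<lambda>a. \<integral>w. m (w + a *\<^sub>R v) *\<^sub>R f (x - ?r *\<^sub>R w) \<partial>lborel) has_vector_derivative
      (\<integral>w. m' (w + 0 *\<^sub>R v) *\<^sub>R f (x - ?r *\<^sub>R w) \<partial>lborel)) (at 0)"
  proof (rule has_vector_derivative_integral_dominated[where \<delta> = 1 and g = "\<lambda>w. ?K * gdom w * M"])
    show "integrable lborel (\<lambda>w. m (w + a *\<^sub>R v) *\<^sub>R f (x - ?r *\<^sub>R w))" if "\<bar>a - 0\<bar> < 1" for a
    proof -
      \<comment> \<open>Translating back by \<open>a *\<^sub>R v\<close> removes the shift from the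
        weight and moves the base point instead, which reduces the claim to
        \<open>gconv_integrable\<close>.\<close>
      have "integrable (distr lborel borel (\<lambda>w. - (a *\<^sub>R v) + w)) (\<lambda>w. m (w + a *\<^sub>R v) *\<^sub>R f (x - ?r *\<^sub>R w))"
      proof (subst integrable_distr_eq)
        have [measurable]: "m \<in> borel_measurable borel" "f \<in> borel_measurable borel"
          using m f by (auto simp: weight_def intro!: borel_measurable_continuous_onI)
        show "(\<lambda>w. m (w + a *\<^sub>R v) *\<^sub>R f (x - ?r *\<^sub>R w)) \<in> borel_measurable borel" by measurable
        have "m (- (a *\<^sub>R v) + w + a *\<^sub>R v) *\<^sub>R f (x - ?r *\<^sub>R (- (a *\<^sub>R v) + w)) =
            m w *\<^sub>R f ((x + ?r *\<^sub>R a *\<^sub>R v) - ?r *\<^sub>R w)" for w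
          by (simp add: algebra_simps)
        then show "integrable lborel (\<lambda>w. m (- (a *\<^sub>R v) + w + a *\<^sub>R v) *\<^sub>R f (x - ?r *\<^sub>R (- (a *\<^sub>R v) + w)))"
          using gconv_integrable[OF m f] by presburger
      qed simp
      then show ?thesis by (simp only: lborel_distr_plus)
    qed
    show "((\<lambda>a. m (w + a *\<^sub>R v) *\<^sub>R f (x - ?r *\<^sub>R w)) has_vector_derivative m' (w + a *\<^sub>R v) *\<^sub>R f (x - ?r *\<^sub>R w)) (at a)" for a w
      using has_vector_derivative_scaleR[OF mm[of w a] has_vector_derivative_const[of "f (x - ?r *\<^sub>R w)"]] by simp
    show "norm (m' (w + a *\<^sub>R v) *\<^sub>R f (x - ?r *\<^sub>R w)) \<le> ?K * gdom w * M" if "\<bar>a - 0\<bar> < 1" for a w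
      using weight_shift[OF m', of a w v] that f(2)[of "x - ?r *\<^sub>R w"]
      by (auto intro!: mult_mono order_trans[OF abs_ge_zero weight_shift[OF m', of a w v]])
    show "integrable lborel (\<lambda>w. ?K * gdom w * M)" by (intro integrable_mult_left integrable_mult_right integrable_gdom)
  qed auto
  then have 1: "((\<lambda>a. \<integral>w. m (w + a *\<^sub>R v) *\<^sub>R f (x - ?r *\<^sub>R w) \<partial>lborel) has_vector_derivative gconv m' f \<tau> x) (at (0 / ?r))"
    by (simp add: gconv_def)
  have "((\<lambda>a. \<integral>w. m (w + a *\<^sub>R v) *\<^sub>R f (x - ?r *\<^sub>R w) \<partial>lborel) \<circ> (\<lambda>h. h / ?r) has_vector_derivative (1 / ?r) *\<^sub>R gconv m' f \<tau> x) (at 0)"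
    by (intro vector_diff_chain_at 1, unfold has_real_derivative_iff_has_vector_derivative[symmetric])
      (use r \<open>\<tau> > 0\<close> in \<open>auto intro!: derivative_eq_intros simp: sqrt_divide_self_eq inverse_eq_divide\<close>)
  then show "((\<lambda>h. gconv m f \<tau> (x + h *\<^sub>R v)) has_vector_derivative (1 / ?r) *\<^sub>R gconv m' f \<tau> x) (at 0)"
    by (simp add: s o_def)
qed

text \<open>Convolving the constant function 1 gives a constant in \<open>x\<close>. Its derivative,
  computed on the weight, is the integral of \<open>m'\<close>.\<close>

lemma integral_weight_deriv_0:
  assumes m: "weight C m" and m': "weight C' m'"
    and mm: "\<And>w a. ((\<lambda>a. m (w + a *\<^sub>R v)) has_real_derivative m' (w + a *\<^sub>R v)) (at a)"
  shows "(\<integral>w. m' w \<partial>lborel) = 0"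
proof -
  have "dir_deriv v (gconv m (\<lambda>_. 1) 1) (\<lambda>x. (1 / sqrt 1) *\<^sub>R gconv m' (\<lambda>_. 1) 1 x)"
    by (rule gconv_deriv_weight[OF m m' mm, where M = 1]) auto
  moreover have "dir_deriv v (gconv m (\<lambda>_. 1) 1) (\<lambda>x. 0)"
    by (auto simp: dir_deriv_def gconv_def)
  ultimately have "(\<lambda>x. (1 / sqrt 1) *\<^sub>R gconv m' (\<lambda>_. 1) 1 x) = (\<lambda>x. 0)"
    by (rule dir_deriv_unique)
  from fun_cong[OF this, of 0] have "(1 / sqrt 1) *\<^sub>R gconv m' (\<lambda>_. 1) 1 0 = 0" .
  moreover have "gconv m' (\<lambda>_. 1) 1 0 = of_real (\<integral>w. m' w \<partial>lborel)"
    using weight_integrable(1)[OF m'] by (simp add: gconv_def scaleR_conv_of_real)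
  ultimately show ?thesis by simp
qed

lemma gconv_kern_0:
  fixes f :: "real^'n \<Rightarrow> complex"
  shows "gconv kern f 0 x = f x"
  using integrable_kern[where 'n='n] by (simp add: gconv_def integral_kern)

lemma heat_eq_gconv:
  fixes f :: "(real^'n) \<Rightarrow>\<^sub>C complex"
  assumes "t \<ge> 0"
  shows "apply_bcontfun (heat t f) x = gconv kern (apply_bcontfun f) t x"
proof (cases "t = 0")
  case True
  then show ?thesis by (simp add: heat_def gconv_kern_0)
next
  case False
  then have t: "t > 0" using assms by simp
  let ?N = "CARD('n)"
  have [measurable]: "heat_kernel t \<in> borel_measurable (borel :: (real^'n) measure)" "apply_bcontfun f \<in> borel_measurable borel"
    by (auto simp: heat_kernel_def[abs_def] intro!: borel_measurable_continuous_onI)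
  have e: "lborel = density (distr lborel borel (\<lambda>w. x + (- sqrt t) *\<^sub>R w)) (\<lambda>_. \<bar>- sqrt t\<bar> ^ DIM(real^'n))"
    using t by (intro lborel_affine) auto
  have "apply_bcontfun (heat t f) x = (\<integral>y. heat_kernel t (x - y) *\<^sub>R apply_bcontfun f y \<partial>lborel)"
    by (rule apply_heat[OF t])
  also have "\<dots> = (\<integral>w. (\<lambda>w. sqrt t ^ ?N * heat_kernel t (sqrt t *\<^sub>R w)) w *\<^sub>R apply_bcontfun f (x - sqrt t *\<^sub>R w) \<partial>lborel)"
    by (subst e, subst integral_density, simp, simp, simp, subst integral_distr) (use t in auto)
  also have "(\<lambda>w. sqrt t ^ ?N * heat_kernel t (sqrt t *\<^sub>R w)) = (kern :: real^'n \<Rightarrow> real)"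
  proof
    fix w :: "real^'n"
    have "sqrt t ^ ?N = t powr (real ?N / 2)"
      using t by (simp add: powr_half_sqrt[symmetric] powr_realpow[symmetric] powr_powr)
    moreover have "(4 * pi * t) powr (- (real ?N / 2)) = (4 * pi) powr (- (real ?N / 2)) * t powr (- (real ?N / 2))"
      using t by (simp add: powr_mult)
    moreover have "t powr (real ?N / 2) * t powr (- (real ?N / 2)) = 1" using t by (simp flip: powr_add)
    ultimately show "sqrt t ^ ?N * heat_kernel t (sqrt t *\<^sub>R w) = kern w" using t
      by (simp add: heat_kernel_def kern_eq power_mult_distrib)
  qed
  finally show ?thesis by (simp add: gconv_def)
qed

lemma gconv_scale: "gconv m (\<lambda>z. c *\<^sub>R g z) \<tau> x = c *\<^sub>R gconv m g \<tau> x"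
  unfolding gconv_def scaleR_left_commute[of _ c] by (simp only: scaleR_conv_of_real[of c] integral_mult_right_zero)

lemma gconv_sum:
  fixes f :: "'i \<Rightarrow> real^'n \<Rightarrow> complex"
  assumes "\<And>i. i \<in> I \<Longrightarrow> weight (C i) (m i)" "\<And>i. i \<in> I \<Longrightarrow> continuous_on UNIV (f i)" "\<And>i x. i \<in> I \<Longrightarrow> norm (f i x) \<le> M i"
  shows "(\<integral>w. (\<Sum>i\<in>I. m i w *\<^sub>R f i (x - sqrt \<tau> *\<^sub>R w)) \<partial>lborel) = (\<Sum>i\<in>I. gconv (m i) (f i) \<tau> x)"
  unfolding gconv_def by (rule Bochner_Integration.integral_sum) (rule gconv_integrable[OF assms])

text \<open>As \<open>x - sqrt \<tau> w\<close> moves along the direction \<open>w\<close>, the chain rule in \<open>\<tau>\<close> only needs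
  directional derivatives.\<close>

lemma gconv_time_deriv:
  fixes f :: "real^'n \<Rightarrow> complex"
  assumes f: "continuous_on UNIV f" "\<And>x. norm (f x) \<le> M"
    and d: "\<And>v. dir_deriv v f (f' v)"
    and lin: "\<And>v x. f' v x = (\<Sum>i\<in>UNIV. (v $ i) *\<^sub>R f' (axis i 1) x)"
    and f': "\<And>v. continuous_on UNIV (f' v)" "\<And>i x. norm (f' (axis i 1) x) \<le> M'"
    and "\<tau> > 0"
  shows "((\<lambda>\<tau>. gconv kern f \<tau> x) has_vector_derivative
     (\<Sum>i\<in>UNIV. (1 / sqrt \<tau>) *\<^sub>R gconv (kern1 (axis i 1)) (f' (axis i 1)) \<tau> x)) (at \<tau>)"
proof -
  obtain C where C: "weight C (kern :: real^'n \<Rightarrow> real)" using weight_kern by blast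
  have M': "M' \<ge> 0" using order_trans[OF norm_ge_zero f'(2)] .
  have nb: "norm (f' w x) \<le> real CARD('n) * M' * norm w" for w x
  proof -
    have "norm (f' w x) \<le> (\<Sum>i\<in>UNIV. norm ((w $ i) *\<^sub>R f' (axis i 1) x))"
      by (subst lin) (rule norm_sum)
    also have "\<dots> \<le> (\<Sum>i\<in>(UNIV::'n set). norm w * M')"
      using component_le_norm_cart[of w] f'(2) by (intro sum_mono) (auto intro!: mult_mono)
    finally show ?thesis by (simp add: mult_ac)
  qed
  let ?G = "\<lambda>\<tau> w. kern w *\<^sub>R (- (1 / (2 * sqrt \<tau>)) *\<^sub>R f' w (x - sqrt \<tau> *\<^sub>R w))"
  \<comment> \<open>For \<open>s\<close> within \<tau>/2 of \<tau>, \<open>s\<close> stays above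
    \<tau>/2, so the derivative of \<open>sqrt\<close> is bounded and the remaining factor
    \<open>norm w\<close> is absorbed by the Gaussian.\<close>
  let ?B = "real CARD('n) * M' / sqrt (\<tau> / 2)"
  have d1: "((\<lambda>\<tau>. \<integral>w. kern w *\<^sub>R f (x - sqrt \<tau> *\<^sub>R w) \<partial>lborel) has_vector_derivative (\<integral>w. ?G \<tau> w \<partial>lborel)) (at \<tau>)"
  proof (rule has_vector_derivative_integral_dominated[where \<delta> = "\<tau> / 2" and g = "\<lambda>w. ?B * (\<bar>kern w\<bar> * norm w)"])
    fix s w assume "\<bar>s - \<tau>\<bar> < \<tau> / 2"
    then have s: "s > \<tau> / 2" using \<open>\<tau> > 0\<close> by linarith
    then have s0: "s > 0" using \<open>\<tau> > 0\<close> by linarith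
    have "((\<lambda>h. f (x + h *\<^sub>R w)) \<circ> (\<lambda>s. - sqrt s) has_vector_derivative (- (1 / (2 * sqrt s))) *\<^sub>R f' w (x + (- sqrt s) *\<^sub>R w)) (at s)"
    proof (rule vector_diff_chain_at)
      show "((\<lambda>s. - sqrt s) has_vector_derivative - (1 / (2 * sqrt s))) (at s)"
        using s0 unfolding has_real_derivative_iff_has_vector_derivative[symmetric]
        by (auto intro!: derivative_eq_intros simp: field_simps)
      show "((\<lambda>h. f (x + h *\<^sub>R w)) has_vector_derivative f' w (x + - sqrt s *\<^sub>R w)) (at (- sqrt s))"
        by (rule dir_deriv_at[OF d])
    qed
    then show "((\<lambda>\<tau>. kern w *\<^sub>R f (x - sqrt \<tau> *\<^sub>R w)) has_vector_derivative ?G s w) (at s)"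
      by (intro bounded_linear.has_vector_derivative[OF bounded_linear_scaleR_right]) (simp add: o_def)
    have "norm (?G s w) = \<bar>kern w\<bar> * ((1 / (2 * sqrt s)) * norm (f' w (x - sqrt s *\<^sub>R w)))"
      using s0 by simp
    also have "\<dots> \<le> \<bar>kern w\<bar> * ((1 / sqrt (\<tau> / 2)) * (real CARD('n) * M' * norm w))"
    proof (intro mult_left_mono mult_mono nb)
      have "sqrt (\<tau> / 2) \<le> 2 * sqrt s" using s s0 real_sqrt_le_mono[of "\<tau> / 2" s] real_sqrt_ge_zero[of s] by linarith
      then show "1 / (2 * sqrt s) \<le> 1 / sqrt (\<tau> / 2)" using \<open>\<tau> > 0\<close> by (intro divide_left_mono) (use s0 in auto)
    qed (use \<open>\<tau> > 0\<close> in auto)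
    also have "\<dots> = ?B * (\<bar>kern w\<bar> * norm w)" by (simp add: field_simps)
    finally show "norm (?G s w) \<le> ?B * (\<bar>kern w\<bar> * norm w)" .
  qed (use \<open>\<tau> > 0\<close> gconv_integrable[OF C f] weight_integrable(3)[OF C] in auto)
  \<comment> \<open>By linearity \<open>f' w\<close> splits into components with coefficients
    \<open>w $ i\<close>, and \<open>w $ i * kern w\<close> equals
    \<open>- 2 * kern1 (axis i 1) w\<close>. The 2 cancels the one from the derivative of
    \<open>sqrt\<close>.\<close>
  have "(\<integral>w. ?G \<tau> w \<partial>lborel) = (\<integral>w. (\<Sum>i\<in>UNIV. kern1 (axis i 1) w *\<^sub>R ((1 / sqrt \<tau>) *\<^sub>R f' (axis i 1) (x - sqrt \<tau> *\<^sub>R w))) \<partial>lborel)"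
  proof (rule Bochner_Integration.integral_cong)
    fix w
    show "?G \<tau> w = (\<Sum>i\<in>UNIV. kern1 (axis i 1) w *\<^sub>R ((1 / sqrt \<tau>) *\<^sub>R f' (axis i 1) (x - sqrt \<tau> *\<^sub>R w)))"
      by (subst lin) (simp add: scaleR_sum_right kern1_def inner_axis mult_ac)
  qed simp
  also have "\<dots> = (\<Sum>i\<in>UNIV. gconv (kern1 (axis i 1)) (\<lambda>z. (1 / sqrt \<tau>) *\<^sub>R f' (axis i 1) z) \<tau> x)"
  proof -
    have "\<forall>i::'n. \<exists>C. weight C (kern1 (axis i 1 :: real^'n))" using weight_kern1 by blast
    then obtain C' where C': "\<And>i::'n. weight (C' i) (kern1 (axis i 1 :: real^'n))" by metis
    show ?thesis
      by (rule gconv_sum[where C = C' and M = "\<lambda>_. (1 / sqrt \<tau>) * M'" and f = "\<lambda>i z. (1 / sqrt \<tau>) *\<^sub>R f' (axis i 1) z"])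
         (use C' f' \<open>\<tau> > 0\<close> in \<open>auto intro!: continuous_intros divide_right_mono\<close>)
  qed
  finally have d2: "(\<integral>w. ?G \<tau> w \<partial>lborel) = (\<Sum>i\<in>UNIV. gconv (kern1 (axis i 1)) (\<lambda>z. (1 / sqrt \<tau>) *\<^sub>R f' (axis i 1) z) \<tau> x)" .
  have "((\<lambda>\<tau>. gconv kern f \<tau> x) has_vector_derivative (\<integral>w. ?G \<tau> w \<partial>lborel)) (at \<tau>)"
    using d1 by (simp only: gconv_def)
  then show ?thesis unfolding d2 gconv_scale .
qed

section \<open>Duhamel integrals\<close>

lemma integrable_powr:
  assumes "\<theta> < 1"
  shows "integrable lborel (\<lambda>\<tau>::real. indicator {0<..<T} \<tau> *\<^sub>R \<tau> powr (- \<theta>))"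
proof (cases "T > 0")
  case True
  have "(\<lambda>\<tau>. \<tau> powr (- \<theta>)) integrable_on {0<..<T}"
    using integrable_on_powr_from_0[of "-\<theta>" T] True assms integrable_on_open_interval[of "\<lambda>\<tau>. \<tau> powr (- \<theta>)" 0 T] by (simp add: box_real)
  then have "(\<lambda>\<tau>. \<tau> powr (- \<theta>)) absolutely_integrable_on {0<..<T}"
    by (intro nonnegative_absolutely_integrable_1) auto
  then have "integrable lebesgue (\<lambda>\<tau>. indicator {0<..<T} \<tau> *\<^sub>R \<tau> powr (- \<theta>))" by (simp add: set_integrable_def)
  then show ?thesis by (subst (asm) integrable_completion) auto
qed auto

definition volterra :: "(real \<Rightarrow> real \<Rightarrow> 'a \<Rightarrow> complex) \<Rightarrow> real \<Rightarrow> 'a \<Rightarrow> complex" where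
  "volterra B t x = (\<integral>\<tau>. indicator {0<..<t} \<tau> *\<^sub>R B \<tau> (t - \<tau>) x \<partial>lborel)"

text \<open>In \<open>B \<tau> s x\<close> the lag \<open>\<tau> = t - s\<close> and the source time \<open>s\<close> are separate variables, so that only
  \<open>\<tau> = 0\<close> is singular.\<close>

definition admissible :: "real \<Rightarrow> real \<Rightarrow> (real \<Rightarrow> real \<Rightarrow> 'a::metric_space \<Rightarrow> complex) \<Rightarrow> bool" where
  "admissible C \<theta> B \<longleftrightarrow> \<theta> < 1 \<and> continuous_on ({0<..} \<times> UNIV) (\<lambda>(\<tau>, s, x). B \<tau> s x) \<and>
     (\<forall>\<tau> s x. \<tau> > 0 \<longrightarrow> norm (B \<tau> s x) \<le> C * \<tau> powr (- \<theta>))"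

lemma admissible_measurable:
  assumes "admissible C \<theta> B"
  shows "(\<lambda>\<tau>. indicator {0<..<t} \<tau> *\<^sub>R B \<tau> (t - \<tau>) x) \<in> borel_measurable lborel"
  unfolding measurable_lborel2
proof (rule borel_measurable_continuous_on_indicator)
  have "continuous_on ({0<..} \<times> UNIV) (\<lambda>(\<tau>, s, x). B \<tau> s x)" using assms by (simp add: admissible_def)
  then have "continuous_on {0<..<t} (\<lambda>\<tau>. (\<lambda>(\<tau>, s, x). B \<tau> s x) (\<tau>, t - \<tau>, x))"
    by (rule continuous_on_compose2) (auto intro!: continuous_intros)
  then show "continuous_on {0<..<t} (\<lambda>\<tau>. B \<tau> (t - \<tau>) x)" by simp
qed simp

lemma admissible_integrable:
  assumes "admissible C \<theta> B"
  shows "integrable lborel (\<lambda>\<tau>. indicator {0<..<t} \<tau> *\<^sub>R B \<tau> (t - \<tau>) x)"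
proof (rule Bochner_Integration.integrable_bound)
  show "integrable lborel (\<lambda>\<tau>. C * (indicator {0<..<t} \<tau> *\<^sub>R \<tau> powr (- \<theta>)))"
    using assms by (intro integrable_mult_right integrable_powr) (auto simp: admissible_def)
  show "AE \<tau> in lborel. norm (indicator {0<..<t} \<tau> *\<^sub>R B \<tau> (t - \<tau>) x) \<le> norm (C * (indicator {0<..<t} \<tau> *\<^sub>R \<tau> powr (- \<theta>)))"
    using assms by (auto intro!: AE_I2 order_trans[OF _ abs_ge_self] simp: admissible_def indicator_def simp del: abs_mult)
qed (rule admissible_measurable[OF assms])

lemma admissible_nonneg:
  assumes "admissible C \<theta> B" shows "0 \<le> C"
  using assms order_trans[OF norm_ge_zero] unfolding admissible_def
  by (metis mult.right_neutral powr_one_eq_one zero_less_one)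

lemma volterra_bound:
  assumes "admissible C \<theta> B" "t \<le> T"
  shows "norm (volterra B t x) \<le> C * (\<integral>\<tau>. indicator {0<..<T} \<tau> *\<^sub>R \<tau> powr (- \<theta>) \<partial>lborel)"
proof -
  note C = admissible_nonneg[OF assms(1)]
  have "norm (volterra B t x) \<le> (\<integral>\<tau>. C * (indicator {0<..<T} \<tau> *\<^sub>R \<tau> powr (- \<theta>)) \<partial>lborel)"
    unfolding volterra_def
  proof (rule Bochner_Integration.integral_norm_bound_integral[OF admissible_integrable[OF assms(1)]])
    show "integrable lborel (\<lambda>\<tau>. C * (indicator {0<..<T} \<tau> *\<^sub>R \<tau> powr (- \<theta>)))"
      using assms by (intro integrable_mult_right integrable_powr) (auto simp: admissible_def)
    show "norm (indicator {0<..<t} \<tau> *\<^sub>R B \<tau> (t - \<tau>) x) \<le> C * (indicator {0<..<T} \<tau> *\<^sub>R \<tau> powr (- \<theta>))" for \<tau>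
      using assms C by (auto simp: admissible_def indicator_def)
  qed
  then show ?thesis by simp
qed

text \<open>Dominated convergence in the lag: the indicator of the moving interval can fail to
  converge only at the single lag \<open>\<tau> = t\<close>, and a bound \<open>T\<close> for all
  the times provides a common majorant.\<close>

lemma volterra_continuous:
  assumes a: "admissible C \<theta> B"
  shows "continuous_on UNIV (\<lambda>(t, x). volterra B t x)"
  unfolding continuous_on_sequentially
proof (intro allI impI ballI)
  fix X :: "nat \<Rightarrow> real \<times> 'a" and p :: "real \<times> 'a"
  assume "(\<forall>n. X n \<in> UNIV) \<and> X \<longlonglongrightarrow> p"
  then have X: "X \<longlonglongrightarrow> p" by simp
  obtain t x where p: "p = (t, x)" by (cases p) auto
  define S Y where "S n = fst (X n)" and "Y n = snd (X n)" for n
  have l: "S \<longlonglongrightarrow> t" "Y \<longlonglongrightarrow> x"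
    unfolding S_def Y_def using tendsto_fst[OF X] tendsto_snd[OF X] by (auto simp: p)
  obtain T where T: "\<And>n. S n < T"
    using convergent_imp_Bseq[OF convergentI[OF l(1)]] unfolding Bseq_def
    by (metis abs_le_D1 gt_ex le_less_trans real_norm_def)
  have cont: "continuous_on ({0<..} \<times> UNIV) (\<lambda>(\<tau>, s, x). B \<tau> s x)" using a by (simp add: admissible_def)
  have "(\<lambda>n. volterra B (S n) (Y n)) \<longlonglongrightarrow> volterra B t x"
    unfolding volterra_def
  proof (rule integral_dominated_convergence[where w = "\<lambda>\<tau>. \<bar>C * (indicator {0<..<T} \<tau> *\<^sub>R \<tau> powr (- \<theta>))\<bar>"])
    show "AE \<tau> in lborel. (\<lambda>n. indicator {0<..<S n} \<tau> *\<^sub>R B \<tau> (S n - \<tau>) (Y n)) \<longlonglongrightarrow> indicator {0<..<t} \<tau> *\<^sub>R B \<tau> (t - \<tau>) x"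
    proof -
      have "(\<lambda>n. indicator {0<..<S n} \<tau> *\<^sub>R B \<tau> (S n - \<tau>) (Y n)) \<longlonglongrightarrow> indicator {0<..<t} \<tau> *\<^sub>R B \<tau> (t - \<tau>) x" if "\<tau> \<noteq> t" for \<tau>
      proof (cases "\<tau> > 0")
        case True
        have "(\<lambda>n. (\<tau>, S n - \<tau>, Y n)) \<longlonglongrightarrow> (\<tau>, t - \<tau>, x)" by (intro tendsto_intros l)
        from continuous_on_tendsto_compose[OF cont this] True
        have 1: "(\<lambda>n. B \<tau> (S n - \<tau>) (Y n)) \<longlonglongrightarrow> B \<tau> (t - \<tau>) x" by auto
        have "(\<lambda>n. indicator {0<..<S n} \<tau> :: real) \<longlonglongrightarrow> indicator {0<..<t} \<tau>"
        proof (rule tendsto_eventually)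
          show "eventually (\<lambda>n. indicator {0<..<S n} \<tau> = (indicator {0<..<t} \<tau> :: real)) sequentially"
          proof (cases "\<tau> < t")
            case True
            from order_tendstoD(1)[OF l(1) this] show ?thesis by eventually_elim (use True in \<open>auto simp: indicator_def\<close>)
          next
            case False
            with that have "t < \<tau>" by simp
            from order_tendstoD(2)[OF l(1) this] show ?thesis by eventually_elim (use False in \<open>auto simp: indicator_def\<close>)
          qed
        qed
        from tendsto_scaleR[OF this 1] show ?thesis .
      qed auto
      then show ?thesis using AE_lborel_singleton[of t] by (auto elim!: eventually_mono)
    qed
    show "integrable lborel (\<lambda>\<tau>. \<bar>C * (indicator {0<..<T} \<tau> *\<^sub>R \<tau> powr (- \<theta>))\<bar>)"
      using a by (intro integrable_abs integrable_mult_right integrable_powr) (auto simp: admissible_def)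
    show "AE \<tau> in lborel. norm (indicator {0<..<S n} \<tau> *\<^sub>R B \<tau> (S n - \<tau>) (Y n)) \<le> \<bar>C * (indicator {0<..<T} \<tau> *\<^sub>R \<tau> powr (- \<theta>))\<bar>" for n
      using a T[of n] by (auto intro!: AE_I2 order_trans[OF _ abs_ge_self] simp: admissible_def indicator_def simp del: abs_mult)
  qed (rule admissible_measurable[OF a])+
  then show "((\<lambda>(t, x). volterra B t x) \<circ> X) \<longlonglongrightarrow> (\<lambda>(t, x). volterra B t x) p"
    by (simp add: o_def case_prod_beta p S_def Y_def)
qed

text \<open>A derivative in space passes under the lag integral as soon as the differentiated
  integrand has an integrable singularity. Every gain in regularity below reduces to checking this
  for one more derivative.\<close>

lemma volterra_deriv:
  fixes B B' :: "real \<Rightarrow> real \<Rightarrow> 'a::real_normed_vector \<Rightarrow> complex"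
  assumes a: "admissible C \<theta> B" and a': "admissible C' \<theta>' B'"
    and d: "\<And>\<tau> s. \<tau> > 0 \<Longrightarrow> dir_deriv v (B \<tau> s) (B' \<tau> s)"
  shows "dir_deriv v (volterra B t) (volterra B' t)"
  unfolding dir_deriv_def
proof
  fix x
  have "((\<lambda>h. \<integral>\<tau>. indicator {0<..<t} \<tau> *\<^sub>R B \<tau> (t - \<tau>) (x + h *\<^sub>R v) \<partial>lborel) has_vector_derivative
     (\<integral>\<tau>. indicator {0<..<t} \<tau> *\<^sub>R B' \<tau> (t - \<tau>) (x + 0 *\<^sub>R v) \<partial>lborel)) (at 0)"
  proof (rule has_vector_derivative_integral_dominated[where \<delta> = 1 and
      f' = "\<lambda>h \<tau>. indicator {0<..<t} \<tau> *\<^sub>R B' \<tau> (t - \<tau>) (x + h *\<^sub>R v)" and g = "\<lambda>\<tau>. C' * (indicator {0<..<t} \<tau> *\<^sub>R \<tau> powr (- \<theta>'))"])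
    show "((\<lambda>h. indicator {0<..<t} \<tau> *\<^sub>R B \<tau> (t - \<tau>) (x + h *\<^sub>R v)) has_vector_derivative
       indicator {0<..<t} \<tau> *\<^sub>R B' \<tau> (t - \<tau>) (x + h *\<^sub>R v)) (at h)" for h \<tau>
      using dir_deriv_at[OF d[of \<tau> "t - \<tau>"], of x h UNIV]
      by (cases "\<tau> > 0") (auto intro!: bounded_linear.has_vector_derivative[OF bounded_linear_scaleR_right])
    show "norm (indicator {0<..<t} \<tau> *\<^sub>R B' \<tau> (t - \<tau>) (x + h *\<^sub>R v)) \<le> C' * (indicator {0<..<t} \<tau> *\<^sub>R \<tau> powr (- \<theta>'))" for h \<tau>
      using a' by (auto simp: admissible_def indicator_def)
    show "integrable lborel (\<lambda>\<tau>. C' * (indicator {0<..<t} \<tau> *\<^sub>R \<tau> powr (- \<theta>')))"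
      using a' by (intro integrable_mult_right integrable_powr) (auto simp: admissible_def)
  qed (auto intro: admissible_integrable[OF a])
  then show "((\<lambda>h. volterra B t (x + h *\<^sub>R v)) has_vector_derivative volterra B' t x) (at 0)"
    by (simp add: volterra_def)
qed

lemma Ioo_integrable:
  fixes h :: "real \<Rightarrow> complex"
  assumes "continuous_on {s..t} h"
  shows "integrable lborel (\<lambda>\<sigma>. indicator {s<..<t} \<sigma> *\<^sub>R h \<sigma>)"
proof -
  have "set_integrable lborel {s..t} h"
    unfolding set_integrable_def by (intro borel_integrable_compact assms) auto
  then have "set_integrable lborel {s<..<t} h" by (rule set_integrable_subset) auto
  then show ?thesis by (simp add: set_integrable_def)
qed

text \<open>The integrand is dominated by a product of a function of \<tau> and a function of
  \<rho>. The source time \<open>s\<close> is left general so that the triangle is covered both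
  before and after the reflection.\<close>

lemma triangle_integrable:
  fixes L :: "real \<Rightarrow> real \<Rightarrow> 'a::metric_space \<Rightarrow> complex"
  assumes a: "admissible C \<theta> L" and s: "continuous_on UNIV (\<lambda>(\<tau>, \<rho>). s \<tau> \<rho> :: real)"
  shows "integrable (lborel \<Otimes>\<^sub>M lborel) (\<lambda>(\<tau>, \<rho>). indicator {(\<tau>, \<rho>). 0 < \<rho> \<and> \<rho> < \<tau> \<and> \<tau> < t} (\<tau>, \<rho>) *\<^sub>R L \<rho> (s \<tau> \<rho>) x)"
    (is "integrable _ ?f")
proof -
  let ?k = "\<lambda>\<rho>. C * (indicator {0<..<t} \<rho> *\<^sub>R \<rho> powr (- \<theta>))"
  let ?S = "{(\<tau>, \<rho>). 0 < \<rho> \<and> \<rho> < \<tau> \<and> \<tau> < t}"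
  have k: "integrable lborel ?k" using a by (intro integrable_mult_right integrable_powr) (auto simp: admissible_def)
  have km: "?k \<in> borel_measurable borel" using borel_measurable_integrable[OF k] by simp
  have "integrable (lborel \<Otimes>\<^sub>M lborel) (\<lambda>(\<tau>, \<rho>). indicator {0<..<t} \<tau> * ?k \<rho>)"
  proof (rule lborel_pair.Fubini_integrable)
    show "(\<lambda>(\<tau>, \<rho>). indicator {0<..<t} \<tau> * ?k \<rho>) \<in> borel_measurable (lborel \<Otimes>\<^sub>M lborel)"
      using km by measurable
    have "integrable lborel (\<lambda>\<tau>. indicator {0<..<t} \<tau> * (\<integral>\<rho>. norm (?k \<rho>) \<partial>lborel) :: real)"
      by (intro integrable_mult_left) (intro integrable_real_indicator emeasure_bounded_finite, auto)
    then show "integrable lborel (\<lambda>\<tau>. \<integral>\<rho>. norm (case (\<tau>, \<rho>) of (\<tau>, \<rho>) \<Rightarrow> indicator {0<..<t} \<tau> * ?k \<rho>) \<partial>lborel)"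
      by (simp add: abs_mult)
    show "AE \<tau> in lborel. integrable lborel (\<lambda>\<rho>. case (\<tau>, \<rho>) of (\<tau>, \<rho>) \<Rightarrow> indicator {0<..<t} \<tau> * ?k \<rho>)"
      using k by (intro AE_I2) (simp only: prod.case integrable_mult_right)
  qed
  then show ?thesis
  proof (rule Bochner_Integration.integrable_bound)
    have c: "continuous_on ({0<..} \<times> UNIV) (\<lambda>(\<tau>, s, x). L \<tau> s x)" using a by (simp add: admissible_def)
    have "continuous_on ?S (\<lambda>p. (\<lambda>(\<tau>, s, x). L \<tau> s x) (snd p, s (fst p) (snd p), x))"
      using s by (intro continuous_on_compose2[OF c] continuous_intros) (auto simp: case_prod_beta intro: continuous_on_subset)
    moreover have "open ?S"
      unfolding case_prod_beta by (intro open_Collect_conj open_Collect_less continuous_intros)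
    ultimately have "(\<lambda>p. indicator ?S p *\<^sub>R L (snd p) (s (fst p) (snd p)) x) \<in> borel_measurable borel"
      by (intro borel_measurable_continuous_on_indicator) auto
    moreover have "(\<lambda>p. indicator ?S p *\<^sub>R L (snd p) (s (fst p) (snd p)) x) = ?f" by (auto simp: fun_eq_iff)
    ultimately show "?f \<in> borel_measurable (lborel \<Otimes>\<^sub>M lborel)"
      by (simp only: lborel_prod measurable_lborel2)
    show "AE p in lborel \<Otimes>\<^sub>M lborel. norm (?f p) \<le> norm ((\<lambda>(\<tau>, \<rho>). indicator {0<..<t} \<tau> * ?k \<rho>) p)"
      using a admissible_nonneg[OF a] by (intro AE_I2) (auto simp: admissible_def indicator_def intro!: order_trans[OF _ abs_ge_self] simp del: abs_mult)
  qed
qed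

text \<open>Fubini on the triangle \<open>0 < \<rho> < \<tau> < t\<close>, with \<open>\<tau>\<close> reflected in between.\<close>

lemma volterra_time_identity:
  fixes B L :: "real \<Rightarrow> real \<Rightarrow> 'a::metric_space \<Rightarrow> complex"
  assumes L: "admissible C \<theta> L" and F: "continuous_on UNIV (\<lambda>r. F r x)"
    and B: "\<And>\<tau> r. \<tau> > 0 \<Longrightarrow> B \<tau> r x = F r x + (\<integral>\<rho>. indicator {0<..<\<tau>} \<rho> *\<^sub>R L \<rho> r x \<partial>lborel)"
  shows "volterra B t x = (\<integral>r. indicator {0<..<t} r *\<^sub>R F r x \<partial>lborel) + (\<integral>\<sigma>. indicator {0<..<t} \<sigma> *\<^sub>R volterra L \<sigma> x \<partial>lborel)"
proof -
  let ?S = "{(\<tau>, \<rho>). 0 < \<rho> \<and> \<rho> < \<tau> \<and> \<tau> < t}"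
  let ?P = "\<lambda>\<tau> \<rho>. indicator ?S (\<tau>, \<rho>) *\<^sub>R L \<rho> (t - \<tau>) x"
  let ?Q = "\<lambda>\<sigma> \<rho>. indicator ?S (\<sigma>, \<rho>) *\<^sub>R L \<rho> (\<sigma> - \<rho>) x"
  have P: "integrable (lborel \<Otimes>\<^sub>M lborel) (\<lambda>(\<tau>, \<rho>). ?P \<tau> \<rho>)"
    by (rule triangle_integrable[OF L, where s = "\<lambda>\<tau> \<rho>. t - \<tau>"]) (auto simp: case_prod_beta intro!: continuous_intros)
  have Q: "integrable (lborel \<Otimes>\<^sub>M lborel) (\<lambda>(\<tau>, \<rho>). ?Q \<tau> \<rho>)"
    by (rule triangle_integrable[OF L, where s = "\<lambda>\<tau> \<rho>. \<tau> - \<rho>"]) (auto simp: case_prod_beta intro!: continuous_intros)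
  have Fi: "integrable lborel (\<lambda>\<tau>. indicator {0<..<t} \<tau> *\<^sub>R F (t - \<tau>) x)"
    by (intro Ioo_integrable continuous_on_compose2[OF F] continuous_intros) auto
  have "volterra B t x = (\<integral>\<tau>. indicator {0<..<t} \<tau> *\<^sub>R F (t - \<tau>) x + (\<integral>\<rho>. ?P \<tau> \<rho> \<partial>lborel) \<partial>lborel)"
    unfolding volterra_def
  proof (rule Bochner_Integration.integral_cong)
    fix \<tau>
    show "indicator {0<..<t} \<tau> *\<^sub>R B \<tau> (t - \<tau>) x = indicator {0<..<t} \<tau> *\<^sub>R F (t - \<tau>) x + (\<integral>\<rho>. ?P \<tau> \<rho> \<partial>lborel)"
    proof (cases "\<tau> \<in> {0<..<t}")
      case True
      then have "(\<lambda>\<rho>. ?P \<tau> \<rho>) = (\<lambda>\<rho>. indicator {0<..<\<tau>} \<rho> *\<^sub>R L \<rho> (t - \<tau>) x)" by (auto simp: fun_eq_iff indicator_def)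
      then show ?thesis using True B[of \<tau>] by simp
    next
      case False
      then have "(\<lambda>\<rho>. ?P \<tau> \<rho>) = (\<lambda>\<rho>. 0)" by (auto simp: fun_eq_iff indicator_def)
      then show ?thesis using False by simp
    qed
  qed simp
  also have "\<dots> = (\<integral>\<tau>. indicator {0<..<t} \<tau> *\<^sub>R F (t - \<tau>) x \<partial>lborel) + (\<integral>\<tau>. (\<integral>\<rho>. ?P \<tau> \<rho> \<partial>lborel) \<partial>lborel)"
    using lborel_pair.integrable_fst'[OF P] by (intro Bochner_Integration.integral_add Fi) simp
  also have "(\<integral>\<tau>. indicator {0<..<t} \<tau> *\<^sub>R F (t - \<tau>) x \<partial>lborel) = (\<integral>r. indicator {0<..<t} r *\<^sub>R F r x \<partial>lborel)"
  proof -
    have e: "indicator {0<..<t} (t + - 1 * r) = (indicator {0<..<t} r :: real)" for r by (auto simp: indicator_def)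
    show ?thesis
      using lborel_integral_real_affine[of "-1" "\<lambda>\<tau>. indicator {0<..<t} \<tau> *\<^sub>R F (t - \<tau>) x" t] unfolding e by simp
  qed
  also have "(\<integral>\<tau>. (\<integral>\<rho>. ?P \<tau> \<rho> \<partial>lborel) \<partial>lborel) = (\<integral>\<rho>. (\<integral>\<tau>. ?P \<tau> \<rho> \<partial>lborel) \<partial>lborel)"
    by (rule lborel_pair.Fubini_integral[OF P, symmetric])
  also have "\<dots> = (\<integral>\<rho>. (\<integral>\<sigma>. ?Q \<sigma> \<rho> \<partial>lborel) \<partial>lborel)"
  proof (rule Bochner_Integration.integral_cong)
    fix \<rho>
    \<comment> \<open>The reflection \<open>\<tau> = t + \<rho> - \<sigma>\<close> maps the slice
      \<open>\<rho> < \<tau> < t\<close> to itself and turns the source time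
      \<open>t - \<tau>\<close> into \<open>\<sigma> - \<rho>\<close>. Integrated over \<rho>, this
      is the Volterra integral at time \<sigma>.\<close>
    have e: "?P (t + \<rho> + - 1 * \<sigma>) \<rho> = ?Q \<sigma> \<rho>" for \<sigma> by (auto simp: indicator_def)
    show "(\<integral>\<tau>. ?P \<tau> \<rho> \<partial>lborel) = (\<integral>\<sigma>. ?Q \<sigma> \<rho> \<partial>lborel)"
      using lborel_integral_real_affine[of "-1" "\<lambda>\<tau>. ?P \<tau> \<rho>" "t + \<rho>"] unfolding e by simp
  qed simp
  also have "\<dots> = (\<integral>\<sigma>. (\<integral>\<rho>. ?Q \<sigma> \<rho> \<partial>lborel) \<partial>lborel)"
    by (rule lborel_pair.Fubini_integral[OF Q])
  also have "\<dots> = (\<integral>\<sigma>. indicator {0<..<t} \<sigma> *\<^sub>R volterra L \<sigma> x \<partial>lborel)"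
  proof (rule Bochner_Integration.integral_cong)
    fix \<sigma>
    show "(\<integral>\<rho>. ?Q \<sigma> \<rho> \<partial>lborel) = indicator {0<..<t} \<sigma> *\<^sub>R volterra L \<sigma> x"
    proof (cases "\<sigma> \<in> {0<..<t}")
      case True
      then have "(\<lambda>\<rho>. ?Q \<sigma> \<rho>) = (\<lambda>\<rho>. indicator {0<..<\<sigma>} \<rho> *\<^sub>R L \<rho> (\<sigma> - \<rho>) x)" by (auto simp: fun_eq_iff indicator_def)
      then show ?thesis using True by (simp add: volterra_def)
    next
      case False
      then have "(\<lambda>\<rho>. ?Q \<sigma> \<rho>) = (\<lambda>\<rho>. 0)" by (auto simp: fun_eq_iff indicator_def)
      then show ?thesis using False by simp
    qed
  qed simp
  finally show ?thesis .
qed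

section \<open>The nonlinearity\<close>

text \<open>Subadditivity of the power: the fractions \<open>y / x\<close> and
  \<open>(x - y) / x\<close> add up to 1, and each of them is at most its own \<open>a\<close>-th
  power.\<close>

lemma powr_diff_le:
  fixes x y a :: real
  assumes "0 \<le> y" "y \<le> x" "0 < a" "a < 1"
  shows "x powr a - y powr a \<le> (x - y) powr a"
proof (cases "x = 0")
  case False
  then have x: "x > 0" using assms by simp
  have p: "q \<le> q powr a" if "0 \<le> q" "q \<le> 1" for q :: real
    using powr_mono'[of a 1 q] that assms by simp
  have "1 = y / x + (x - y) / x" using x by (simp add: field_simps)
  also have "\<dots> \<le> (y / x) powr a + ((x - y) / x) powr a"
    using assms x by (intro add_mono p) auto
  also have "\<dots> = (y powr a + (x - y) powr a) / x powr a"
    using assms x by (simp add: powr_divide add_divide_distrib)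
  finally show ?thesis using x by (simp add: le_divide_eq)
qed (use assms in auto)

definition pnl :: "real \<Rightarrow> complex \<Rightarrow> complex" where
  "pnl a z = (norm z powr a) *\<^sub>R z"

text \<open>The real derivative of \<open>pnl a\<close> at \<open>z\<close> in direction
  \<open>h\<close>. It is not complex linear, hence the real inner product. At \<open>z = 0\<close>
  the negative power is harmless, as \<open>0 powr b = 0\<close>.\<close>

definition dpnl :: "real \<Rightarrow> complex \<Rightarrow> complex \<Rightarrow> complex" where
  "dpnl a z h = (norm z powr a) *\<^sub>R h + (a * norm z powr (a - 2) * (z \<bullet> h)) *\<^sub>R z"

lemma bounded_linear_dpnl: "bounded_linear (dpnl a z)"
  unfolding dpnl_def[abs_def]
  by (intro bounded_linear_add bounded_linear_scaleR_right bounded_linear_scaleR_const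
    bounded_linear_const_mult bounded_linear_inner_right)

lemma dpnl_bound:
  assumes "0 < a" "a < 1"
  shows "norm (dpnl a z h) \<le> 2 * norm z powr a * norm h"
proof (cases "z = 0")
  case False
  have "norm (dpnl a z h) \<le> norm ((norm z powr a) *\<^sub>R h) + norm ((a * norm z powr (a - 2) * (z \<bullet> h)) *\<^sub>R z)"
    unfolding dpnl_def by (rule norm_triangle_ineq)
  also have "\<dots> \<le> norm z powr a * norm h + 1 * norm z powr (a - 2) * (norm z * norm h) * norm z"
    using assms Cauchy_Schwarz_ineq2[of z h] by (auto simp: abs_mult intro!: mult_mono mult_left_le_one_le)
  also have "\<dots> = 2 * norm z powr a * norm h"
    using False by (simp add: powr_diff power2_eq_square)
  finally show ?thesis .
qed (use assms in \<open>simp add: dpnl_def\<close>)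

lemma pnl_has_derivative:
  assumes "0 < a"
  shows "(pnl a has_derivative dpnl a z) (at z)"
proof (cases "z = 0")
  case True
  have "((\<lambda>y. norm y powr a) \<longlongrightarrow> 0) (at (0::complex))"
    using assms by (auto intro!: tendsto_eq_intros tendsto_zero_powrI)
  then have "((\<lambda>y. norm (pnl a y - pnl a 0 - dpnl a 0 (y - 0)) / norm (y - 0)) \<longlongrightarrow> 0) (at 0)"
    by (rule Lim_transform_eventually) (auto simp: eventually_at_filter pnl_def dpnl_def)
  then show ?thesis using True unfolding has_derivative_iff_norm by (auto intro: bounded_linear_dpnl)
next
  case False
  have n: "(norm has_derivative (\<lambda>h. h \<bullet> sgn z)) (at z)" using has_derivative_norm[OF False] .
  have "((\<lambda>y. norm y powr a) has_derivative (\<lambda>h. (h \<bullet> sgn z) * (a * norm z powr (a - 1)))) (at z)"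
  proof -
    have "((\<lambda>r. r powr a) has_derivative (\<lambda>h. h * (a * norm z powr (a - 1)))) (at (norm z))"
      using has_real_derivative_powr[of "norm z" a] False by (simp add: has_field_derivative_def mult_commute_abs)
    from has_derivative_compose[OF n this] show ?thesis .
  qed
  from has_derivative_scaleR[OF this has_derivative_ident]
  have "(pnl a has_derivative (\<lambda>h. norm z powr a *\<^sub>R h + ((h \<bullet> sgn z) * (a * norm z powr (a - 1))) *\<^sub>R z)) (at z)"
    by (simp add: pnl_def[abs_def])
  also have "(\<lambda>h. norm z powr a *\<^sub>R h + ((h \<bullet> sgn z) * (a * norm z powr (a - 1))) *\<^sub>R z) = dpnl a z"
    using False by (auto simp: fun_eq_iff dpnl_def sgn_div_norm powr_diff power2_eq_square inner_commute field_simps)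
  finally show ?thesis .
qed

lemma dir_deriv_pnl:
  assumes "0 < a" "dir_deriv v f f'"
  shows "dir_deriv v (\<lambda>x. pnl a (f x)) (\<lambda>x. dpnl a (f x) (f' x))"
  unfolding dir_deriv_def
proof
  fix x
  have "((\<lambda>h. f (x + h *\<^sub>R v)) has_derivative (\<lambda>h. h *\<^sub>R f' x)) (at 0)"
    using assms(2) by (simp add: dir_deriv_def has_vector_derivative_def)
  from has_derivative_compose[OF this, of "pnl a"] pnl_has_derivative[OF assms(1), of "f x"]
  have "((\<lambda>h. pnl a (f (x + h *\<^sub>R v))) has_derivative (\<lambda>h. dpnl a (f x) (h *\<^sub>R f' x))) (at 0)" by simp
  then show "((\<lambda>h. pnl a (f (x + h *\<^sub>R v))) has_vector_derivative dpnl a (f x) (f' x)) (at 0)"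
    by (simp add: has_vector_derivative_def linear_scale[OF bounded_linear.linear[OF bounded_linear_dpnl]])
qed

lemma pnl_lipschitz:
  assumes a: "0 < a" "a < 1" and R: "norm z \<le> R" "norm w \<le> R"
  shows "norm (pnl a z - pnl a w) \<le> 2 * R powr a * norm (z - w)"
proof -
  have d: "(pnl a has_derivative dpnl a y) (at y within cball 0 R)" for y
    by (rule has_derivative_at_withinI[OF pnl_has_derivative[OF a(1)]])
  have o: "onorm (dpnl a y) \<le> 2 * R powr a" if "y \<in> cball 0 R" for y
  proof (rule onorm_le)
    have "norm y powr a \<le> R powr a" using a that by (intro powr_mono2) auto
    then have "2 * norm y powr a * norm h \<le> 2 * R powr a * norm h" for h :: complex
      by (simp add: mult_right_mono)
    then show "norm (dpnl a y h) \<le> 2 * R powr a * norm h" for h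
      using dpnl_bound[OF a] order_trans by blast
  qed
  show ?thesis
    by (rule differentiable_bound[OF convex_cball d o]) (use R in auto)
qed

lemma continuous_pnl: "0 < a \<Longrightarrow> continuous_on A (pnl a)"
  by (intro continuous_at_imp_continuous_on ballI has_derivative_continuous[OF pnl_has_derivative])

text \<open>Expanding around \<open>w\<close> writes the difference as \<open>1 / norm w\<close>
  times \<open>z - w\<close> minus a radial correction, and the correction is itself at most
  \<open>norm (z - w)\<close>.\<close>

lemma norm_sgn_diff_le:
  fixes z w :: complex
  assumes "norm w \<le> norm z" "w \<noteq> 0"
  shows "norm (sgn z - sgn w) \<le> 2 * (norm (z - w) / norm w)"
proof -
  have z: "norm z > 0" "norm w > 0" using assms by auto
  have "sgn z - sgn w = (1 / norm w) *\<^sub>R ((z - w) - (norm z - norm w) *\<^sub>R sgn z)"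
  proof -
    have "norm z *\<^sub>R sgn z = z" using z by (simp add: sgn_div_norm)
    then show ?thesis using z by (simp add: scaleR_diff_left scaleR_diff_right sgn_div_norm[of w] divide_inverse)
  qed
  also have "norm \<dots> = (1 / norm w) * norm ((z - w) - (norm z - norm w) *\<^sub>R sgn z)" using z by simp
  also have "\<dots> \<le> (1 / norm w) * (norm (z - w) + norm (z - w))"
  proof (intro mult_left_mono)
    have "norm ((z - w) - (norm z - norm w) *\<^sub>R sgn z) \<le> norm (z - w) + norm ((norm z - norm w) *\<^sub>R sgn z)"
      by (rule norm_triangle_ineq4)
    also have "norm ((norm z - norm w) *\<^sub>R sgn z) \<le> norm (z - w)"
      using z norm_triangle_ineq2[of z w] assms by (simp add: norm_sgn)
    finally show "norm ((z - w) - (norm z - norm w) *\<^sub>R sgn z) \<le> norm (z - w) + norm (z - w)" by simp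
  qed (use z in auto)
  finally show ?thesis by simp
qed

text \<open>In polar form \<open>dpnl a z h\<close> is \<open>norm z powr a\<close> times
  \<open>h\<close> plus \<open>a\<close> times the projection of \<open>h\<close> onto
  \<open>sgn z\<close>. A change of the modulus is controlled by \<open>powr_diff_le\<close> and
  contributes 2 to the constant 6; a change of direction contributes the remaining 4.\<close>

lemma dpnl_holder:
  assumes a: "0 < a" "a < 1"
  shows "norm (dpnl a z h - dpnl a w h) \<le> 6 * norm (z - w) powr a * norm h"
proof -
  have main: "norm (dpnl a z h - dpnl a w h) \<le> 6 * norm (z - w) powr a * norm h" if le: "norm w \<le> norm z" for z w
  proof -
    let ?d = "norm (z - w) powr a"
    have e: "dpnl a z h = (norm z powr a) *\<^sub>R h + (a * norm z powr a * (sgn z \<bullet> h)) *\<^sub>R sgn z" for z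
      by (cases "z = 0") (auto simp: dpnl_def sgn_div_norm powr_diff power2_eq_square field_simps)
    have s: "norm (sgn z) \<le> 1" for z :: complex by (simp add: norm_sgn)
    have 1: "\<bar>norm z powr a - norm w powr a\<bar> \<le> ?d"
    proof -
      have "norm z powr a - norm w powr a \<le> (norm z - norm w) powr a" by (rule powr_diff_le) (use le a in auto)
      also have "\<dots> \<le> ?d" using le a norm_triangle_ineq2[of z w] by (intro powr_mono2) auto
      finally show ?thesis using powr_mono2[of a "norm w" "norm z"] le a by auto
    qed
    have 2: "norm w powr a * norm (sgn z - sgn w) \<le> 2 * ?d"
    proof (cases "w = 0")
      case False
      let ?r = "norm (z - w) / norm w"
      \<comment> \<open>Interpolation between \<open>norm_sgn_diff_le\<close>, useful when the
        relative distance \<open>?r\<close> is at most 1, and the trivial bound 2 otherwise. The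
        factor \<open>norm w powr a\<close> then cancels the denominator of
        \<open>?r powr a\<close>.\<close>
      have "norm (sgn z - sgn w) \<le> 2 * ?r powr a"
      proof (cases "?r \<le> 1")
        case True
        then have "?r \<le> ?r powr a" using powr_mono'[of a 1 ?r] a by simp
        then show ?thesis using norm_sgn_diff_le[OF le False] by linarith
      next
        case False
        then have "1 \<le> ?r powr a" using a by (intro ge_one_powr_ge_zero) auto
        moreover have "norm (sgn z - sgn w) \<le> 2" using norm_triangle_ineq4[of "sgn z" "sgn w"] s[of z] s[of w] by linarith
        ultimately show ?thesis by linarith
      qed
      then have "norm w powr a * norm (sgn z - sgn w) \<le> norm w powr a * (2 * ?r powr a)" by (rule mult_left_mono) simp
      also have "\<dots> = 2 * ?d" using False by (simp add: powr_divide)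
      finally show ?thesis .
    qed (use a in auto)
    have 3: "norm ((sgn z \<bullet> h) *\<^sub>R sgn z - (sgn w \<bullet> h) *\<^sub>R sgn w) \<le> 2 * norm (sgn z - sgn w) * norm h"
    proof -
      have "(sgn z \<bullet> h) *\<^sub>R sgn z - (sgn w \<bullet> h) *\<^sub>R sgn w = ((sgn z - sgn w) \<bullet> h) *\<^sub>R sgn z + (sgn w \<bullet> h) *\<^sub>R (sgn z - sgn w)"
        by (simp add: inner_diff_left scaleR_diff_left scaleR_diff_right)
      also have "norm \<dots> \<le> norm (((sgn z - sgn w) \<bullet> h) *\<^sub>R sgn z) + norm ((sgn w \<bullet> h) *\<^sub>R (sgn z - sgn w))"
        by (rule norm_triangle_ineq)
      also have "\<dots> \<le> (norm (sgn z - sgn w) * norm h) * 1 + (1 * norm h) * norm (sgn z - sgn w)"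
      proof -
        have "\<bar>sgn w \<bullet> h\<bar> \<le> 1 * norm h" by (rule order_trans[OF Cauchy_Schwarz_ineq2]) (intro mult_right_mono s norm_ge_zero)
        then show ?thesis unfolding norm_scaleR
          by (intro add_mono mult_mono Cauchy_Schwarz_ineq2 s) auto
      qed
      finally show ?thesis by (simp add: mult_ac)
    qed
    have 4: "norm ((sgn z \<bullet> h) *\<^sub>R sgn z) \<le> norm h"
    proof -
      have "\<bar>sgn z \<bullet> h\<bar> * norm (sgn z) \<le> (norm (sgn z) * norm h) * 1" by (intro mult_mono Cauchy_Schwarz_ineq2 s) auto
      also have "\<dots> \<le> norm h" using s[of z] by (auto intro: mult_left_le_one_le)
      finally show ?thesis by simp
    qed
    have "dpnl a z h - dpnl a w h = (norm z powr a - norm w powr a) *\<^sub>R (h + a *\<^sub>R ((sgn z \<bullet> h) *\<^sub>R sgn z))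
       + (a * norm w powr a) *\<^sub>R ((sgn z \<bullet> h) *\<^sub>R sgn z - (sgn w \<bullet> h) *\<^sub>R sgn w)"
      unfolding e by (simp add: scaleR_diff_left scaleR_diff_right scaleR_add_right algebra_simps)
    also have "norm \<dots> \<le> \<bar>norm z powr a - norm w powr a\<bar> * norm (h + a *\<^sub>R ((sgn z \<bullet> h) *\<^sub>R sgn z))
       + (a * norm w powr a) * norm ((sgn z \<bullet> h) *\<^sub>R sgn z - (sgn w \<bullet> h) *\<^sub>R sgn w)"
      by (rule order_trans[OF norm_triangle_ineq]) (use a in simp)
    also have "\<dots> \<le> ?d * (2 * norm h) + 4 * ?d * norm h"
    proof (rule add_mono)
      have "norm (h + a *\<^sub>R ((sgn z \<bullet> h) *\<^sub>R sgn z)) \<le> norm h + a * norm ((sgn z \<bullet> h) *\<^sub>R sgn z)"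
        using norm_triangle_ineq[of h "a *\<^sub>R ((sgn z \<bullet> h) *\<^sub>R sgn z)"] a by (simp add: abs_mult mult.assoc)
      also have "\<dots> \<le> norm h + 1 * norm h" using a 4 by (intro add_mono mult_mono) auto
      finally show "\<bar>norm z powr a - norm w powr a\<bar> * norm (h + a *\<^sub>R ((sgn z \<bullet> h) *\<^sub>R sgn z)) \<le> ?d * (2 * norm h)"
        using 1 by (intro mult_mono) auto
      have "(a * norm w powr a) * norm ((sgn z \<bullet> h) *\<^sub>R sgn z - (sgn w \<bullet> h) *\<^sub>R sgn w)
         \<le> (1 * norm w powr a) * (2 * norm (sgn z - sgn w) * norm h)"
        using a 3 by (intro mult_mono) auto
      also have "\<dots> = (norm w powr a * norm (sgn z - sgn w)) * (2 * norm h)" by simp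
      also have "\<dots> \<le> (2 * ?d) * (2 * norm h)" using 2 by (intro mult_right_mono) auto
      finally show "(a * norm w powr a) * norm ((sgn z \<bullet> h) *\<^sub>R sgn z - (sgn w \<bullet> h) *\<^sub>R sgn w) \<le> 4 * ?d * norm h" by simp
    qed
    finally show ?thesis by (simp add: mult_ac)
  qed
  show ?thesis
    using main[of w z] main[of z w] by (cases "norm w \<le> norm z") (auto simp: norm_minus_commute)
qed

text \<open>The change of base point is controlled by the Hoelder bound and the change of direction
  by the operator bound; together they give joint continuity, including at the origin.\<close>

lemma dpnl_tendsto:
  assumes a: "0 < a" "a < 1" and X: "(X \<longlongrightarrow> z) F" and Y: "(Y \<longlongrightarrow> h) F"
  shows "((\<lambda>n. dpnl a (X n) (Y n)) \<longlongrightarrow> dpnl a z h) F"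
proof (rule Lim_transform2[OF tendsto_const])
  have b: "norm (dpnl a z h - dpnl a (X n) (Y n)) \<le> 6 * norm (z - X n) powr a * norm (Y n) + 2 * norm z powr a * norm (h - Y n)" for n
  proof -
    have e: "dpnl a z h - dpnl a (X n) (Y n) = (dpnl a z (Y n) - dpnl a (X n) (Y n)) + dpnl a z (h - Y n)"
      by (simp add: linear_diff[OF bounded_linear.linear[OF bounded_linear_dpnl]])
    show ?thesis
      unfolding e by (rule norm_triangle_mono[OF dpnl_holder[OF a, of z "Y n" "X n"] dpnl_bound[OF a, of z "h - Y n"]])
  qed
  have l: "((\<lambda>n. 6 * norm (z - X n) powr a * norm (Y n) + 2 * norm z powr a * norm (h - Y n)) \<longlongrightarrow> 6 * 0 * norm h + 2 * norm z powr a * norm (h - h)) F"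
    using a by (intro tendsto_intros tendsto_zero_powrI[where b = a] Y) (use X in \<open>auto intro!: tendsto_eq_intros\<close>)
  show "((\<lambda>n. dpnl a z h - dpnl a (X n) (Y n)) \<longlongrightarrow> 0) F"
    by (rule Lim_null_comparison[OF always_eventually]) (use b l in auto)
qed

lemma continuous_on_dpnl:
  assumes a: "0 < a" "a < 1" and "continuous_on A f" "continuous_on A g"
  shows "continuous_on A (\<lambda>x. dpnl a (f x) (g x))"
  using assms unfolding continuous_on_def by (auto intro!: dpnl_tendsto)

text \<open>The second summand of \<open>dpnl\<close> is here a nonnegative multiple of
  \<open>z\<close>, whose real part is nonnegative.\<close>

lemma Re_dpnl_ge:
  assumes "0 < a" "Re z \<ge> 0" "z \<bullet> h \<ge> 0"
  shows "Re (dpnl a z h) \<ge> norm z powr a * Re h"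
  using assms by (simp add: dpnl_def)

section \<open>Spatial regularity of mild solutions\<close>

lemma dir_deriv_add: "dir_deriv v f f' \<Longrightarrow> dir_deriv v g g' \<Longrightarrow> dir_deriv v (\<lambda>x. f x + g x) (\<lambda>x. f' x + g' x)"
  by (auto simp: dir_deriv_def intro!: has_vector_derivative_add)

lemma dir_deriv_cmult: "dir_deriv v f f' \<Longrightarrow> dir_deriv v (\<lambda>x. c * f x) (\<lambda>x. c * f' x :: complex)"
  by (auto simp: dir_deriv_def intro!: has_vector_derivative_mult_right)

lemma dir_deriv_sum: "(\<And>i. i \<in> I \<Longrightarrow> dir_deriv v (f i) (f' i)) \<Longrightarrow> dir_deriv v (\<lambda>x. \<Sum>i\<in>I. f i x) (\<lambda>x. \<Sum>i\<in>I. f' i x)"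
  by (auto simp: dir_deriv_def intro!: has_vector_derivative_sum)

text \<open>Moving from \<open>y\<close> to \<open>x\<close> one coordinate at a time.\<close>

lemma lipschitz_from_axes:
  fixes f :: "real^'n \<Rightarrow> complex"
  assumes d: "\<And>i. dir_deriv (axis i 1) f (f' i)" and b: "\<And>i x. norm (f' i x) \<le> K"
  shows "norm (f x - f y) \<le> real CARD('n) * K * norm (x - y)"
proof -
  have K: "K \<ge> 0" using order_trans[OF norm_ge_zero b] .
  let ?z = "\<lambda>S. \<chi> i. if i \<in> S then x $ i else y $ i"
  have "norm (f (?z S) - f y) \<le> (\<Sum>i\<in>S. K * \<bar>x $ i - y $ i\<bar>)" if "finite S" for S :: "'n set"
    using that
  proof (induction S rule: finite_induct)
    case (insert i S)
    have z: "?z (insert i S) = ?z S + (x $ i - y $ i) *\<^sub>R axis i 1"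
      using insert.hyps by (auto simp: vec_eq_iff axis_def)
    have "norm (f (?z (insert i S)) - f (?z S)) \<le> K * \<bar>x $ i - y $ i\<bar>"
      unfolding z by (rule dir_deriv_bound[OF d b])
    then show ?case
      using insert norm_triangle_ineq[of "f (?z (insert i S)) - f (?z S)" "f (?z S) - f y"] by simp
  qed simp
  from this[of UNIV] have "norm (f x - f y) \<le> (\<Sum>i\<in>UNIV. K * \<bar>x $ i - y $ i\<bar>)"
    by (simp add: vec_nth_inverse)
  also have "\<dots> \<le> (\<Sum>i\<in>(UNIV :: 'n set). K * norm (x - y))"
    using K component_le_norm_cart[of "x - y"] by (intro sum_mono mult_left_mono) auto
  finally show ?thesis by (simp add: mult_ac)
qed

text \<open>At distances up to 1 the Lipschitz bound is the stronger one; beyond 1 the sup bound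
  \<open>2 * M\<close> suffices.\<close>

lemma holder_of_lipschitz:
  fixes f :: "'a::real_normed_vector \<Rightarrow> complex"
  assumes "\<And>x y. norm (f x - f y) \<le> L * norm (x - y)" "\<And>x. norm (f x) \<le> M" "0 < l" "l \<le> 1" "0 \<le> L"
  shows "norm (f x - f y) \<le> (L + 2 * M) * norm (x - y) powr l"
proof -
  have M: "M \<ge> 0" using order_trans[OF norm_ge_zero assms(2)] .
  let ?d = "norm (x - y)"
  show ?thesis
  proof (cases "?d \<le> 1")
    case True
    then have "?d \<le> ?d powr l" using powr_mono'[of l 1 ?d] assms by simp
    then have "L * ?d \<le> (L + 2 * M) * ?d powr l" using M assms by (intro mult_mono) auto
    then show ?thesis using assms(1)[of x y] by linarith
  next
    case False
    then have "1 \<le> ?d powr l" using assms by (intro ge_one_powr_ge_zero) auto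
    then have "(L + 2 * M) * 1 \<le> (L + 2 * M) * ?d powr l" using M assms by (intro mult_left_mono) auto
    moreover have "norm (f x - f y) \<le> 2 * M"
      using norm_triangle_ineq4[of "f x" "f y"] assms(2)[of x] assms(2)[of y] by linarith
    ultimately show ?thesis using assms(5) by simp
  qed
qed

section \<open>Linear combinations, and singularities of Gaussian convolutions\<close>

lemma gconv_lincomb:
  assumes "weight C m" "\<And>i. continuous_on UNIV (f i)" "\<And>i x. norm (f i x) \<le> M i"
  shows "gconv m (\<lambda>z. \<Sum>i\<in>I. c i *\<^sub>R f i z) \<tau> x = (\<Sum>i\<in>I. c i *\<^sub>R gconv m (f i) \<tau> x)"
proof -
  have "(\<integral>w. (\<Sum>i\<in>I. m w *\<^sub>R (c i *\<^sub>R f i (x - sqrt \<tau> *\<^sub>R w))) \<partial>lborel) = (\<Sum>i\<in>I. gconv m (\<lambda>z. c i *\<^sub>R f i z) \<tau> x)"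
    by (rule gconv_sum[where m = "\<lambda>_. m" and C = "\<lambda>_. C" and M = "\<lambda>i. \<bar>c i\<bar> * M i" and f = "\<lambda>i z. c i *\<^sub>R f i z"])
       (use assms in \<open>auto intro!: continuous_intros mult_left_mono\<close>)
  then show ?thesis by (simp only: gconv_scale) (simp only: gconv_def scaleR_sum_right)
qed

lemma kern1_lincomb: "kern1 v w = (\<Sum>i\<in>UNIV. (v $ i) * kern1 (axis i 1) w)"
proof -
  have wv: "w \<bullet> v = (\<Sum>i\<in>UNIV. v $ i * w $ i)" by (simp add: inner_vec_def mult.commute)
  have k: "kern1 (axis i 1) w = - (w $ i / 2) * kern w" for i by (simp add: kern1_def inner_axis)
  show ?thesis
    unfolding k by (simp add: kern1_def wv sum_distrib_left sum_distrib_right sum_divide_distrib sum_negf mult_ac)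
qed

lemma gconv_kern1_lincomb:
  fixes f :: "real^'n \<Rightarrow> complex"
  assumes f: "continuous_on UNIV f" "\<And>x. norm (f x) \<le> M"
  shows "gconv (kern1 v) f \<tau> x = (\<Sum>i\<in>UNIV. (v $ i) *\<^sub>R gconv (kern1 (axis i 1)) f \<tau> x)"
proof -
  have "\<forall>i::'n. \<exists>C. weight C (kern1 (axis i 1 :: real^'n))" using weight_kern1 by blast
  then obtain C' where C': "\<And>i::'n. weight (C' i) (kern1 (axis i 1 :: real^'n))" by metis
  have "gconv (kern1 v) f \<tau> x = (\<integral>w. (\<Sum>i\<in>UNIV. kern1 (axis i 1) w *\<^sub>R ((v $ i) *\<^sub>R f (x - sqrt \<tau> *\<^sub>R w))) \<partial>lborel)"
    unfolding gconv_def by (subst kern1_lincomb) (simp add: scaleR_sum_left mult_ac)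
  also have "\<dots> = (\<Sum>i\<in>UNIV. gconv (kern1 (axis i 1)) (\<lambda>z. (v $ i) *\<^sub>R f z) \<tau> x)"
    by (rule gconv_sum[where C = C' and M = "\<lambda>i. \<bar>v $ i\<bar> * M" and f = "\<lambda>i z. (v $ i) *\<^sub>R f z"])
       (use C' f in \<open>auto intro!: continuous_intros mult_left_mono\<close>)
  finally show ?thesis by (simp only: gconv_scale)
qed

lemma admissible_lincomb:
  assumes "\<And>i. i \<in> I \<Longrightarrow> admissible (C i) \<theta> (B i)" "finite I" "\<theta> < 1"
  shows "admissible (\<Sum>i\<in>I. \<bar>c i\<bar> * C i) \<theta> (\<lambda>\<tau> s x. \<Sum>i\<in>I. c i *\<^sub>R B i \<tau> s x)"
  unfolding admissible_def
proof (intro conjI allI impI)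
  show "continuous_on ({0<..} \<times> UNIV) (\<lambda>(\<tau>, s, x). \<Sum>i\<in>I. c i *\<^sub>R B i \<tau> s x)"
    using assms(1) by (auto simp: case_prod_beta admissible_def intro!: continuous_intros)
  fix \<tau> :: real and s x assume "\<tau> > 0"
  have "norm (\<Sum>i\<in>I. c i *\<^sub>R B i \<tau> s x) \<le> (\<Sum>i\<in>I. \<bar>c i\<bar> * (C i * \<tau> powr - \<theta>))"
    using assms(1) \<open>\<tau> > 0\<close> by (intro order_trans[OF norm_sum] sum_mono) (auto simp: admissible_def intro!: mult_left_mono)
  then show "norm (\<Sum>i\<in>I. c i *\<^sub>R B i \<tau> s x) \<le> (\<Sum>i\<in>I. \<bar>c i\<bar> * C i) * \<tau> powr - \<theta>"
    by (simp add: sum_distrib_right mult.assoc)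
qed (fact assms(3))

lemma volterra_lincomb:
  assumes "\<And>i. i \<in> I \<Longrightarrow> admissible (C i) \<theta> (B i)"
  shows "volterra (\<lambda>\<tau> s x. \<Sum>i\<in>I. c i *\<^sub>R B i \<tau> s x) t x = (\<Sum>i\<in>I. c i *\<^sub>R volterra (B i) t x)"
proof -
  have "volterra (\<lambda>\<tau> s x. \<Sum>i\<in>I. c i *\<^sub>R B i \<tau> s x) t x =
      (\<integral>\<tau>. (\<Sum>i\<in>I. c i *\<^sub>R (indicator {0<..<t} \<tau> *\<^sub>R B i \<tau> (t - \<tau>) x)) \<partial>lborel)"
    unfolding volterra_def by (simp add: scaleR_sum_right mult_ac)
  also have "\<dots> = (\<Sum>i\<in>I. (\<integral>\<tau>. c i *\<^sub>R (indicator {0<..<t} \<tau> *\<^sub>R B i \<tau> (t - \<tau>) x) \<partial>lborel))"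
    by (rule Bochner_Integration.integral_sum) (intro integrable_scaleR_right admissible_integrable[OF assms])
  also have "\<dots> = (\<Sum>i\<in>I. c i *\<^sub>R volterra (B i) t x)"
    unfolding volterra_def by (simp only: scaleR_conv_of_real[of "c _"] integral_mult_right_zero)
  finally show ?thesis .
qed

lemma admissible_gconv:
  fixes F :: "'s::metric_space \<Rightarrow> real^'n \<Rightarrow> complex"
  assumes m: "weight C m" and F: "continuous_on UNIV (\<lambda>(s, x). F s x)" "\<And>s x. norm (F s x) \<le> M"
  shows "continuous_on A (\<lambda>(\<tau>, s, x). gconv m (F s) \<tau> x)" "continuous_on UNIV (F s)"
proof -
  show "continuous_on A (\<lambda>(\<tau>, s, x). gconv m (F s) \<tau> x)"
    by (rule continuous_on_subset[OF gconv_continuous[OF m F]]) simp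
  have "continuous_on UNIV (\<lambda>x. (\<lambda>(s, x). F s x) (s, x))"
    by (rule continuous_on_compose2[OF F(1)]) (auto intro!: continuous_intros)
  then show "continuous_on UNIV (F s)" by simp
qed

lemma admissible_gconv0:
  fixes F :: "real \<Rightarrow> real^'n \<Rightarrow> complex"
  assumes m: "weight C m" and F: "continuous_on UNIV (\<lambda>(s, x). F s x)" "\<And>s x. norm (F s x) \<le> M"
  shows "admissible (M * (\<integral>w. \<bar>m w\<bar> \<partial>lborel)) 0 (\<lambda>\<tau> s x. gconv m (F s) \<tau> x)"
  unfolding admissible_def using admissible_gconv[OF m F] gconv_bound[OF m _ F(2)] by auto

lemma admissible_gconv1:
  fixes F :: "real \<Rightarrow> real^'n \<Rightarrow> complex"
  assumes m: "weight C m" and F: "continuous_on UNIV (\<lambda>(s, x). F s x)" "\<And>s x. norm (F s x) \<le> M"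
  shows "admissible (M * (\<integral>w. \<bar>m w\<bar> \<partial>lborel)) (1/2) (\<lambda>\<tau> s x. (1 / sqrt \<tau>) *\<^sub>R gconv m (F s) \<tau> x)"
  unfolding admissible_def
proof (intro conjI allI impI)
  have "continuous_on ({0<..} \<times> UNIV) (\<lambda>p. (1 / sqrt (fst p)) *\<^sub>R (\<lambda>(\<tau>, s, x). gconv m (F s) \<tau> x) p)"
    by (intro continuous_intros admissible_gconv[OF m F]) auto
  then show "continuous_on ({0<..} \<times> UNIV) (\<lambda>(\<tau>, s, x). (1 / sqrt \<tau>) *\<^sub>R gconv m (F s) \<tau> x)"
    by (simp add: case_prod_beta)
  fix \<tau> :: real and s x assume t: "\<tau> > 0"
  have "norm ((1 / sqrt \<tau>) *\<^sub>R gconv m (F s) \<tau> x) = (1 / sqrt \<tau>) * norm (gconv m (F s) \<tau> x)" using t by simp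
  also have "\<dots> \<le> (1 / sqrt \<tau>) * (M * (\<integral>w. \<bar>m w\<bar> \<partial>lborel))"
    using t by (intro mult_left_mono gconv_bound[OF m admissible_gconv(2)[OF m F] F(2)]) auto
  finally show "norm ((1 / sqrt \<tau>) *\<^sub>R gconv m (F s) \<tau> x) \<le> M * (\<integral>w. \<bar>m w\<bar> \<partial>lborel) * \<tau> powr - (1/2)"
    using t by (simp add: powr_minus_divide powr_half_sqrt mult_ac)
qed simp

text \<open>Two derivatives on the kernel cost a factor \<open>1 / \<tau>\<close>; the mean-zero
  weight acting on a Hoelder source returns \<open>\<tau> powr (l / 2)\<close>, which brings the
  exponent below 1.\<close>

lemma admissible_gconv2:
  fixes F :: "real \<Rightarrow> real^'n \<Rightarrow> complex"
  assumes m: "weight C m" and F: "continuous_on UNIV (\<lambda>(s, x). F s x)" "\<And>s x. norm (F s x) \<le> M"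
    and h: "\<And>s x y. norm (F s x - F s y) \<le> H * norm (x - y) powr l" and l: "0 < l" "l \<le> 1"
    and m0: "(\<integral>w. m w \<partial>lborel) = 0"
  shows "admissible (H * (\<integral>w. \<bar>m w\<bar> * (1 + norm w) \<partial>lborel)) (1 - l/2) (\<lambda>\<tau> s x. (1 / \<tau>) *\<^sub>R gconv m (F s) \<tau> x)"
  unfolding admissible_def
proof (intro conjI allI impI)
  have "continuous_on ({0<..} \<times> UNIV) (\<lambda>p. (1 / fst p) *\<^sub>R (\<lambda>(\<tau>, s, x). gconv m (F s) \<tau> x) p)"
    by (intro continuous_intros admissible_gconv[OF m F]) auto
  then show "continuous_on ({0<..} \<times> UNIV) (\<lambda>(\<tau>, s, x). (1 / \<tau>) *\<^sub>R gconv m (F s) \<tau> x)"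
    by (simp add: case_prod_beta)
  fix \<tau> :: real and s x assume t: "\<tau> > 0"
  have "norm ((1 / \<tau>) *\<^sub>R gconv m (F s) \<tau> x) = (1 / \<tau>) * norm (gconv m (F s) \<tau> x)" using t by simp
  also have "\<dots> \<le> (1 / \<tau>) * (H * \<tau> powr (l / 2) * (\<integral>w. \<bar>m w\<bar> * (1 + norm w) \<partial>lborel))"
    using t by (intro mult_left_mono gconv_holder_bound[OF m admissible_gconv(2)[OF m F] F(2) h l m0]) auto
  also have "\<dots> = H * (\<integral>w. \<bar>m w\<bar> * (1 + norm w) \<partial>lborel) * (\<tau> powr (l / 2) / \<tau> powr 1)" using t by simp
  also have "\<tau> powr (l / 2) / \<tau> powr 1 = \<tau> powr - (1 - l/2)"
  proof -
    have "- (1 - l/2) = l/2 - 1" by simp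
    then show ?thesis by (simp only: powr_diff)
  qed
  finally show "norm ((1 / \<tau>) *\<^sub>R gconv m (F s) \<tau> x) \<le> H * (\<integral>w. \<bar>m w\<bar> * (1 + norm w) \<partial>lborel) * \<tau> powr - (1 - l/2)" .
qed (use l in simp)

lemma gconv_time_integral:
  fixes f :: "real^'n \<Rightarrow> complex"
  assumes f: "continuous_on UNIV f" "\<And>x. norm (f x) \<le> M"
    and d: "\<And>v. dir_deriv v f (f' v)"
    and lin: "\<And>v x. f' v x = (\<Sum>i\<in>UNIV. (v $ i) *\<^sub>R f' (axis i 1) x)"
    and f': "\<And>v. continuous_on UNIV (f' v)" "\<And>i x. norm (f' (axis i 1) x) \<le> M'"
    and "\<tau> \<ge> 0"
  shows "gconv kern f \<tau> x = f x + (\<integral>\<rho>. indicator {0<..<\<tau>} \<rho> *\<^sub>R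
     (\<Sum>i\<in>UNIV. (1 / sqrt \<rho>) *\<^sub>R gconv (kern1 (axis i 1)) (f' (axis i 1)) \<rho> x) \<partial>lborel)"
proof -
  let ?g = "\<lambda>\<rho>. \<Sum>i\<in>UNIV. (1 / sqrt \<rho>) *\<^sub>R gconv (kern1 (axis i 1)) (f' (axis i 1)) \<rho> x"
  obtain C where C: "weight C (kern :: real^'n \<Rightarrow> real)" using weight_kern by blast
  have "continuous_on {0..\<tau>} (\<lambda>\<rho>. (\<lambda>(\<tau>, x). gconv kern f \<tau> x) (\<rho>, x))"
    by (rule continuous_on_compose2[OF gconv_continuous'[OF C f]]) (auto intro!: continuous_intros)
  then have "(?g has_integral (gconv kern f \<tau> x - gconv kern f 0 x)) {0..\<tau>}"
    \<comment> \<open>The derivative may be unbounded near 0, so only continuity is used at the end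
      points.\<close>
    by (intro fundamental_theorem_of_calculus_interior \<open>\<tau> \<ge> 0\<close>)
       (auto intro!: gconv_time_deriv[OF f d lin f'])
  then have 1: "(?g has_integral (gconv kern f \<tau> x - f x)) {0<..<\<tau>}"
    by (simp add: gconv_kern_0 has_integral_Icc_iff_Ioo)
  have "integrable lborel (\<lambda>\<rho>. indicator {0<..<\<tau>} \<rho> *\<^sub>R (1 *\<^sub>R ((1 / sqrt \<rho>) *\<^sub>R gconv (kern1 (axis i 1)) (f' (axis i 1)) \<rho> x)))" for i :: 'n
  proof -
    obtain C' where C': "weight C' (kern1 (axis i 1 :: real^'n))" using weight_kern1 by blast
    have "admissible (M' * (\<integral>w. \<bar>kern1 (axis i 1 :: real^'n) w\<bar> \<partial>lborel)) (1/2) (\<lambda>\<tau> s x. (1 / sqrt \<tau>) *\<^sub>R gconv (kern1 (axis i 1 :: real^'n)) (f' (axis i 1)) \<tau> x)"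
      by (rule admissible_gconv1[OF C', where F = "\<lambda>_. f' (axis i 1)"])
         (use f' in \<open>auto simp: case_prod_beta intro!: continuous_on_compose2[OF f'(1)] continuous_intros\<close>)
    from admissible_integrable[OF this, of \<tau> x] show ?thesis by simp
  qed
  then have "integrable lborel (\<lambda>\<rho>. indicator {0<..<\<tau>} \<rho> *\<^sub>R ?g \<rho>)"
    unfolding scaleR_sum_right by (intro Bochner_Integration.integrable_sum) simp
  then have "set_integrable lborel {0<..<\<tau>} ?g" by (simp add: set_integrable_def)
  from set_borel_integral_eq_integral(2)[OF this] integral_unique[OF 1]
  show ?thesis by (simp add: set_lebesgue_integral_def)
qed

lemma dir_deriv_partial:
  assumes "dir_deriv (axis i 1) f f'"
  shows "partial_differentiable i f" "partial i f = f'"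
  using assms unfolding dir_deriv_def partial_differentiable_def partial_def[abs_def]
  by (auto simp: fun_eq_iff intro: differentiableI_vector vector_derivative_at)

text \<open>\<open>U\<close> is a solution on \<open>[0, T1]\<close>, extended to all times by freezing it outside; \<open>E vs\<close> is the iterated
  derivative of the initial value in the directions \<open>vs\<close>.\<close>

locale duhamel =
  fixes \<alpha> :: real and lam :: complex and T1 M :: real
    and U :: "real \<Rightarrow> real^'n \<Rightarrow> complex" and E :: "(real^'n) list \<Rightarrow> real^'n \<Rightarrow> complex"
  assumes \<alpha>: "0 < \<alpha>" "\<alpha> < 1" and T1: "0 \<le> T1"
    and U_cont: "continuous_on UNIV (\<lambda>(t, x). U t x)" and U_bound: "\<And>t x. norm (U t x) \<le> M"
    and U_clip: "\<And>t. U t = U (max 0 (min t T1))"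
    and U_eq: "\<And>t x. 0 \<le> t \<Longrightarrow> t \<le> T1 \<Longrightarrow>
      U t x = gconv kern (E []) t x + lam * volterra (\<lambda>\<tau> s. gconv kern (\<lambda>z. pnl \<alpha> (U s z)) \<tau>) t x"
    and E_deriv: "\<And>vs v. dir_deriv v (E vs) (E (v # vs))"
    and E_cont: "\<And>vs. continuous_on UNIV (E vs)" and E_bounded: "\<And>vs. \<exists>B. \<forall>x. norm (E vs x) \<le> B"
    and E_lin: "\<And>v x. E [v] x = (\<Sum>i\<in>UNIV. (v $ i) *\<^sub>R E [axis i 1] x)"
begin

text \<open>\<open>D1\<close>, \<open>D2\<close>, \<open>D3\<close> turn out to be the iterated directional derivatives of \<open>U\<close>, and \<open>G v\<close> that of \<open>F\<close>. In \<open>D2\<close>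
  and \<open>D3\<close> one derivative has already been moved to the nonlinearity.\<close>

definition "F s x = pnl \<alpha> (U s x)"
definition "clip t = max 0 (min t T1)"
definition "B1 v \<tau> s x = (1 / sqrt \<tau>) *\<^sub>R gconv (kern1 v) (F s) \<tau> x"
definition "D1 v t x = gconv kern (E [v]) t x + lam * volterra (B1 v) t x"
definition "G v s x = dpnl \<alpha> (U s x) (D1 v (clip s) x)"
definition "C1 v w \<tau> s x = (1 / sqrt \<tau>) *\<^sub>R gconv (kern1 w) (G v s) \<tau> x"
definition "D2 v w t x = gconv kern (E [w, v]) t x + lam * volterra (C1 v w) t x"
definition "C2 v w w' \<tau> s x = (1 / \<tau>) *\<^sub>R gconv (kern2 w w') (G v s) \<tau> x"
definition "D3 v w w' t x = gconv kern (E [w', w, v]) t x + lam * volterra (C2 v w w') t x"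

lemma clip: "0 \<le> clip t" "clip t \<le> T1" "0 \<le> t \<Longrightarrow> t \<le> T1 \<Longrightarrow> clip t = t" "U (clip t) = U t"
  using T1 U_clip[of t] by (auto simp: clip_def)

lemma clip_cont: "continuous_on UNIV clip"
  unfolding clip_def[abs_def] by (intro continuous_intros)

lemma F_cont: "continuous_on UNIV (\<lambda>(t, x). F t x)"
  unfolding F_def case_prod_beta
  by (rule continuous_on_compose2[OF continuous_pnl[OF \<alpha>(1), of UNIV]]) (use U_cont in \<open>auto simp: case_prod_beta\<close>)

lemma F_bound: "norm (F s x) \<le> M powr \<alpha> * M"
  unfolding F_def pnl_def using U_bound[of s x] \<alpha> by (auto intro!: mult_mono powr_mono2)

lemma Fs_cont: "continuous_on UNIV (F s)"
proof -
  obtain C where "weight C (kern :: real^'n \<Rightarrow> real)" using weight_kern by blast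
  from admissible_gconv(2)[OF this F_cont F_bound] show ?thesis .
qed

lemma E_gconv_cont: "continuous_on UNIV (\<lambda>(t, x). gconv kern (E vs) t x)"
proof -
  obtain C where C: "weight C (kern :: real^'n \<Rightarrow> real)" using weight_kern by blast
  obtain B where "\<And>x. norm (E vs x) \<le> B" using E_bounded by blast
  from gconv_continuous'[OF C E_cont this] show ?thesis .
qed

lemma E_gconv_bounded: "\<exists>B. \<forall>t x. norm (gconv kern (E vs) t x) \<le> B"
proof -
  obtain C where C: "weight C (kern :: real^'n \<Rightarrow> real)" using weight_kern by blast
  obtain B where "\<And>x. norm (E vs x) \<le> B" using E_bounded by blast
  from gconv_bound[OF C E_cont this] show ?thesis by blast
qed

lemma E_gconv_deriv: "dir_deriv v (gconv kern (E vs) t) (gconv kern (E (v # vs)) t)"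
proof -
  obtain C where C: "weight C (kern :: real^'n \<Rightarrow> real)" using weight_kern by blast
  obtain B where B: "\<And>x. norm (E vs x) \<le> B" using E_bounded by blast
  obtain B' where B': "\<And>x. norm (E (v # vs) x) \<le> B'" using E_bounded by blast
  show ?thesis by (rule gconv_deriv_comm[OF C E_cont B E_cont B' E_deriv])
qed

text \<open>A common template for \<open>D1\<close>, \<open>D2\<close> and \<open>D3\<close>, each
  the sum of a linear part and a Duhamel part with an admissible integrand.\<close>

lemma sum_bounded_on:
  assumes "admissible C \<theta> B" and D: "\<And>t x. D t x = gconv kern (E vs) t x + lam * volterra B t x"
  shows "continuous_on UNIV (\<lambda>(t, x). D t x)" "\<exists>K. \<forall>t\<le>T1. \<forall>x. norm (D t x) \<le> K"
proof -
  show "continuous_on UNIV (\<lambda>(t, x). D t x)"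
    using E_gconv_cont[of vs] volterra_continuous[OF assms(1)]
    unfolding D case_prod_beta by (intro continuous_intros)
  obtain K where K: "\<And>t x. norm (gconv kern (E vs) t x) \<le> K" using E_gconv_bounded by blast
  let ?J = "C * (\<integral>\<tau>. indicator {0<..<T1} \<tau> *\<^sub>R \<tau> powr (- \<theta>) \<partial>lborel)"
  have "norm (D t x) \<le> K + norm lam * ?J" if "t \<le> T1" for t x
    unfolding D
    by (rule order_trans[OF norm_triangle_ineq add_mono[OF K]])
       (use volterra_bound[OF assms(1) that] in \<open>simp add: norm_mult mult_left_mono\<close>)
  then show "\<exists>K. \<forall>t\<le>T1. \<forall>x. norm (D t x) \<le> K" by blast
qed

section \<open>First spatial derivatives\<close>

lemma B0_adm: "\<exists>C. admissible C 0 (\<lambda>\<tau> s. gconv kern (F s) \<tau>)"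
proof -
  obtain C where C: "weight C (kern :: real^'n \<Rightarrow> real)" using weight_kern by blast
  from admissible_gconv0[OF C F_cont F_bound] show ?thesis by blast
qed

lemma B1_adm: "\<exists>C. admissible C (1/2) (B1 v)"
proof -
  obtain C where C: "weight C (kern1 v)" using weight_kern1 by blast
  from admissible_gconv1[OF C F_cont F_bound] show ?thesis unfolding B1_def[abs_def] by blast
qed

lemma dir_deriv_B1: "\<tau> > 0 \<Longrightarrow> dir_deriv v (gconv kern (F s) \<tau>) (B1 v \<tau> s)"
proof -
  assume t: "\<tau> > 0"
  obtain C where C: "weight C (kern :: real^'n \<Rightarrow> real)" using weight_kern by blast
  obtain C' where C': "weight C' (kern1 v)" using weight_kern1 by blast
  show ?thesis unfolding B1_def[abs_def]
    by (rule gconv_deriv_weight[OF C C' kern_deriv(1) Fs_cont F_bound t])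
qed

lemma U_eq': "0 \<le> t \<Longrightarrow> t \<le> T1 \<Longrightarrow> U t = (\<lambda>x. gconv kern (E []) t x + lam * volterra (\<lambda>\<tau> s. gconv kern (F s) \<tau>) t x)"
  using U_eq by (simp add: F_def[abs_def] fun_eq_iff)

lemma dir_deriv_U: "0 \<le> t \<Longrightarrow> t \<le> T1 \<Longrightarrow> dir_deriv v (U t) (D1 v t)"
proof -
  assume t: "0 \<le> t" "t \<le> T1"
  obtain C where C: "admissible C 0 (\<lambda>\<tau> s. gconv kern (F s) \<tau>)" using B0_adm by blast
  obtain C' where C': "admissible C' (1/2) (B1 v)" using B1_adm by blast
  show ?thesis unfolding U_eq'[OF t] D1_def[abs_def]
    by (intro dir_deriv_add dir_deriv_cmult E_gconv_deriv volterra_deriv[OF C C' dir_deriv_B1])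
qed

lemma D1_cont: "continuous_on UNIV (\<lambda>(t, x). D1 v t x)"
  and D1_bounded: "\<exists>K. \<forall>t\<le>T1. \<forall>x. norm (D1 v t x) \<le> K"
proof -
  obtain C' where C': "admissible C' (1/2) (B1 v)" using B1_adm by blast
  note * = sum_bounded_on[OF C', where D = "D1 v" and vs = "[v]", OF D1_def]
  show "continuous_on UNIV (\<lambda>(t, x). D1 v t x)" "\<exists>K. \<forall>t\<le>T1. \<forall>x. norm (D1 v t x) \<le> K"
    using * by auto
qed

text \<open>Directional derivatives need not depend linearly on the direction. Here linearity comes
  from that of \<open>kern1 v\<close> and \<open>E [v]\<close> in \<open>v\<close>;
  \<open>G_lin\<close> inherits it, as the time derivative of the semigroup acting on
  \<open>F\<close> requires.\<close>

lemma D1_lin: "D1 v t x = (\<Sum>i\<in>UNIV. (v $ i) *\<^sub>R D1 (axis i 1) t x)"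
proof -
  obtain C where C: "weight C (kern :: real^'n \<Rightarrow> real)" using weight_kern by blast
  have "\<forall>i::'n. \<exists>B. \<forall>x. norm (E [axis i 1] x) \<le> B" using E_bounded by blast
  then obtain Bd where Bd: "\<And>(i::'n) x. norm (E [axis i 1] x) \<le> Bd i" by metis
  have 1: "gconv kern (E [v]) t x = (\<Sum>i\<in>UNIV. (v $ i) *\<^sub>R gconv kern (E [axis i 1]) t x)"
    unfolding E_lin[of v, abs_def] by (rule gconv_lincomb[OF C E_cont Bd])
  have "\<forall>i::'n. \<exists>C. admissible C (1/2) (B1 (axis i 1))" using B1_adm by blast
  then obtain Ca where Ca: "\<And>i::'n. admissible (Ca i) (1/2) (B1 (axis i 1))" by metis
  have "B1 v = (\<lambda>\<tau> s x. \<Sum>i\<in>UNIV. (v $ i) *\<^sub>R B1 (axis i 1) \<tau> s x)"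
    unfolding B1_def[abs_def] by (subst gconv_kern1_lincomb[OF Fs_cont F_bound]) (simp add: scaleR_sum_right mult.commute)
  then have 2: "volterra (B1 v) t x = (\<Sum>i\<in>UNIV. (v $ i) *\<^sub>R volterra (B1 (axis i 1)) t x)"
    using volterra_lincomb[of UNIV Ca "1/2" "\<lambda>i. B1 (axis i 1)", OF Ca] by simp
  show ?thesis unfolding D1_def 1 2 by (simp add: scaleR_add_right sum.distrib sum_distrib_left)
qed

lemma G_cont: "continuous_on UNIV (\<lambda>(t, x). G v t x)"
proof -
  have "continuous_on UNIV (\<lambda>p. (\<lambda>(t, x). D1 v t x) (clip (fst p), snd p))"
    by (rule continuous_on_compose2[OF D1_cont])
       (auto intro!: continuous_intros continuous_on_compose2[OF clip_cont])
  then show ?thesis unfolding G_def case_prod_beta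
    using U_cont by (intro continuous_on_dpnl[OF \<alpha>]) (auto simp: case_prod_beta)
qed

lemma G_bounded: "\<exists>K. \<forall>s x. norm (G v s x) \<le> K"
proof -
  obtain K where K: "\<And>t x. t \<le> T1 \<Longrightarrow> norm (D1 v t x) \<le> K" using D1_bounded by blast
  have "norm (G v s x) \<le> 2 * M powr \<alpha> * K" for s x
    unfolding G_def
    by (rule order_trans[OF dpnl_bound[OF \<alpha>]])
       (use U_bound[of s x] K[OF clip(2)] \<alpha> in \<open>auto intro!: mult_mono powr_mono2\<close>)
  then show ?thesis by blast
qed

lemma Gs_cont: "continuous_on UNIV (G v s)"
proof -
  obtain C where C: "weight C (kern :: real^'n \<Rightarrow> real)" using weight_kern by blast
  obtain K where K: "\<And>s x. norm (G v s x) \<le> K" using G_bounded by blast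
  show ?thesis using admissible_gconv(2)[OF C G_cont K] .
qed

text \<open>Outside \<open>[0, T1]\<close> the curve \<open>U\<close> is frozen while
  \<open>D1\<close> is not. The clipped time in \<open>G\<close> makes the formula valid at every
  \<open>s\<close>.\<close>

lemma dir_deriv_F: "dir_deriv v (F s) (G v s)"
  unfolding F_def[abs_def] G_def[abs_def]
  using dir_deriv_pnl[OF \<alpha>(1) dir_deriv_U[OF clip(1,2)], of v s] by (simp add: clip)

lemma G_lin: "G v s x = (\<Sum>i\<in>UNIV. (v $ i) *\<^sub>R G (axis i 1) s x)"
  unfolding G_def
  by (subst D1_lin) (simp add: linear_sum[OF bounded_linear.linear[OF bounded_linear_dpnl]]
    linear_scale[OF bounded_linear.linear[OF bounded_linear_dpnl]])

text \<open>Uniqueness of derivatives moves the derivative from the kernel to the nonlinearity.\<close>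

lemma B1_eq: "\<tau> > 0 \<Longrightarrow> B1 v \<tau> s = gconv kern (G v s) \<tau>"
proof -
  assume t: "\<tau> > 0"
  obtain C where C: "weight C (kern :: real^'n \<Rightarrow> real)" using weight_kern by blast
  obtain K where K: "\<And>s x. norm (G v s x) \<le> K" using G_bounded by blast
  show ?thesis
    by (rule dir_deriv_unique[OF dir_deriv_B1[OF t] gconv_deriv_comm[OF C Fs_cont F_bound Gs_cont K dir_deriv_F]])
qed

text \<open>With no derivative left on the kernel, the next differentiation costs only the exponent
  1/2. The two integrands agree at positive lags, and the indicator removes the others.\<close>

lemma D1_eq: "D1 v t = (\<lambda>x. gconv kern (E [v]) t x + lam * volterra (\<lambda>\<tau> s. gconv kern (G v s) \<tau>) t x)"
proof -
  have "volterra (B1 v) t x = volterra (\<lambda>\<tau> s. gconv kern (G v s) \<tau>) t x" for x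
    unfolding volterra_def by (rule Bochner_Integration.integral_cong) (auto simp: indicator_def B1_eq)
  then show ?thesis by (simp add: D1_def[abs_def])
qed

section \<open>Second and third spatial derivatives\<close>

lemma C1_adm: "\<exists>C. admissible C (1/2) (C1 v w)"
proof -
  obtain C where C: "weight C (kern1 w)" using weight_kern1 by blast
  obtain K where K: "\<And>s x. norm (G v s x) \<le> K" using G_bounded by blast
  from admissible_gconv1[OF C G_cont K] show ?thesis unfolding C1_def[abs_def] by blast
qed

lemma dir_deriv_D1: "dir_deriv w (D1 v t) (D2 v w t)"
proof -
  obtain C where C: "weight C (kern :: real^'n \<Rightarrow> real)" using weight_kern by blast
  obtain C' where C': "weight C' (kern1 w)" using weight_kern1 by blast
  obtain K where K: "\<And>s x. norm (G v s x) \<le> K" using G_bounded by blast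
  have d: "dir_deriv w (gconv kern (G v s) \<tau>) (C1 v w \<tau> s)" if "\<tau> > 0" for \<tau> s
    unfolding C1_def[abs_def] by (rule gconv_deriv_weight[OF C C' kern_deriv(1) Gs_cont K that])
  obtain Ca where Ca: "admissible Ca (1/2) (C1 v w)" using C1_adm by blast
  show ?thesis unfolding D1_eq D2_def[abs_def]
    by (intro dir_deriv_add dir_deriv_cmult E_gconv_deriv volterra_deriv[OF admissible_gconv0[OF C G_cont K] Ca d])
qed

lemma D2_cont: "continuous_on UNIV (\<lambda>(t, x). D2 v w t x)"
  and D2_bounded: "\<exists>K. \<forall>t\<le>T1. \<forall>x. norm (D2 v w t x) \<le> K"
proof -
  obtain C' where C': "admissible C' (1/2) (C1 v w)" using C1_adm by blast
  note * = sum_bounded_on[OF C', where D = "D2 v w" and vs = "[w, v]", OF D2_def]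
  show "continuous_on UNIV (\<lambda>(t, x). D2 v w t x)" "\<exists>K. \<forall>t\<le>T1. \<forall>x. norm (D2 v w t x) \<le> K"
    using * by auto
qed

lemma D1_lipschitz: "\<exists>K\<ge>0. \<forall>t\<le>T1. \<forall>x y. norm (D1 v t x - D1 v t y) \<le> K * norm (x - y)"
proof -
  have "\<forall>i::'n. \<exists>K. \<forall>t\<le>T1. \<forall>x. norm (D2 v (axis i 1) t x) \<le> K" using D2_bounded by blast
  then obtain K where K: "\<And>(i::'n) t x. t \<le> T1 \<Longrightarrow> norm (D2 v (axis i 1) t x) \<le> K i" by metis
  have "norm (D2 v (axis i 1) t x) \<le> (\<Sum>i\<in>UNIV. \<bar>K i\<bar>)" if "t \<le> T1" for i t x
    using K[OF that, of i x] member_le_sum[of i UNIV "\<lambda>i. \<bar>K i\<bar>"] by fastforce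
  from lipschitz_from_axes[OF dir_deriv_D1 this]
  show ?thesis by (intro exI[of _ "real CARD('n) * (\<Sum>i\<in>UNIV. \<bar>K i\<bar>)"]) (auto intro!: mult_nonneg_nonneg sum_nonneg)
qed

lemma U_lipschitz: "\<exists>K\<ge>0. \<forall>s x y. norm (U s x - U s y) \<le> K * norm (x - y)"
proof -
  have "\<forall>i::'n. \<exists>K. \<forall>t\<le>T1. \<forall>x. norm (D1 (axis i 1) t x) \<le> K" using D1_bounded by blast
  then obtain K where K: "\<And>(i::'n) t x. t \<le> T1 \<Longrightarrow> norm (D1 (axis i 1) t x) \<le> K i" by metis
  have k: "norm (D1 (axis i 1) t x) \<le> (\<Sum>i\<in>UNIV. \<bar>K i\<bar>)" if "t \<le> T1" for i t x
    using K[OF that, of i x] member_le_sum[of i UNIV "\<lambda>i. \<bar>K i\<bar>"] by fastforce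
  have "norm (U (clip s) x - U (clip s) y) \<le> real CARD('n) * (\<Sum>i\<in>UNIV. \<bar>K i\<bar>) * norm (x - y)" for s x y
    by (rule lipschitz_from_axes[OF dir_deriv_U[OF clip(1,2)] k[OF clip(2)]])
  then show ?thesis unfolding clip(4) by (intro exI[of _ "real CARD('n) * (\<Sum>i\<in>UNIV. \<bar>K i\<bar>)"]) (auto intro!: mult_nonneg_nonneg sum_nonneg)
qed

text \<open>The difference splits into a change of base point in \<open>dpnl\<close>, where its
  Hoelder bound meets the Lipschitz bound of \<open>U\<close>, and a change of direction, where
  \<open>D1\<close> is Lipschitz and bounded, hence Hoelder.\<close>

lemma G_holder: "\<exists>H. \<forall>s x y. norm (G v s x - G v s y) \<le> H * norm (x - y) powr \<alpha>"
proof -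
  obtain K where K: "K \<ge> 0" "\<And>s x y. norm (U s x - U s y) \<le> K * norm (x - y)" using U_lipschitz by blast
  obtain L where L: "L \<ge> 0" "\<And>t x y. t \<le> T1 \<Longrightarrow> norm (D1 v t x - D1 v t y) \<le> L * norm (x - y)" using D1_lipschitz by blast
  obtain N where N: "\<And>t x. t \<le> T1 \<Longrightarrow> norm (D1 v t x) \<le> N" using D1_bounded by blast
  have "norm (G v s x - G v s y) \<le> (6 * K powr \<alpha> * N + 2 * M powr \<alpha> * (L + 2 * N)) * norm (x - y) powr \<alpha>" for s x y
  proof -
    let ?t = "clip s" and ?d = "norm (x - y) powr \<alpha>"
    have e: "G v s x - G v s y = (dpnl \<alpha> (U s x) (D1 v ?t x) - dpnl \<alpha> (U s y) (D1 v ?t x)) + dpnl \<alpha> (U s y) (D1 v ?t x - D1 v ?t y)"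
      by (simp add: G_def linear_diff[OF bounded_linear.linear[OF bounded_linear_dpnl]])
    have "norm (dpnl \<alpha> (U s x) (D1 v ?t x) - dpnl \<alpha> (U s y) (D1 v ?t x)) \<le> 6 * norm (U s x - U s y) powr \<alpha> * norm (D1 v ?t x)"
      by (rule dpnl_holder[OF \<alpha>])
    also have "\<dots> \<le> 6 * (K powr \<alpha> * ?d) * N"
    proof (intro mult_mono)
      have "norm (U s x - U s y) powr \<alpha> \<le> (K * norm (x - y)) powr \<alpha>" using \<alpha> K by (intro powr_mono2) auto
      then show "norm (U s x - U s y) powr \<alpha> \<le> K powr \<alpha> * ?d" using K by (simp add: powr_mult)
    qed (use N clip in auto)
    finally have 1: "norm (dpnl \<alpha> (U s x) (D1 v ?t x) - dpnl \<alpha> (U s y) (D1 v ?t x)) \<le> 6 * K powr \<alpha> * N * ?d" by (simp add: mult_ac)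
    have "norm (dpnl \<alpha> (U s y) (D1 v ?t x - D1 v ?t y)) \<le> 2 * norm (U s y) powr \<alpha> * norm (D1 v ?t x - D1 v ?t y)"
      by (rule dpnl_bound[OF \<alpha>])
    also have "\<dots> \<le> 2 * M powr \<alpha> * ((L + 2 * N) * ?d)"
      using U_bound[of s y] \<alpha> holder_of_lipschitz[of "D1 v ?t" L N \<alpha>, OF L(2)[OF clip(2)] N[OF clip(2)] \<alpha>(1) _ L(1)]
      by (intro mult_mono powr_mono2) auto
    finally have 2: "norm (dpnl \<alpha> (U s y) (D1 v ?t x - D1 v ?t y)) \<le> 2 * M powr \<alpha> * (L + 2 * N) * ?d" by (simp add: mult_ac)
    have "norm (G v s x - G v s y) \<le> 6 * K powr \<alpha> * N * ?d + 2 * M powr \<alpha> * (L + 2 * N) * ?d"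
      unfolding e by (rule norm_triangle_mono[OF 1 2])
    then show ?thesis by (simp add: distrib_right)
  qed
  then show ?thesis by blast
qed

text \<open>As a directional derivative of the weight \<open>kern1 w\<close>,
  \<open>kern2 w w'\<close> has mean zero, so the Hoelder continuity of \<open>G\<close> can be
  spent.\<close>

lemma C2_adm: "\<exists>C. admissible C (1 - \<alpha>/2) (C2 v w w')"
proof -
  obtain C where C: "weight C (kern1 w)" using weight_kern1 by blast
  obtain C' where C': "weight C' (kern2 w w')" using weight_kern2 by blast
  obtain K where K: "\<And>s x. norm (G v s x) \<le> K" using G_bounded by blast
  obtain H where H: "\<And>s x y. norm (G v s x - G v s y) \<le> H * norm (x - y) powr \<alpha>" using G_holder by blast
  from admissible_gconv2[OF C' G_cont K H \<alpha>(1) less_imp_le[OF \<alpha>(2)] integral_weight_deriv_0[OF C C' kern_deriv(2)]]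
  show ?thesis unfolding C2_def[abs_def] by blast
qed

lemma dir_deriv_D2: "dir_deriv w' (D2 v w t) (D3 v w w' t)"
proof -
  obtain C where C: "weight C (kern1 w)" using weight_kern1 by blast
  obtain C' where C': "weight C' (kern2 w w')" using weight_kern2 by blast
  obtain K where K: "\<And>s x. norm (G v s x) \<le> K" using G_bounded by blast
  have d: "dir_deriv w' (C1 v w \<tau> s) (C2 v w w' \<tau> s)" if "\<tau> > 0" for \<tau> s
  proof -
    have "dir_deriv w' (\<lambda>x. of_real (1 / sqrt \<tau>) * gconv (kern1 w) (G v s) \<tau> x) (\<lambda>x. of_real (1 / sqrt \<tau>) * ((1 / sqrt \<tau>) *\<^sub>R gconv (kern2 w w') (G v s) \<tau> x))"
      by (intro dir_deriv_cmult gconv_deriv_weight[OF C C' kern_deriv(2) Gs_cont K that])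
    moreover have "of_real (1 / sqrt \<tau>) * ((1 / sqrt \<tau>) *\<^sub>R z) = (1 / \<tau>) *\<^sub>R z" for z :: complex
    proof -
      have "of_real (1 / sqrt \<tau>) * ((1 / sqrt \<tau>) *\<^sub>R z) = ((1 / sqrt \<tau>) * (1 / sqrt \<tau>)) *\<^sub>R z"
        by (simp only: scaleR_conv_of_real of_real_mult mult.assoc)
      also have "(1 / sqrt \<tau>) * (1 / sqrt \<tau>) = 1 / \<tau>" using that by simp
      finally show ?thesis .
    qed
    ultimately show ?thesis unfolding C1_def[abs_def] C2_def[abs_def] by (simp only: scaleR_conv_of_real)
  qed
  obtain Ca where Ca: "admissible Ca (1/2) (C1 v w)" using C1_adm by blast
  obtain Cb where Cb: "admissible Cb (1 - \<alpha>/2) (C2 v w w')" using C2_adm by blast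
  show ?thesis unfolding D2_def[abs_def] D3_def[abs_def]
    by (intro dir_deriv_add dir_deriv_cmult E_gconv_deriv volterra_deriv[OF Ca Cb d])
qed

lemma D3_cont: "continuous_on UNIV (\<lambda>(t, x). D3 v w w' t x)"
  and D3_bounded: "\<exists>K. \<forall>t\<le>T1. \<forall>x. norm (D3 v w w' t x) \<le> K"
proof -
  obtain C' where C': "admissible C' (1 - \<alpha>/2) (C2 v w w')" using C2_adm by blast
  note * = sum_bounded_on[OF C', where D = "D3 v w w'" and vs = "[w', w, v]", OF D3_def]
  show "continuous_on UNIV (\<lambda>(t, x). D3 v w w' t x)" "\<exists>K. \<forall>t\<le>T1. \<forall>x. norm (D3 v w w' t x) \<le> K"
    using * by auto
qed

section \<open>The equation integrated in time\<close>

lemma at_point_cont: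
  assumes "continuous_on UNIV (\<lambda>(t, x). f t x)" shows "continuous_on A (\<lambda>t. f t x)"
proof -
  have "continuous_on A (\<lambda>t. (\<lambda>(t, x). f t x) (t, x))"
    by (rule continuous_on_compose2[OF assms]) (auto intro!: continuous_intros)
  then show ?thesis by simp
qed

text \<open>Uniqueness of derivatives moves the kernel derivative onto the datum, so that the
  integrand becomes the linear part of the sum of the \<open>D2\<close>.\<close>

lemma E_time_integral:
  assumes "0 \<le> t"
  shows "gconv kern (E []) t x = E [] x + (\<integral>\<sigma>. indicator {0<..<t} \<sigma> *\<^sub>R (\<Sum>i\<in>UNIV. gconv kern (E [axis i 1, axis i 1]) \<sigma> x) \<partial>lborel)"
proof -
  obtain C where C: "weight C (kern :: real^'n \<Rightarrow> real)" using weight_kern by blast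
  have "\<forall>i::'n. \<exists>B. \<forall>x. norm (E [axis i 1] x) \<le> B" using E_bounded by blast
  then obtain Bd where Bd: "\<And>(i::'n) x. norm (E [axis i 1] x) \<le> Bd i" by metis
  have bd: "norm (E [axis i 1] x) \<le> (\<Sum>i\<in>UNIV. \<bar>Bd i\<bar>)" for i x
    using Bd[of i x] member_le_sum[of i UNIV "\<lambda>i. \<bar>Bd i\<bar>"] by fastforce
  obtain B where B: "\<And>x. norm (E [] x) \<le> B" using E_bounded by blast
  have e: "(1 / sqrt \<rho>) *\<^sub>R gconv (kern1 (axis i 1)) (E [axis i 1]) \<rho> x = gconv kern (E [axis i 1, axis i 1]) \<rho> x"
    if "\<rho> > 0" for i \<rho>
  proof -
    obtain C' where C': "weight C' (kern1 (axis i 1 :: real^'n))" using weight_kern1 by blast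
    from dir_deriv_unique[OF gconv_deriv_weight[OF C C' kern_deriv(1) E_cont Bd that] E_gconv_deriv]
    show ?thesis by (rule fun_cong)
  qed
  have "gconv kern (E []) t x = E [] x + (\<integral>\<rho>. indicator {0<..<t} \<rho> *\<^sub>R
     (\<Sum>i\<in>UNIV. (1 / sqrt \<rho>) *\<^sub>R gconv (kern1 (axis i 1)) (E [axis i 1]) \<rho> x) \<partial>lborel)"
    by (rule gconv_time_integral[OF E_cont B E_deriv E_lin E_cont bd assms])
  also have "(\<integral>\<rho>. indicator {0<..<t} \<rho> *\<^sub>R (\<Sum>i\<in>UNIV. (1 / sqrt \<rho>) *\<^sub>R gconv (kern1 (axis i 1)) (E [axis i 1]) \<rho> x) \<partial>lborel)
     = (\<integral>\<sigma>. indicator {0<..<t} \<sigma> *\<^sub>R (\<Sum>i\<in>UNIV. gconv kern (E [axis i 1, axis i 1]) \<sigma> x) \<partial>lborel)"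
  proof (rule Bochner_Integration.integral_cong)
    fix \<rho>
    show "indicator {0<..<t} \<rho> *\<^sub>R (\<Sum>i\<in>UNIV. (1 / sqrt \<rho>) *\<^sub>R gconv (kern1 (axis i 1)) (E [axis i 1]) \<rho> x)
       = indicator {0<..<t} \<rho> *\<^sub>R (\<Sum>i\<in>UNIV. gconv kern (E [axis i 1, axis i 1]) \<rho> x)"
    proof (cases "\<rho> \<in> {0<..<t}")
      case True
      then have "\<rho> > 0" by simp
      then show ?thesis by (simp only: e)
    qed simp
  qed simp
  finally show ?thesis .
qed

text \<open>Fubini needs an integrable singularity. The Laplacian of the semigroup therefore appears
  as one derivative on the kernel and one on \<open>F\<close>, which is exactly
  \<open>C1\<close>.\<close>

lemma volterra_F:
  "volterra (\<lambda>\<tau> s. gconv kern (F s) \<tau>) t x = (\<integral>\<sigma>. indicator {0<..<t} \<sigma> *\<^sub>R F \<sigma> x \<partial>lborel) +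
    (\<integral>\<sigma>. indicator {0<..<t} \<sigma> *\<^sub>R (\<Sum>i\<in>UNIV. volterra (C1 (axis i 1) (axis i 1)) \<sigma> x) \<partial>lborel)"
proof -
  let ?L = "\<lambda>\<tau> s x. \<Sum>i\<in>(UNIV::'n set). 1 *\<^sub>R C1 (axis i 1) (axis i 1) \<tau> s x"
  have "\<forall>i::'n. \<exists>C. admissible C (1/2) (C1 (axis i 1) (axis i 1))" using C1_adm by blast
  then obtain Ca where Ca: "\<And>i::'n. admissible (Ca i) (1/2) (C1 (axis i 1) (axis i 1))" by metis
  have "\<forall>i::'n. \<exists>K. \<forall>s x. norm (G (axis i 1) s x) \<le> K" using G_bounded by blast
  then obtain K where K: "\<And>(i::'n) s x. norm (G (axis i 1) s x) \<le> K i" by metis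
  have k: "norm (G (axis i 1) s x) \<le> (\<Sum>i\<in>UNIV. \<bar>K i\<bar>)" for i s x
    using K[of i s x] member_le_sum[of i UNIV "\<lambda>i. \<bar>K i\<bar>"] by fastforce
  have b: "gconv kern (F r) \<tau> x = F r x + (\<integral>\<rho>. indicator {0<..<\<tau>} \<rho> *\<^sub>R ?L \<rho> r x \<partial>lborel)" if "\<tau> > 0" for \<tau> r
    using gconv_time_integral[OF Fs_cont F_bound dir_deriv_F G_lin Gs_cont k, of \<tau> r] that by (simp add: C1_def)
  have L: "admissible (\<Sum>i\<in>UNIV. \<bar>1\<bar> * Ca i) (1/2) ?L" by (rule admissible_lincomb[OF Ca]) auto
  have "volterra ?L \<sigma> x = (\<Sum>i\<in>UNIV. 1 *\<^sub>R volterra (C1 (axis i 1) (axis i 1)) \<sigma> x)" for \<sigma>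
    by (rule volterra_lincomb[OF Ca])
  moreover have "volterra (\<lambda>\<tau> s. gconv kern (F s) \<tau>) t x = (\<integral>\<sigma>. indicator {0<..<t} \<sigma> *\<^sub>R F \<sigma> x \<partial>lborel) +
      (\<integral>\<sigma>. indicator {0<..<t} \<sigma> *\<^sub>R volterra ?L \<sigma> x \<partial>lborel)"
    by (rule volterra_time_identity[where F = F and L = ?L, OF L at_point_cont[OF F_cont]]) (rule b)
  ultimately show ?thesis by simp
qed

text \<open>The sum of the \<open>D2\<close> is the Laplacian, so this is the equation in integrated
  form. Its linear and Duhamel parts come from the two preceding lemmas.\<close>

lemma U_time_integral:
  assumes "0 \<le> t" "t \<le> T1"
  shows "U t x = E [] x + (\<integral>\<sigma>. indicator {0<..<t} \<sigma> *\<^sub>R ((\<Sum>i\<in>UNIV. D2 (axis i 1) (axis i 1) \<sigma> x) + lam * F \<sigma> x) \<partial>lborel)"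
proof -
  let ?P = "\<lambda>\<sigma>. \<Sum>i\<in>UNIV. gconv kern (E [axis i 1, axis i 1]) \<sigma> x"
  let ?Q = "\<lambda>\<sigma>. \<Sum>i\<in>UNIV. volterra (C1 (axis i 1) (axis i 1)) \<sigma> x"
  have cP: "continuous_on UNIV ?P" by (intro continuous_on_sum at_point_cont[OF E_gconv_cont])
  have cQ: "continuous_on UNIV ?Q"
  proof (intro continuous_on_sum)
    fix i :: 'n
    obtain C where "admissible C (1/2) (C1 (axis i 1) (axis i 1))" using C1_adm by blast
    from at_point_cont[OF volterra_continuous[OF this]]
    show "continuous_on UNIV (\<lambda>\<sigma>. volterra (C1 (axis i 1) (axis i 1)) \<sigma> x)" .
  qed
  have cF: "continuous_on UNIV (\<lambda>\<sigma>. F \<sigma> x)" by (rule at_point_cont[OF F_cont])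
  note i = Ioo_integrable[OF continuous_on_subset[OF cP subset_UNIV], of 0 t] Ioo_integrable[OF continuous_on_subset[OF cQ subset_UNIV], of 0 t]
    Ioo_integrable[OF continuous_on_subset[OF cF subset_UNIV], of 0 t]
  let ?I = "\<lambda>h. (\<integral>\<sigma>. indicator {0<..<t} \<sigma> *\<^sub>R h \<sigma> \<partial>lborel) :: complex"
  have "U t x = E [] x + ?I ?P + lam * (?I (\<lambda>\<sigma>. F \<sigma> x) + ?I ?Q)"
    unfolding U_eq'[OF assms] E_time_integral[OF assms(1)] volterra_F ..
  also have "\<dots> = E [] x + (?I ?P + (\<integral>\<sigma>. lam * (indicator {0<..<t} \<sigma> *\<^sub>R F \<sigma> x + indicator {0<..<t} \<sigma> *\<^sub>R ?Q \<sigma>) \<partial>lborel))"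
    unfolding integral_mult_right_zero Bochner_Integration.integral_add[OF i(3,2)] add.assoc ..
  also have "?I ?P + (\<integral>\<sigma>. lam * (indicator {0<..<t} \<sigma> *\<^sub>R F \<sigma> x + indicator {0<..<t} \<sigma> *\<^sub>R ?Q \<sigma>) \<partial>lborel)
     = (\<integral>\<sigma>. indicator {0<..<t} \<sigma> *\<^sub>R ?P \<sigma> + lam * (indicator {0<..<t} \<sigma> *\<^sub>R F \<sigma> x + indicator {0<..<t} \<sigma> *\<^sub>R ?Q \<sigma>) \<partial>lborel)"
    by (rule Bochner_Integration.integral_add[symmetric, OF i(1) integrable_mult_right[OF Bochner_Integration.integrable_add[OF i(3,2)]]])
  also have "\<dots> = (\<integral>\<sigma>. indicator {0<..<t} \<sigma> *\<^sub>R ((\<Sum>i\<in>UNIV. D2 (axis i 1) (axis i 1) \<sigma> x) + lam * F \<sigma> x) \<partial>lborel)"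
  proof (rule Bochner_Integration.integral_cong)
    fix \<sigma>
    show "indicator {0<..<t} \<sigma> *\<^sub>R ?P \<sigma> + lam * (indicator {0<..<t} \<sigma> *\<^sub>R F \<sigma> x + indicator {0<..<t} \<sigma> *\<^sub>R ?Q \<sigma>) =
      indicator {0<..<t} \<sigma> *\<^sub>R ((\<Sum>i\<in>UNIV. D2 (axis i 1) (axis i 1) \<sigma> x) + lam * F \<sigma> x)"
      by (cases "\<sigma> \<in> {0<..<t}") (simp_all add: D2_def sum.distrib sum_distrib_left distrib_left)
  qed simp
  finally show ?thesis .
qed

text \<open>The identity for \<open>U\<close> is differentiated in space under the time integral,
  and uniqueness of derivatives identifies the result with \<open>D1\<close>. The Laplacian is taken
  before \<open>v\<close>, so the third derivatives appear in the order required by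
  \<open>partial k (laplacian _)\<close>.\<close>

lemma D1_time_integral:
  assumes "0 \<le> t" "t \<le> T1"
  shows "D1 v t x = E [v] x + (\<integral>\<sigma>. indicator {0<..<t} \<sigma> *\<^sub>R ((\<Sum>i\<in>UNIV. D3 (axis i 1) (axis i 1) v \<sigma> x) + lam * G v \<sigma> x) \<partial>lborel)"
proof -
  \<comment> \<open>To reuse \<open>volterra_deriv\<close>, the time integral is written as a
    Volterra integral whose lag plays the role of time and whose source time is a dummy. Clipping
    makes the bounds global.\<close>
  let ?B = "\<lambda>\<tau> (s::real) x. (\<Sum>i\<in>UNIV. D2 (axis i 1) (axis i 1) (clip \<tau>) x) + lam * F (clip \<tau>) x"
  let ?B' = "\<lambda>\<tau> (s::real) x. (\<Sum>i\<in>UNIV. D3 (axis i 1) (axis i 1) v (clip \<tau>) x) + lam * G v (clip \<tau>) x"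
  have ccomp: "continuous_on A (\<lambda>(\<tau>, s::real, x). f (clip \<tau>) x)"
    if "continuous_on UNIV (\<lambda>(t, x). f t x)" for f :: "real \<Rightarrow> real^'n \<Rightarrow> complex" and A
  proof -
    have "continuous_on A (\<lambda>p. (\<lambda>(t, x). f t x) (clip (fst p), snd (snd p)))"
      by (rule continuous_on_compose2[OF that]) (auto intro!: continuous_intros continuous_on_compose2[OF clip_cont])
    then show ?thesis by (simp add: case_prod_beta)
  qed
  have "\<forall>i::'n. \<exists>K. \<forall>t\<le>T1. \<forall>x. norm (D2 (axis i 1) (axis i 1) t x) \<le> K" using D2_bounded by blast
  then obtain K where K: "\<And>(i::'n) t x. t \<le> T1 \<Longrightarrow> norm (D2 (axis i 1) (axis i 1) t x) \<le> K i" by metis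
  have "\<forall>i::'n. \<exists>K. \<forall>t\<le>T1. \<forall>x. norm (D3 (axis i 1) (axis i 1) v t x) \<le> K" using D3_bounded by blast
  then obtain K' where K': "\<And>(i::'n) t x. t \<le> T1 \<Longrightarrow> norm (D3 (axis i 1) (axis i 1) v t x) \<le> K' i" by metis
  obtain N where N: "\<And>s x. norm (G v s x) \<le> N" using G_bounded by blast
  have a: "admissible ((\<Sum>i\<in>UNIV. K i) + norm lam * (M powr \<alpha> * M)) 0 ?B"
    unfolding admissible_def
  proof (intro conjI allI impI)
    show "continuous_on ({0<..} \<times> UNIV) (\<lambda>(\<tau>, s, x). ?B \<tau> s x)"
      using ccomp[OF D2_cont] ccomp[OF F_cont] unfolding case_prod_beta by (intro continuous_intros)
    show "norm (?B \<tau> s x) \<le> ((\<Sum>i\<in>UNIV. K i) + norm lam * (M powr \<alpha> * M)) * \<tau> powr - 0" if "\<tau> > 0" for \<tau> and s :: real and x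
    proof -
      have "norm (?B \<tau> s x) \<le> (\<Sum>i\<in>UNIV. K i) + norm lam * (M powr \<alpha> * M)"
        by (intro order_trans[OF norm_triangle_ineq] add_mono order_trans[OF norm_sum] sum_mono K clip)
           (simp add: norm_mult mult_left_mono F_bound)
      then show ?thesis using that by simp
    qed
  qed simp
  have a': "admissible ((\<Sum>i\<in>UNIV. K' i) + norm lam * N) 0 ?B'"
    unfolding admissible_def
  proof (intro conjI allI impI)
    show "continuous_on ({0<..} \<times> UNIV) (\<lambda>(\<tau>, s, x). ?B' \<tau> s x)"
      using ccomp[OF D3_cont] ccomp[OF G_cont] unfolding case_prod_beta by (intro continuous_intros)
    show "norm (?B' \<tau> s x) \<le> ((\<Sum>i\<in>UNIV. K' i) + norm lam * N) * \<tau> powr - 0" if "\<tau> > 0" for \<tau> and s :: real and x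
    proof -
      have "norm (?B' \<tau> s x) \<le> (\<Sum>i\<in>UNIV. K' i) + norm lam * N"
        by (intro order_trans[OF norm_triangle_ineq] add_mono order_trans[OF norm_sum] sum_mono K' clip)
           (simp add: norm_mult mult_left_mono N)
      then show ?thesis using that by simp
    qed
  qed simp
  have d: "dir_deriv v (?B \<tau> s) (?B' \<tau> s)" for \<tau> and s :: real
    by (intro dir_deriv_add dir_deriv_sum dir_deriv_cmult dir_deriv_D2 dir_deriv_F)
  have e: "U t = (\<lambda>x. E [] x + volterra ?B t x)"
    unfolding volterra_def U_time_integral[OF assms, abs_def]
    by (intro ext arg_cong2[where f = "(+)"] refl Bochner_Integration.integral_cong)
       (use assms in \<open>auto simp: indicator_def clip\<close>)
  have "dir_deriv v (U t) (\<lambda>x. E [v] x + volterra ?B' t x)"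
    unfolding e by (intro dir_deriv_add E_deriv volterra_deriv[OF a a' d])
  from dir_deriv_unique[OF dir_deriv_U[OF assms] this]
  have "D1 v t x = E [v] x + volterra ?B' t x" by (rule fun_cong)
  also have "volterra ?B' t x = (\<integral>\<sigma>. indicator {0<..<t} \<sigma> *\<^sub>R ((\<Sum>i\<in>UNIV. D3 (axis i 1) (axis i 1) v \<sigma> x) + lam * G v \<sigma> x) \<partial>lborel)"
    unfolding volterra_def by (rule Bochner_Integration.integral_cong) (use assms in \<open>auto simp: indicator_def clip\<close>)
  finally show ?thesis .
qed

lemma D1_increment:
  assumes "0 \<le> s" "s \<le> t" "t \<le> T1"
  shows "D1 v t x - D1 v s x = (\<integral>\<sigma>. indicator {s<..<t} \<sigma> *\<^sub>R ((\<Sum>i\<in>UNIV. D3 (axis i 1) (axis i 1) v \<sigma> x) + lam * G v \<sigma> x) \<partial>lborel)"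
proof -
  let ?h = "\<lambda>\<sigma>. (\<Sum>i\<in>UNIV. D3 (axis i 1) (axis i 1) v \<sigma> x) + lam * G v \<sigma> x"
  have c: "continuous_on UNIV ?h"
    by (intro continuous_intros at_point_cont[OF D3_cont] at_point_cont[OF G_cont])
  have "D1 v t x - D1 v s x = (\<integral>\<sigma>. indicator {0<..<t} \<sigma> *\<^sub>R ?h \<sigma> \<partial>lborel) - (\<integral>\<sigma>. indicator {0<..<s} \<sigma> *\<^sub>R ?h \<sigma> \<partial>lborel)"
    using D1_time_integral[of t v x] D1_time_integral[of s v x] assms by simp
  also have "\<dots> = (\<integral>\<sigma>. indicator {0<..<t} \<sigma> *\<^sub>R ?h \<sigma> - indicator {0<..<s} \<sigma> *\<^sub>R ?h \<sigma> \<partial>lborel)"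
    by (intro Bochner_Integration.integral_diff[symmetric] Ioo_integrable continuous_on_subset[OF c subset_UNIV])
  also have "\<dots> = (\<integral>\<sigma>. indicator {s<..<t} \<sigma> *\<^sub>R ?h \<sigma> \<partial>lborel)"
  proof (rule integral_cong_AE)
    have m: "(\<lambda>\<sigma>. indicator {a<..<b} \<sigma> *\<^sub>R ?h \<sigma>) \<in> borel_measurable lborel" for a b
      unfolding measurable_lborel2
      by (intro borel_measurable_continuous_on_indicator continuous_on_subset[OF c]) auto
    show "(\<lambda>\<sigma>. indicator {s<..<t} \<sigma> *\<^sub>R ?h \<sigma>) \<in> borel_measurable lborel"
      "(\<lambda>\<sigma>. indicator {0<..<t} \<sigma> *\<^sub>R ?h \<sigma> - indicator {0<..<s} \<sigma> *\<^sub>R ?h \<sigma>) \<in> borel_measurable lborel"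
      by (intro borel_measurable_diff m)+
    show "AE \<sigma> in lborel. indicator {0<..<t} \<sigma> *\<^sub>R ?h \<sigma> - indicator {0<..<s} \<sigma> *\<^sub>R ?h \<sigma> = indicator {s<..<t} \<sigma> *\<^sub>R ?h \<sigma>"
      using AE_lborel_singleton[of s] by eventually_elim (use assms in \<open>auto simp: indicator_def\<close>)
  qed
  finally show ?thesis .
qed

section \<open>Translation into \<open>Ck\<close> and \<open>laplacian\<close>\<close>

lemma section_cont:
  assumes "continuous_on UNIV (\<lambda>(t, x). f t x)" shows "continuous_on UNIV (f t)"
proof -
  have "continuous_on UNIV (\<lambda>x. (\<lambda>(t, x). f t x) (t, x))"
    by (rule continuous_on_compose2[OF assms]) (auto intro!: continuous_intros)
  then show ?thesis by simp
qed

lemma Ck3_U: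
  assumes "0 \<le> t" "t \<le> T1" shows "Ck 3 (U t)"
proof -
  have "Ck (Suc (Suc (Suc 0))) (U t)"
    using section_cont[OF U_cont, of t] section_cont[OF D1_cont, of _ t] section_cont[OF D2_cont, of _ _ t]
      section_cont[OF D3_cont, of _ _ _ t]
    by (simp add: dir_deriv_partial[OF dir_deriv_U[OF assms]] dir_deriv_partial[OF dir_deriv_D1]
      dir_deriv_partial[OF dir_deriv_D2])
  then show ?thesis by (simp add: numeral_3_eq_3)
qed

lemma partial_laplacian_U:
  assumes "0 \<le> t" "t \<le> T1"
  shows "partial k (laplacian (U t)) = (\<lambda>x. \<Sum>i\<in>UNIV. D3 (axis i 1) (axis i 1) (axis k 1) t x)"
proof -
  have "laplacian (U t) = (\<lambda>x. \<Sum>i\<in>UNIV. D2 (axis i 1) (axis i 1) t x)"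
    by (simp add: fun_eq_iff laplacian_def dir_deriv_partial[OF dir_deriv_U[OF assms]] dir_deriv_partial[OF dir_deriv_D1])
  then show ?thesis by (simp only:) (intro dir_deriv_partial(2) dir_deriv_sum dir_deriv_D2)
qed

section \<open>Lower bound for the seminorm\<close>

text \<open>At distance \<open>h\<close> from the origin \<open>U\<close> is within \<open>h / 2\<close> of \<open>h\<close>, which makes both terms of \<open>dpnl\<close> contribute
  nonnegatively.\<close>

lemma G_lower_bound:
  assumes odd: "U s 0 = 0" and s: "0 \<le> s" "s \<le> T1" and h: "0 < h"
    and near: "\<And>y. 0 \<le> y \<Longrightarrow> y \<le> h \<Longrightarrow> norm (D1 v s (y *\<^sub>R v) - 1) \<le> 1 / 2"
  shows "Re (G v s (h *\<^sub>R v)) \<ge> (h / 2) powr \<alpha> / 2"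
proof -
  let ?u = "U s (h *\<^sub>R v)" and ?d = "D1 v s (h *\<^sub>R v)"
  have "norm ((\<lambda>y. U s (y *\<^sub>R v) - of_real y) h - (\<lambda>y. U s (y *\<^sub>R v) - of_real y) 0) \<le> 1/2 * norm (h - 0)"
  proof (rule differentiable_bound[where S = "{0..h}" and f' = "\<lambda>y r. r *\<^sub>R (D1 v s (y *\<^sub>R v) - 1)"])
    fix y assume y: "y \<in> {0..h}"
    have "((\<lambda>y. U s (y *\<^sub>R v)) has_vector_derivative D1 v s (y *\<^sub>R v)) (at y within {0..h})"
      using dir_deriv_at[OF dir_deriv_U[OF s], where x = 0] by simp
    moreover have "((\<lambda>y. of_real y :: complex) has_vector_derivative 1) (at y within {0..h})"
      by (auto intro!: derivative_eq_intros)
    ultimately have "((\<lambda>y. U s (y *\<^sub>R v) - of_real y) has_vector_derivative D1 v s (y *\<^sub>R v) - 1) (at y within {0..h})"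
      by (rule has_vector_derivative_diff)
    then show "((\<lambda>y. U s (y *\<^sub>R v) - of_real y) has_derivative (\<lambda>r. r *\<^sub>R (D1 v s (y *\<^sub>R v) - 1))) (at y within {0..h})"
      by (simp only: has_vector_derivative_def)
    show "onorm (\<lambda>r. r *\<^sub>R (D1 v s (y *\<^sub>R v) - 1)) \<le> 1/2"
    proof (rule onorm_le)
      fix r :: real
      have "\<bar>r\<bar> * norm (D1 v s (y *\<^sub>R v) - 1) \<le> \<bar>r\<bar> * (1/2)" using near[of y] y by (intro mult_left_mono) auto
      then show "norm (r *\<^sub>R (D1 v s (y *\<^sub>R v) - 1)) \<le> 1/2 * norm r" by simp
    qed
  qed (use h in auto)
  then have u: "norm (?u - of_real h) \<le> h / 2" using h odd by simp
  have d: "norm (?d - 1) \<le> 1 / 2" using near[of h] h by simp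
  have uR: "Re ?u \<ge> h / 2" and uI: "\<bar>Im ?u\<bar> \<le> h / 2"
    using abs_Re_le_cmod[of "?u - of_real h"] abs_Im_le_cmod[of "?u - of_real h"] u by auto
  have dR: "Re ?d \<ge> 1 / 2" and dI: "\<bar>Im ?d\<bar> \<le> 1 / 2"
    using abs_Re_le_cmod[of "?d - 1"] abs_Im_le_cmod[of "?d - 1"] d by auto
  have "\<bar>Im ?u * Im ?d\<bar> \<le> (h / 2) * (1 / 2)" unfolding abs_mult using uI dI h by (intro mult_mono) auto
  moreover have "Re ?u * Re ?d \<ge> (h / 2) * (1 / 2)" using uR dR h by (intro mult_mono) auto
  ultimately have i: "?u \<bullet> ?d \<ge> 0" unfolding inner_complex_def by linarith
  have "(h / 2) powr \<alpha> / 2 \<le> norm ?u powr \<alpha> * Re ?d"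
  proof -
    have "h / 2 \<le> norm ?u" using uR complex_Re_le_cmod[of ?u] by linarith
    then have "(h / 2) powr \<alpha> \<le> norm ?u powr \<alpha>" using h \<alpha> by (intro powr_mono2) auto
    then have "(h / 2) powr \<alpha> * (1 / 2) \<le> norm ?u powr \<alpha> * Re ?d" using dR by (intro mult_mono) auto
    then show ?thesis by simp
  qed
  also have "\<dots> \<le> Re (dpnl \<alpha> ?u ?d)" using uR h i by (intro Re_dpnl_ge \<alpha>) auto
  finally show ?thesis using s by (simp add: G_def clip)
qed

text \<open>At each of the times \<open>s\<close> and \<open>t\<close> the increment of
  \<open>D1\<close> between the two points is at most \<open>K * h\<close>, as \<open>D2 v v\<close>
  is bounded by \<open>K\<close>; this is the term \<open>2 * K * h\<close>. The rest must balance
  the integral of \<open>G\<close>, whose real part has a definite sign.\<close>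

lemma increment_lower_bound:
  assumes st: "0 \<le> s" "s \<le> t" "t \<le> T1" and h: "0 < h" and U0: "\<And>\<sigma>. 0 \<le> \<sigma> \<Longrightarrow> \<sigma> \<le> T1 \<Longrightarrow> U \<sigma> 0 = 0"
    and K: "\<And>t x. t \<le> T1 \<Longrightarrow> norm (D2 v v t x) \<le> K"
    and near: "\<And>y \<sigma>. s \<le> \<sigma> \<Longrightarrow> \<sigma> \<le> t \<Longrightarrow> 0 \<le> y \<Longrightarrow> y \<le> h \<Longrightarrow> norm (D1 v \<sigma> (y *\<^sub>R v) - 1) \<le> 1 / 2"
  defines "X \<equiv> \<lambda>\<sigma>. (\<Sum>i\<in>UNIV. D3 (axis i 1) (axis i 1) v \<sigma> (h *\<^sub>R v)) - (\<Sum>i\<in>UNIV. D3 (axis i 1) (axis i 1) v \<sigma> 0)"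
  shows "norm (\<integral>\<sigma>. indicator {s<..<t} \<sigma> *\<^sub>R X \<sigma> \<partial>lborel) \<ge> norm lam * (t - s) * ((h / 2) powr \<alpha> / 2) - 2 * K * h"
proof -
  let ?I = "\<lambda>h. (\<integral>\<sigma>. indicator {s<..<t} \<sigma> *\<^sub>R h \<sigma> \<partial>lborel) :: complex"
  have ci: "integrable lborel (\<lambda>\<sigma>. indicator {s<..<t} \<sigma> *\<^sub>R f \<sigma>)" if "continuous_on UNIV f" for f :: "real \<Rightarrow> complex"
    by (rule Ioo_integrable[OF continuous_on_subset[OF that subset_UNIV]])
  have cX: "continuous_on UNIV X" unfolding X_def by (intro continuous_intros at_point_cont[OF D3_cont])
  have cG: "continuous_on UNIV (\<lambda>\<sigma>. G v \<sigma> x)" for x by (rule at_point_cont[OF G_cont])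
  have c3: "continuous_on UNIV (\<lambda>\<sigma>. (\<Sum>i\<in>UNIV. D3 (axis i 1) (axis i 1) v \<sigma> x) + lam * G v \<sigma> x)" for x
    by (intro continuous_intros at_point_cont[OF D3_cont] cG)
  have "(D1 v t (h *\<^sub>R v) - D1 v s (h *\<^sub>R v)) - (D1 v t 0 - D1 v s 0) =
     (\<integral>\<sigma>. indicator {s<..<t} \<sigma> *\<^sub>R ((\<Sum>i\<in>UNIV. D3 (axis i 1) (axis i 1) v \<sigma> (h *\<^sub>R v)) + lam * G v \<sigma> (h *\<^sub>R v))
       - indicator {s<..<t} \<sigma> *\<^sub>R ((\<Sum>i\<in>UNIV. D3 (axis i 1) (axis i 1) v \<sigma> 0) + lam * G v \<sigma> 0) \<partial>lborel)"
    unfolding D1_increment[OF st] by (rule Bochner_Integration.integral_diff[symmetric, OF ci[OF c3] ci[OF c3]])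
  also have "\<dots> = (\<integral>\<sigma>. indicator {s<..<t} \<sigma> *\<^sub>R X \<sigma> + lam * (indicator {s<..<t} \<sigma> *\<^sub>R G v \<sigma> (h *\<^sub>R v)) \<partial>lborel)"
  proof (rule Bochner_Integration.integral_cong)
    fix \<sigma>
    \<comment> \<open>\<open>dpnl\<close> vanishes at base point 0, so only the point
      \<open>h *\<^sub>R v\<close> contributes through the nonlinearity.\<close>
    have "G v \<sigma> 0 = 0" if "s < \<sigma>" "\<sigma> < t" using U0[of \<sigma>] that st by (simp add: G_def dpnl_def)
    then show "indicator {s<..<t} \<sigma> *\<^sub>R ((\<Sum>i\<in>UNIV. D3 (axis i 1) (axis i 1) v \<sigma> (h *\<^sub>R v)) + lam * G v \<sigma> (h *\<^sub>R v))
       - indicator {s<..<t} \<sigma> *\<^sub>R ((\<Sum>i\<in>UNIV. D3 (axis i 1) (axis i 1) v \<sigma> 0) + lam * G v \<sigma> 0) =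
       indicator {s<..<t} \<sigma> *\<^sub>R X \<sigma> + lam * (indicator {s<..<t} \<sigma> *\<^sub>R G v \<sigma> (h *\<^sub>R v))"
      by (cases "\<sigma> \<in> {s<..<t}") (simp_all add: X_def)
  qed simp
  also have "\<dots> = ?I X + lam * ?I (\<lambda>\<sigma>. G v \<sigma> (h *\<^sub>R v))"
    unfolding integral_mult_right_zero[symmetric]
    by (rule Bochner_Integration.integral_add[OF ci[OF cX] integrable_mult_right[OF ci[OF cG]]])
  finally have eq: "lam * ?I (\<lambda>\<sigma>. G v \<sigma> (h *\<^sub>R v)) =
     (D1 v t (h *\<^sub>R v) - D1 v t 0) - (D1 v s (h *\<^sub>R v) - D1 v s 0) - ?I X" by (simp add: algebra_simps)
  have inc: "norm (D1 v r (h *\<^sub>R v) - D1 v r 0) \<le> K * h" if "r \<le> T1" for r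
    using dir_deriv_bound[OF dir_deriv_D1 K[OF that], of 0 h] h by simp
  have "norm (lam * ?I (\<lambda>\<sigma>. G v \<sigma> (h *\<^sub>R v))) \<le> (K * h + K * h) + norm (?I X)"
    unfolding eq
    by (rule order_trans[OF norm_triangle_ineq4 add_right_mono[OF order_trans[OF norm_triangle_ineq4 add_mono[OF inc inc]]]]) (use st in auto)
  moreover have "norm (lam * ?I (\<lambda>\<sigma>. G v \<sigma> (h *\<^sub>R v))) \<ge> norm lam * ((t - s) * ((h / 2) powr \<alpha> / 2))"
    unfolding norm_mult
  proof (rule mult_left_mono)
    let ?c = "(h / 2) powr \<alpha> / 2"
    have "(t - s) * ?c = (\<integral>\<sigma>. indicator {s<..<t} \<sigma> *\<^sub>R ?c \<partial>lborel)" using st by simp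
    also have "\<dots> \<le> (\<integral>\<sigma>. Re (indicator {s<..<t} \<sigma> *\<^sub>R G v \<sigma> (h *\<^sub>R v)) \<partial>lborel)"
    proof (rule integral_mono)
      show "integrable lborel (\<lambda>\<sigma>. indicator {s<..<t} \<sigma> *\<^sub>R ?c)"
        by (intro integrable_scaleR_left integrable_real_indicator) (use st in auto)
      show "integrable lborel (\<lambda>\<sigma>. Re (indicator {s<..<t} \<sigma> *\<^sub>R G v \<sigma> (h *\<^sub>R v)))"
        by (intro integrable_Re ci cG)
      show "indicator {s<..<t} \<sigma> *\<^sub>R ?c \<le> Re (indicator {s<..<t} \<sigma> *\<^sub>R G v \<sigma> (h *\<^sub>R v))" for \<sigma>
        using G_lower_bound[of \<sigma> h v] U0[of \<sigma>] near[of \<sigma>] st h by (cases "\<sigma> \<in> {s<..<t}") auto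
    qed
    also have "\<dots> = Re (?I (\<lambda>\<sigma>. G v \<sigma> (h *\<^sub>R v)))" by (rule integral_Re[OF ci[OF cG]])
    also have "\<dots> \<le> norm (?I (\<lambda>\<sigma>. G v \<sigma> (h *\<^sub>R v)))" by (rule complex_Re_le_cmod)
    finally show "(t - s) * ?c \<le> norm (?I (\<lambda>\<sigma>. G v \<sigma> (h *\<^sub>R v)))" .
  qed simp
  ultimately show ?thesis by (simp add: mult.assoc)
qed

text \<open>The seminorm is tested on the single pair \<open>h *\<^sub>R axis k 1\<close> and 0, the
  same for all times, so the integral of the supremum dominates the norm of an integral.\<close>

lemma nn_integral_lower_bound:
  fixes k :: 'n
  assumes st: "0 \<le> s" "s \<le> t" "t \<le> T1" and h: "0 < h"
  defines "X \<equiv> \<lambda>\<sigma>. (\<Sum>i\<in>UNIV. D3 (axis i 1) (axis i 1) (axis k 1) \<sigma> (h *\<^sub>R axis k 1)) - (\<Sum>i\<in>UNIV. D3 (axis i 1) (axis i 1) (axis k 1) \<sigma> 0)"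
  shows "ennreal (norm (\<integral>\<sigma>. indicator {s<..<t} \<sigma> *\<^sub>R X \<sigma> \<partial>lborel) / h powr \<beta>)
    \<le> (\<integral>\<^sup>+\<sigma>\<in>{s..t}. holder_seminorm \<beta> (partial k (laplacian (U \<sigma>))) \<partial>lborel)"
proof -
  have cX: "continuous_on UNIV X" unfolding X_def by (intro continuous_intros at_point_cont[OF D3_cont])
  have "integrable lborel (\<lambda>\<sigma>. indicator {s<..<t} \<sigma> *\<^sub>R X \<sigma>)"
    by (rule Ioo_integrable[OF continuous_on_subset[OF cX subset_UNIV]])
  then have i': "integrable lborel (\<lambda>\<sigma>. norm (indicator {s<..<t} \<sigma> *\<^sub>R X \<sigma>) / h powr \<beta>)" by (intro integrable_divide integrable_norm)
  have "norm (\<integral>\<sigma>. indicator {s<..<t} \<sigma> *\<^sub>R X \<sigma> \<partial>lborel) / h powr \<beta> \<le> (\<integral>\<sigma>. norm (indicator {s<..<t} \<sigma> *\<^sub>R X \<sigma>) \<partial>lborel) / h powr \<beta>"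
    by (intro divide_right_mono integral_norm_bound) auto
  also have "\<dots> = (\<integral>\<sigma>. norm (indicator {s<..<t} \<sigma> *\<^sub>R X \<sigma>) / h powr \<beta> \<partial>lborel)" by simp
  finally have "ennreal (norm (\<integral>\<sigma>. indicator {s<..<t} \<sigma> *\<^sub>R X \<sigma> \<partial>lborel) / h powr \<beta>) \<le>
     ennreal (\<integral>\<sigma>. norm (indicator {s<..<t} \<sigma> *\<^sub>R X \<sigma>) / h powr \<beta> \<partial>lborel)" by (rule ennreal_leI)
  also have "\<dots> = (\<integral>\<^sup>+\<sigma>. ennreal (norm (indicator {s<..<t} \<sigma> *\<^sub>R X \<sigma>) / h powr \<beta>) \<partial>lborel)"
    by (rule nn_integral_eq_integral[symmetric, OF i']) auto
  also have "\<dots> \<le> (\<integral>\<^sup>+\<sigma>\<in>{s..t}. holder_seminorm \<beta> (partial k (laplacian (U \<sigma>))) \<partial>lborel)"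
  proof (rule nn_integral_mono)
    fix \<sigma>
    show "ennreal (norm (indicator {s<..<t} \<sigma> *\<^sub>R X \<sigma>) / h powr \<beta>) \<le> holder_seminorm \<beta> (partial k (laplacian (U \<sigma>))) * indicator {s..t} \<sigma>"
    proof (cases "\<sigma> \<in> {s<..<t}")
      case True
      have e: "h *\<^sub>R axis k 1 \<noteq> (0 :: real^'n)" using h by (simp add: axis_eq_0_iff)
      have "ennreal (norm (X \<sigma>) / h powr \<beta>) \<le> holder_seminorm \<beta> (partial k (laplacian (U \<sigma>)))"
        unfolding holder_seminorm_def
        by (rule SUP_upper2[of "(h *\<^sub>R axis k 1, 0)"]) (use h e True st in \<open>auto simp: partial_laplacian_U X_def\<close>)
      then show ?thesis using True by simp
    qed simp
  qed
  finally show ?thesis .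
qed

lemma seminorm_integral_infinite:
  assumes T1': "0 < T1" and lam: "lam \<noteq> 0" and U0: "\<And>\<sigma>. 0 \<le> \<sigma> \<Longrightarrow> \<sigma> \<le> T1 \<Longrightarrow> U \<sigma> 0 = 0" and E1: "E [axis k 1] 0 = 1"
  shows "\<exists>t0. 0 < t0 \<and> t0 \<le> T1 \<and> (\<forall>\<beta> s t. \<alpha> < \<beta> \<and> \<beta> \<le> 1 \<and> 0 \<le> s \<and> s < t \<and> t < t0 \<longrightarrow>
    (\<integral>\<^sup>+\<sigma>\<in>{s..t}. holder_seminorm \<beta> (partial k (laplacian (U \<sigma>))) \<partial>lborel) = \<infinity>)"
proof -
  let ?v = "axis k 1 :: real^'n"
  have D0: "D1 ?v 0 0 = 1" using D1_time_integral[of 0 ?v 0] T1 E1 by simp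
  have "isCont (\<lambda>(t, x). D1 ?v t x) (0, 0)" using D1_cont[of ?v] by (simp add: continuous_on_eq_continuous_at)
  then obtain \<delta> where \<delta>: "\<delta> > 0" "\<And>p. dist p (0, 0) < \<delta> \<Longrightarrow> dist (case p of (t, x) \<Rightarrow> D1 ?v t x) 1 < 1 / 2"
    unfolding continuous_at_eps_delta using D0 by (metis (no_types, lifting) case_prod_conv half_gt_zero zero_less_one)
  \<comment> \<open>The halves make \<open>\<bar>\<sigma>\<bar> + \<bar>y\<bar> < \<delta>\<close>,
    so that \<open>D1\<close> stays within 1/2 of its value 1 at the origin. The cap 1 in
    \<open>h0\<close> gives \<open>h \<le> h powr \<beta>\<close>, the place where \<beta> is at
    most 1.\<close>
  define t0 where "t0 = min T1 (\<delta> / 2)"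
  define h0 where "h0 = min 1 (\<delta> / 2)"
  have near: "norm (D1 ?v \<sigma> (y *\<^sub>R ?v) - 1) \<le> 1 / 2" if "0 \<le> \<sigma>" "\<sigma> < t0" "0 \<le> y" "y < h0" for \<sigma> y
  proof -
    have "dist (\<sigma>, y *\<^sub>R ?v) (0, 0) \<le> \<bar>\<sigma>\<bar> + \<bar>y\<bar>"
      using sqrt_sum_squares_le_sum_abs[of \<sigma> y] by (simp add: dist_norm norm_Pair)
    also have "\<dots> < \<delta>" using that by (simp add: t0_def h0_def)
    finally show ?thesis using \<delta>(2)[of "(\<sigma>, y *\<^sub>R ?v)"] by (simp add: dist_norm)
  qed
  obtain K where K: "\<And>t x. t \<le> T1 \<Longrightarrow> norm (D2 ?v ?v t x) \<le> K" using D2_bounded by blast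
  have K0: "K \<ge> 0" using order_trans[OF norm_ge_zero K[of 0 0]] T1 by simp
  have "(\<integral>\<^sup>+\<sigma>\<in>{s..t}. holder_seminorm \<beta> (partial k (laplacian (U \<sigma>))) \<partial>lborel) = \<infinity>" (is "?J = \<infinity>")
    if b: "\<alpha> < \<beta>" "\<beta> \<le> 1" and st: "0 \<le> s" "s < t" "t < t0" for \<beta> s t
  proof -
    define c where "c = norm lam * (t - s) * ((1 / 2) powr \<alpha> / 2)"
    have c: "c > 0" using lam st by (simp add: c_def)
    have lower: "ennreal (c * h powr (\<alpha> - \<beta>) - 2 * K) \<le> ?J" if h: "0 < h" "h < h0" for h
    proof -
      let ?X = "\<lambda>\<sigma>. (\<Sum>i\<in>UNIV. D3 (axis i 1) (axis i 1) ?v \<sigma> (h *\<^sub>R ?v)) - (\<Sum>i\<in>UNIV. D3 (axis i 1) (axis i 1) ?v \<sigma> 0)"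
      have tT: "t \<le> T1" using st by (simp add: t0_def)
      have "c * h powr \<alpha> - 2 * K * h \<le> norm (\<integral>\<sigma>. indicator {s<..<t} \<sigma> *\<^sub>R ?X \<sigma> \<partial>lborel)"
        using increment_lower_bound[of s t h ?v K, OF st(1) _ tT h(1) U0 K] near st h
        by (auto simp: c_def powr_divide mult_ac)
      then have "(c * h powr \<alpha> - 2 * K * h) / h powr \<beta> \<le> norm (\<integral>\<sigma>. indicator {s<..<t} \<sigma> *\<^sub>R ?X \<sigma> \<partial>lborel) / h powr \<beta>"
        by (rule divide_right_mono) simp
      moreover have "c * h powr (\<alpha> - \<beta>) - 2 * K \<le> (c * h powr \<alpha> - 2 * K * h) / h powr \<beta>"
      proof -
        have "h powr 1 \<le> h powr \<beta>" using h b by (intro powr_mono') (auto simp: h0_def)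
        then have "h / h powr \<beta> \<le> 1" using h by simp
        then have "2 * K * (h / h powr \<beta>) \<le> 2 * K * 1" using K0 by (intro mult_left_mono) auto
        then show ?thesis by (simp add: powr_diff diff_divide_distrib)
      qed
      ultimately have "ennreal (c * h powr (\<alpha> - \<beta>) - 2 * K) \<le> ennreal (norm (\<integral>\<sigma>. indicator {s<..<t} \<sigma> *\<^sub>R ?X \<sigma> \<partial>lborel) / h powr \<beta>)"
        by (intro ennreal_leI) linarith
      also have "\<dots> \<le> ?J" using nn_integral_lower_bound[of s t h k \<beta>] st tT h by simp
      finally show ?thesis .
    qed
    show ?thesis
    proof (cases ?J)
      case (real r)
      \<comment> \<open>If the integral had a finite value \<open>r\<close>, then
        \<open>c * Q - 2 * K = r + 1\<close> would exceed it. As \<alpha> - \<beta> is negative,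
        every small enough \<open>h\<close> satisfies
        \<open>h powr (\<alpha> - \<beta>) \<ge> Q\<close>.\<close>
      define Q where "Q = (r + 1 + 2 * K) / c"
      have Q: "Q > 0" using real K0 c by (simp add: Q_def)
      define h where "h = min (h0 / 2) (Q powr (1 / (\<alpha> - \<beta>)))"
      have "0 < h0" using \<delta> by (simp add: h0_def)
      then have h: "0 < h" "h < h0" "h \<le> Q powr (1 / (\<alpha> - \<beta>))" using Q by (auto simp: h_def)
      have "Q = (Q powr (1 / (\<alpha> - \<beta>))) powr (\<alpha> - \<beta>)" using Q b by (simp add: powr_powr)
      also have "\<dots> \<le> h powr (\<alpha> - \<beta>)" using h b by (intro powr_mono2') auto
      finally have "c * Q \<le> c * h powr (\<alpha> - \<beta>)" using c by (intro mult_left_mono) auto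
      then have "r + 1 \<le> c * h powr (\<alpha> - \<beta>) - 2 * K" using c by (simp add: Q_def)
      then have "ennreal (r + 1) \<le> ?J" using lower[OF h(1,2)] by (meson ennreal_leI order_trans)
      then show ?thesis using real by simp
    qed simp
  qed
  moreover have "0 < t0" "t0 \<le> T1" using T1' \<delta> by (auto simp: t0_def)
  ultimately show ?thesis by blast
qed

end

section \<open>Existence and uniqueness of mild solutions\<close>

instance bcontfun :: (metric_space, banach) banach ..

lemma apply_bcontfun_simps:
  "apply_bcontfun (f - g) x = apply_bcontfun f x - apply_bcontfun g x"
  "apply_bcontfun (f + g) x = apply_bcontfun f x + apply_bcontfun g x"
  "apply_bcontfun (r *\<^sub>R f) x = r *\<^sub>R apply_bcontfun f x"
  "apply_bcontfun (- f) x = - apply_bcontfun f x"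
  "apply_bcontfun 0 x = 0"
  by (simp_all add: minus_bcontfun.rep_eq plus_bcontfun.rep_eq scaleR_bcontfun.rep_eq uminus_bcontfun.rep_eq zero_bcontfun.rep_eq)

lemma bounded_linear_apply_bcontfun: "bounded_linear (\<lambda>f :: ('a::metric_space) \<Rightarrow>\<^sub>C ('b::real_normed_vector). apply_bcontfun f x)"
  by (rule bounded_linear_intro[where K = 1]) (auto simp: apply_bcontfun_simps norm_bounded)

section \<open>The heat semigroup on \<open>C0\<close>\<close>

lemma heat_diff_le:
  fixes f g :: "(real^'n) \<Rightarrow>\<^sub>C complex"
  assumes "t \<ge> 0"
  shows "norm (heat t f - heat t g) \<le> norm (f - g)"
proof (rule norm_bound)
  fix x
  obtain C where C: "weight C (kern :: real^'n \<Rightarrow> real)" using weight_kern by blast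
  note i = gconv_integrable[OF C continuous_on_apply_bcontfun norm_bounded]
  have "apply_bcontfun (heat t f - heat t g) x = gconv kern (apply_bcontfun (f - g)) t x"
    unfolding apply_bcontfun_simps(1) heat_eq_gconv[OF assms] gconv_def scaleR_diff_right
    by (rule Bochner_Integration.integral_diff[symmetric, OF i i])
  also have "norm \<dots> \<le> norm (f - g) * (\<integral>w. \<bar>kern (w :: real^'n)\<bar> \<partial>lborel)"
    by (rule gconv_bound[OF C continuous_on_apply_bcontfun norm_bounded])
  also have "(\<integral>w. \<bar>kern (w :: real^'n)\<bar> \<partial>lborel) = 1"
  proof -
    have "\<bar>kern w\<bar> = kern w" for w :: "real^'n" using kern_pos[of w] by simp
    then show ?thesis by (simp add: integral_kern)
  qed
  finally show "norm (apply_bcontfun (heat t f - heat t g) x) \<le> norm (f - g)" by simp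
qed

lemma heat_zero: "t \<ge> 0 \<Longrightarrow> heat t (0 :: (real^'n) \<Rightarrow>\<^sub>C complex) = 0"
  by (intro bcontfun_eqI) (simp add: heat_eq_gconv gconv_def apply_bcontfun_simps)

lemma norm_heat_le: "t \<ge> 0 \<Longrightarrow> norm (heat t f) \<le> norm (f :: (real^'n) \<Rightarrow>\<^sub>C complex)"
  using heat_diff_le[of t f 0] by (simp add: heat_zero)

lemma C0_small:
  fixes f :: "(real^'n) \<Rightarrow>\<^sub>C complex"
  assumes "f \<in> C0" "e > 0"
  obtains R where "\<And>x :: real^'n. norm x \<ge> R \<Longrightarrow> norm (apply_bcontfun f x) < e"
  using assms unfolding C0_def tendsto_iff eventually_at_infinity by auto

lemma C0_uniformly_continuous:
  fixes f :: "(real^'n) \<Rightarrow>\<^sub>C complex"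
  assumes "f \<in> C0" "e > 0"
  obtains d where "d > 0" "\<And>x y :: real^'n. norm (x - y) < d \<Longrightarrow> norm (apply_bcontfun f x - apply_bcontfun f y) < e"
proof -
  obtain R where R: "\<And>x. norm x \<ge> R \<Longrightarrow> norm (apply_bcontfun f x) < e / 2"
    using C0_small[OF assms(1), of "e/2"] assms(2) by auto
  \<comment> \<open>The margin 1, together with \<open>d \<le> 1\<close> below, ensures that two
    close points lie either both in this ball or both where \<open>f\<close> is small.\<close>
  have "uniformly_continuous_on (cball 0 (R + 1)) (apply_bcontfun f)"
    by (intro compact_uniformly_continuous) auto
  then obtain d where d: "d > 0" "\<And>x y. x \<in> cball 0 (R + 1) \<Longrightarrow> y \<in> cball 0 (R + 1) \<Longrightarrow> dist y x < d \<Longrightarrow> dist (apply_bcontfun f y) (apply_bcontfun f x) < e"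
    unfolding uniformly_continuous_on_def using assms(2) by metis
  show ?thesis
  proof (rule that[of "min d 1"])
    fix x y :: "real^'n" assume xy: "norm (x - y) < min d 1"
    show "norm (apply_bcontfun f x - apply_bcontfun f y) < e"
    proof (cases "norm x \<le> R + 1 \<and> norm y \<le> R + 1")
      case True
      then show ?thesis using d(2)[of y x] xy by (simp add: dist_norm)
    next
      case False
      have "\<bar>norm x - norm y\<bar> < 1" using norm_triangle_ineq3[of x y] xy by linarith
      then have "norm x \<ge> R" "norm y \<ge> R" using False by auto
      then show ?thesis
        using R[of x] R[of y] norm_triangle_ineq4[of "apply_bcontfun f x" "apply_bcontfun f y"] by linarith
    qed
  qed (use d in auto)
qed

text \<open>Chebyshev's inequality for the Gaussian: the modulus of continuity of \<open>f\<close> is at most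
  \<open>e + K r\<close> at distance \<open>r\<close>.\<close>

lemma heat_time_modulus:
  fixes f :: "(real^'n) \<Rightarrow>\<^sub>C complex"
  assumes f: "f \<in> C0" and "e > 0"
  obtains K where "\<And>t t'. 0 \<le> t \<Longrightarrow> 0 \<le> t' \<Longrightarrow> norm (heat t f - heat t' f) \<le> e + K * \<bar>sqrt t - sqrt t'\<bar>"
proof -
  obtain C where C: "weight C (kern :: real^'n \<Rightarrow> real)" using weight_kern by blast
  obtain d where d: "d > 0" "\<And>x y :: real^'n. norm (x - y) < d \<Longrightarrow> norm (apply_bcontfun f x - apply_bcontfun f y) < e"
    using C0_uniformly_continuous[OF assms] by blast
  let ?A = "2 * norm f / d"
  let ?m = "\<integral>w. \<bar>kern (w :: real^'n)\<bar> * norm w \<partial>lborel"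
  have mod: "norm (apply_bcontfun f x - apply_bcontfun f y) \<le> e + ?A * norm (x - y)" for x y
  proof (cases "norm (x - y) < d")
    case True
    have "0 \<le> ?A * norm (x - y)" using d by simp
    then show ?thesis using d(2)[OF True] by linarith
  next
    case False
    have "norm (apply_bcontfun f x - apply_bcontfun f y) \<le> 2 * norm f"
      using norm_triangle_ineq4[of "apply_bcontfun f x" "apply_bcontfun f y"] norm_bounded[of f x] norm_bounded[of f y] by linarith
    also have "\<dots> = ?A * d" using d by simp
    also have "\<dots> \<le> ?A * norm (x - y)" using False d by (intro mult_left_mono) auto
    finally show ?thesis using \<open>e > 0\<close> by simp
  qed
  note i = gconv_integrable[OF C continuous_on_apply_bcontfun norm_bounded]
  show ?thesis
  proof (rule that[of "?A * ?m"], rule norm_bound)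
    fix t t' :: real and x assume t: "0 \<le> t" "0 \<le> t'"
    let ?r = "\<bar>sqrt t - sqrt t'\<bar>"
    have b: "norm (kern w *\<^sub>R (apply_bcontfun f (x - sqrt t *\<^sub>R w) - apply_bcontfun f (x - sqrt t' *\<^sub>R w)))
        \<le> e * kern w + ?A * ?r * (\<bar>kern w\<bar> * norm w)" for w
    proof -
      have "norm (x - sqrt t *\<^sub>R w - (x - sqrt t' *\<^sub>R w)) = ?r * norm w"
        by (simp flip: scaleR_diff_left add: abs_minus_commute)
      then have "kern w * norm (apply_bcontfun f (x - sqrt t *\<^sub>R w) - apply_bcontfun f (x - sqrt t' *\<^sub>R w)) \<le> kern w * (e + ?A * (?r * norm w))"
        using mod[of "x - sqrt t *\<^sub>R w" "x - sqrt t' *\<^sub>R w"] kern_pos[of w] by (intro mult_left_mono) auto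
      then show ?thesis using kern_pos[of w] unfolding norm_scaleR by (simp add: distrib_left mult_ac)
    qed
    have ik: "integrable lborel (kern :: real^'n \<Rightarrow> real)" by (rule integrable_kern)
    have "apply_bcontfun (heat t f - heat t' f) x = (\<integral>w. kern w *\<^sub>R (apply_bcontfun f (x - sqrt t *\<^sub>R w) - apply_bcontfun f (x - sqrt t' *\<^sub>R w)) \<partial>lborel)"
      unfolding apply_bcontfun_simps(1) heat_eq_gconv[OF t(1)] heat_eq_gconv[OF t(2)] gconv_def scaleR_diff_right
      by (rule Bochner_Integration.integral_diff[symmetric, OF i i])
    also have "norm \<dots> \<le> (\<integral>w. e * kern w + ?A * ?r * (\<bar>kern w\<bar> * norm w) \<partial>(lborel :: (real^'n) measure))"
    proof (rule Bochner_Integration.integral_norm_bound_integral[OF _ _ b])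
      show "integrable lborel (\<lambda>w. kern w *\<^sub>R (apply_bcontfun f (x - sqrt t *\<^sub>R w) - apply_bcontfun f (x - sqrt t' *\<^sub>R w)))"
        unfolding scaleR_diff_right by (rule Bochner_Integration.integrable_diff[OF i i])
      show "integrable lborel (\<lambda>w::real^'n. e * kern w + ?A * ?r * (\<bar>kern w\<bar> * norm w))"
        by (intro Bochner_Integration.integrable_add integrable_mult_right ik weight_integrable(3)[OF C])
    qed
    also have "\<dots> = e * (\<integral>w. kern w \<partial>(lborel :: (real^'n) measure)) + ?A * ?r * ?m"
      by (subst Bochner_Integration.integral_add[OF integrable_mult_right[OF ik] integrable_mult_right[OF weight_integrable(3)[OF C]]])
         (simp only: integral_mult_right_zero)
    also have "\<dots> = e + ?A * ?m * ?r" by (simp add: integral_kern mult_ac)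
    finally show "norm (apply_bcontfun (heat t f - heat t' f) x) \<le> e + ?A * ?m * ?r" .
  qed
qed

text \<open>Contractivity of the semigroup replaces \<open>g x\<close> by its limit at a cost
  independent of time; \<open>heat_time_modulus\<close> then treats the fixed function
  \<open>f\<close>.\<close>

lemma heat_tendsto:
  fixes g :: "'s \<Rightarrow> ((real^'n) \<Rightarrow>\<^sub>C complex)"
  assumes g: "(g \<longlongrightarrow> f) F" and s: "(s \<longlongrightarrow> t) F" and f: "f \<in> C0" and pos: "\<And>x. s x \<ge> 0" "t \<ge> 0"
  shows "((\<lambda>x. heat (s x) (g x)) \<longlongrightarrow> heat t f) F"
proof (rule tendstoI)
  fix e :: real assume e: "e > 0"
  obtain K where K: "\<And>t t'. 0 \<le> t \<Longrightarrow> 0 \<le> t' \<Longrightarrow> norm (heat t f - heat t' f) \<le> e / 4 + K * \<bar>sqrt t - sqrt t'\<bar>"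
    using heat_time_modulus[OF f, of "e/4"] e by auto
  have "((\<lambda>x. norm (g x - f) + (e / 4 + K * \<bar>sqrt (s x) - sqrt t\<bar>)) \<longlongrightarrow> norm (f - f) + (e / 4 + K * \<bar>sqrt t - sqrt t\<bar>)) F"
    by (intro tendsto_intros g s)
  then have "eventually (\<lambda>x. norm (g x - f) + (e / 4 + K * \<bar>sqrt (s x) - sqrt t\<bar>) < e) F"
    by (rule order_tendstoD) (use e in simp)
  then show "eventually (\<lambda>x. dist (heat (s x) (g x)) (heat t f) < e) F"
  proof eventually_elim
    case (elim x)
    have "norm (heat (s x) (g x) - heat t f) \<le> norm (heat (s x) (g x) - heat (s x) f) + norm (heat (s x) f - heat t f)"
      using norm_triangle_ineq[of "heat (s x) (g x) - heat (s x) f" "heat (s x) f - heat t f"] by simp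
    then show ?case using heat_diff_le[OF pos(1), of x "g x" f] K[OF pos, of x] elim unfolding dist_norm by linarith
  qed
qed

lemma heat_continuous_on:
  fixes g :: "'s::topological_space \<Rightarrow> ((real^'n) \<Rightarrow>\<^sub>C complex)"
  assumes "continuous_on A g" "continuous_on A s" "\<And>x. x \<in> A \<Longrightarrow> g x \<in> C0" "\<And>x. s x \<ge> 0"
  shows "continuous_on A (\<lambda>x. heat (s x) (g x))"
  using assms unfolding continuous_on_def by (auto intro!: heat_tendsto)

section \<open>Invariance of odd functions vanishing at infinity\<close>

definition oddC0 :: "((real^'n) \<Rightarrow>\<^sub>C complex) set" where
  "oddC0 = {f \<in> C0. \<forall>x. apply_bcontfun f (- x) = - apply_bcontfun f x}"

lemma subspace_C0: "subspace C0"
  unfolding subspace_def C0_def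
  by (auto simp: apply_bcontfun_simps[abs_def] intro!: tendsto_add_zero tendsto_eq_intros)

lemma subspace_oddC0: "subspace oddC0"
  using subspace_C0 unfolding subspace_def oddC0_def by (auto simp: apply_bcontfun_simps)

lemma closed_C0: "closed (C0 :: ((real^'n) \<Rightarrow>\<^sub>C complex) set)"
  unfolding closed_sequential_limits
proof (intro allI impI, elim conjE)
  fix X :: "nat \<Rightarrow> ((real^'n) \<Rightarrow>\<^sub>C complex)" and f
  assume X: "\<forall>n. X n \<in> C0" "X \<longlonglongrightarrow> f"
  show "f \<in> C0"
    unfolding C0_def mem_Collect_eq tendsto_iff
  proof (intro allI impI)
    fix e :: real assume "e > 0"
    then obtain n where n: "dist (X n) f < e / 2"
      using X(2) by (metis half_gt_zero le_refl lim_sequentially)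
    from \<open>e > 0\<close> have "eventually (\<lambda>x. dist (apply_bcontfun (X n) x) 0 < e / 2) at_infinity"
      using X(1) unfolding C0_def by (auto dest!: tendstoD[where e = "e/2"])
    then show "eventually (\<lambda>x. dist (apply_bcontfun f x) 0 < e) at_infinity"
    proof eventually_elim
      case (elim x)
      then show ?case using dist_fun_lt_imp_dist_val_lt[OF n, of x] dist_triangle2[of "apply_bcontfun f x" 0 "apply_bcontfun (X n) x"]
        by (simp add: dist_commute)
    qed
  qed
qed

lemma closed_oddC0: "closed (oddC0 :: ((real^'n) \<Rightarrow>\<^sub>C complex) set)"
proof -
  have e: "oddC0 = C0 \<inter> (\<Inter>x. {f :: (real^'n) \<Rightarrow>\<^sub>C complex. apply_bcontfun f (- x) = - apply_bcontfun f x})"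
    by (auto simp: oddC0_def)
  have c: "closed {f :: (real^'n) \<Rightarrow>\<^sub>C complex. apply_bcontfun f (- x) = - apply_bcontfun f x}" for x
    by (intro closed_Collect_eq continuous_intros linear_continuous_on bounded_linear_apply_bcontfun)
  show ?thesis unfolding e by (intro closed_Int closed_C0 closed_INT ballI c)
qed

text \<open>Riemann sums lie in the subspace and approximate the integral.\<close>

lemma integral_in_closed_subspace:
  fixes f :: "real \<Rightarrow> 'a::banach"
  assumes S: "subspace S" "closed S" and f: "f integrable_on {a..b}" "\<And>x. x \<in> {a..b} \<Longrightarrow> f x \<in> S"
  shows "integral {a..b} f \<in> S"
proof -
  have "integral {a..b} f \<in> closure S"
    unfolding closure_approachable
  proof (intro allI impI)
    fix e :: real assume "e > 0"
    then obtain g where g: "gauge g" "\<And>D. D tagged_division_of {a..b} \<Longrightarrow> g fine D \<Longrightarrow>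
        norm (sum (\<lambda>(x,k). measure lborel k *\<^sub>R f x) D - integral {a..b} f) < e"
      using integrable_integral[OF f(1)] unfolding has_integral_real by metis
    obtain p where p: "p tagged_division_of {a..b}" "g fine p" using fine_division_exists_real[OF g(1)] .
    have "(\<Sum>(x,k)\<in>p. measure lborel k *\<^sub>R f x) \<in> S"
    proof (rule subspace_sum[OF S(1)])
      fix q assume "q \<in> p"
      then obtain x k where q: "q = (x, k)" "(x, k) \<in> p" by (cases q) auto
      have "x \<in> {a..b}" using tagged_division_ofD(2,3)[OF p(1) q(2)] by auto
      then show "(case q of (x, k) \<Rightarrow> measure lborel k *\<^sub>R f x) \<in> S" using q f(2) S(1) by (auto intro: subspace_scale)
    qed
    then show "\<exists>y\<in>S. dist y (integral {a..b} f) < e" using g(2)[OF p] by (auto simp: dist_norm)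
  qed
  then show ?thesis using S(2) by simp
qed

lemma heat_C0:
  fixes f :: "(real^'n) \<Rightarrow>\<^sub>C complex"
  assumes f: "f \<in> C0" and t: "t \<ge> 0"
  shows "heat t f \<in> C0"
  unfolding C0_def mem_Collect_eq tendsto_iff
proof (intro allI impI)
  fix e :: real assume e: "e > 0"
  obtain C where C: "weight C (kern :: real^'n \<Rightarrow> real)" using weight_kern by blast
  obtain R where R: "\<And>x. norm x \<ge> R \<Longrightarrow> norm (apply_bcontfun f x) < e / 2"
    using C0_small[OF f, of "e/2"] e by auto
  let ?m = "\<integral>w. \<bar>kern (w :: real^'n)\<bar> * norm w \<partial>lborel"
  have m: "?m \<ge> 0" by simp
  define Q where "Q = norm f * sqrt t * ?m"
  have Q: "Q \<ge> 0" using m t by (simp add: Q_def)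
  have "norm (apply_bcontfun (heat t f) x) < e" if x: "norm x \<ge> R + 1 + 2 * Q / e" for x
  proof -
    let ?D = "norm x - R"
    have D: "?D \<ge> 1 + 2 * Q / e" using x by simp
    moreover have "2 * Q / e \<ge> 0" using Q e by simp
    ultimately have D0: "?D > 0" by linarith
    \<comment> \<open>Chebyshev's argument: either the shifted point lies where \<open>f\<close> is
      below \<open>e / 2\<close>, or \<open>sqrt t * norm w / ?D\<close> is at least 1 and may
      multiply the sup bound. The threshold for \<open>norm x\<close> makes the resulting
      \<open>Q / ?D\<close> less than \<open>e / 2\<close>.\<close>
    have b: "norm (kern w *\<^sub>R apply_bcontfun f (x - sqrt t *\<^sub>R w)) \<le> (e / 2) * kern w + (norm f * sqrt t / ?D) * (\<bar>kern w\<bar> * norm w)" for w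
    proof -
      have "norm (apply_bcontfun f (x - sqrt t *\<^sub>R w)) \<le> e / 2 + norm f * sqrt t / ?D * norm w"
      proof (cases "norm (x - sqrt t *\<^sub>R w) \<ge> R")
        case True
        have "0 \<le> norm f * sqrt t / ?D * norm w" using D0 t by simp
        then show ?thesis using R[OF True] by linarith
      next
        case False
        have "norm x - sqrt t * norm w \<le> norm (x - sqrt t *\<^sub>R w)"
          using norm_triangle_ineq2[of x "sqrt t *\<^sub>R w"] t by simp
        then have "?D \<le> sqrt t * norm w" using False by linarith
        then have "norm f * 1 \<le> norm f * (sqrt t * norm w / ?D)" using D0 by (intro mult_left_mono) auto
        then show ?thesis using norm_bounded[of f "x - sqrt t *\<^sub>R w"] e by simp
      qed
      then have "kern w * norm (apply_bcontfun f (x - sqrt t *\<^sub>R w)) \<le> kern w * (e / 2 + norm f * sqrt t / ?D * norm w)"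
        using kern_pos[of w] by (intro mult_left_mono) auto
      then show ?thesis using kern_pos[of w] by (simp add: algebra_simps)
    qed
    have ik: "integrable lborel (kern :: real^'n \<Rightarrow> real)" by (rule integrable_kern)
    have "norm (apply_bcontfun (heat t f) x) \<le> (\<integral>w. (e / 2) * kern w + (norm f * sqrt t / ?D) * (\<bar>kern w\<bar> * norm w) \<partial>(lborel :: (real^'n) measure))"
      unfolding heat_eq_gconv[OF t] gconv_def
      by (rule Bochner_Integration.integral_norm_bound_integral[OF gconv_integrable[OF C continuous_on_apply_bcontfun norm_bounded] _ b])
         (intro Bochner_Integration.integrable_add integrable_mult_right ik weight_integrable(3)[OF C])
    also have "\<dots> = (e / 2) * (\<integral>w. kern w \<partial>(lborel :: (real^'n) measure)) + (norm f * sqrt t / ?D) * ?m"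
      by (subst Bochner_Integration.integral_add[OF integrable_mult_right[OF ik] integrable_mult_right[OF weight_integrable(3)[OF C]]])
         (simp only: integral_mult_right_zero)
    also have "\<dots> = e / 2 + Q / ?D" by (simp add: integral_kern Q_def)
    also have "Q / ?D < e / 2"
    proof -
      have "e * ?D \<ge> e * (1 + 2 * Q / e)" using D e by (intro mult_left_mono) auto
      also have "e * (1 + 2 * Q / e) = e + 2 * Q" using e by (simp add: field_simps)
      finally have "2 * Q < e * ?D" using e by linarith
      then show ?thesis using D0 by (simp add: field_simps)
    qed
    finally show ?thesis by simp
  qed
  then show "eventually (\<lambda>x. dist (apply_bcontfun (heat t f) x) 0 < e) at_infinity"
    unfolding eventually_at_infinity by auto
qed

lemma heat_oddC0:
  fixes f :: "(real^'n) \<Rightarrow>\<^sub>C complex"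
  assumes f: "f \<in> oddC0" and t: "t \<ge> 0"
  shows "heat t f \<in> oddC0"
proof -
  have odd: "apply_bcontfun f (- x) = - apply_bcontfun f x" for x using f by (simp add: oddC0_def)
  have e: "(lborel :: (real^'n) measure) = distr lborel borel (\<lambda>w. - w)"
    using lborel_affine[of "-1" "0 :: real^'n"] by (simp add: density_1)
  have [measurable]: "kern \<in> borel_measurable (borel :: (real^'n) measure)" "apply_bcontfun f \<in> borel_measurable borel"
    by (auto intro!: borel_measurable_continuous_onI continuous_kern)
  have "apply_bcontfun (heat t f) (- x) = - apply_bcontfun (heat t f) x" for x
  proof -
    have "gconv kern (apply_bcontfun f) t (- x) = (\<integral>w. kern (- w) *\<^sub>R apply_bcontfun f (- x - sqrt t *\<^sub>R (- w)) \<partial>lborel)"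
      unfolding gconv_def by (subst e, subst integral_distr) auto
    also have "\<dots> = (\<integral>w. - (kern w *\<^sub>R apply_bcontfun f (x - sqrt t *\<^sub>R w)) \<partial>lborel)"
    proof (rule Bochner_Integration.integral_cong)
      fix w :: "real^'n"
      have "- x - sqrt t *\<^sub>R (- w) = - (x - sqrt t *\<^sub>R w)" by simp
      then show "kern (- w) *\<^sub>R apply_bcontfun f (- x - sqrt t *\<^sub>R (- w)) = - (kern w *\<^sub>R apply_bcontfun f (x - sqrt t *\<^sub>R w))"
        by (simp only: odd) (simp add: kern_eq)
    qed simp
    finally show ?thesis unfolding heat_eq_gconv[OF t] by (simp add: gconv_def)
  qed
  then show ?thesis using heat_C0[OF _ t, of f] f by (simp add: oddC0_def)
qed

section \<open>The nonlinearity on bounded continuous functions\<close>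

lemma nonlin_eq_pnl: "0 < \<alpha> \<Longrightarrow> apply_bcontfun (nonlin \<alpha> f) x = pnl \<alpha> (apply_bcontfun f x)"
  by (simp add: apply_nonlin pnl_def)

lemma nonlin_lipschitz:
  assumes a: "0 < \<alpha>" "\<alpha> < 1" and R: "norm f \<le> R" "norm g \<le> R"
  shows "norm (nonlin \<alpha> f - nonlin \<alpha> g) \<le> 2 * R powr \<alpha> * norm (f - g)"
proof (rule norm_bound)
  fix x
  have "norm (apply_bcontfun (nonlin \<alpha> f - nonlin \<alpha> g) x) \<le> 2 * R powr \<alpha> * norm (apply_bcontfun f x - apply_bcontfun g x)"
    unfolding apply_bcontfun_simps(1) nonlin_eq_pnl[OF a(1)]
    by (rule pnl_lipschitz[OF a order_trans[OF norm_bounded R(1)] order_trans[OF norm_bounded R(2)]])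
  also have "\<dots> \<le> 2 * R powr \<alpha> * norm (f - g)"
    using norm_bounded[of "f - g" x] by (intro mult_left_mono) (auto simp: apply_bcontfun_simps)
  finally show "norm (apply_bcontfun (nonlin \<alpha> f - nonlin \<alpha> g) x) \<le> 2 * R powr \<alpha> * norm (f - g)" .
qed

lemma nonlin_continuous_on:
  assumes a: "0 < \<alpha>" "\<alpha> < 1" and f: "continuous_on A f"
  shows "continuous_on A (\<lambda>t. nonlin \<alpha> (f t))"
  unfolding continuous_on_def
proof
  fix t assume "t \<in> A"
  then have l: "(f \<longlongrightarrow> f t) (at t within A)" using f by (simp add: continuous_on_def)
  let ?R = "norm (f t) + 1"
  have "eventually (\<lambda>x. norm (f x) < ?R) (at t within A)"
    using tendsto_norm[OF l] by (rule order_tendstoD) simp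
  then have ev: "eventually (\<lambda>x. norm (nonlin \<alpha> (f x) - nonlin \<alpha> (f t)) \<le> 2 * ?R powr \<alpha> * norm (f x - f t)) (at t within A)"
    by eventually_elim (intro nonlin_lipschitz a; simp)
  have "((\<lambda>x. 2 * ?R powr \<alpha> * norm (f x - f t)) \<longlongrightarrow> 2 * ?R powr \<alpha> * norm (f t - f t)) (at t within A)"
    by (intro tendsto_intros l)
  then have "((\<lambda>x. 2 * ?R powr \<alpha> * norm (f x - f t)) \<longlongrightarrow> 0) (at t within A)" by simp
  with ev have "((\<lambda>x. nonlin \<alpha> (f x) - nonlin \<alpha> (f t)) \<longlongrightarrow> 0) (at t within A)"
    by (rule Lim_null_comparison)
  then show "((\<lambda>x. nonlin \<alpha> (f x)) \<longlongrightarrow> nonlin \<alpha> (f t)) (at t within A)" by (simp add: LIM_zero_iff)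
qed

lemma nonlin_C0:
  assumes a: "0 < \<alpha>" and "f \<in> C0" shows "nonlin \<alpha> f \<in> C0"
proof -
  have "(apply_bcontfun f \<longlongrightarrow> 0) at_infinity" using assms by (simp add: C0_def)
  then have "((\<lambda>x. pnl \<alpha> (apply_bcontfun f x)) \<longlongrightarrow> pnl \<alpha> 0) at_infinity"
    by (rule isCont_tendsto_compose[OF has_derivative_continuous[OF pnl_has_derivative[OF a]]])
  moreover have "apply_bcontfun (nonlin \<alpha> f) = (\<lambda>x. pnl \<alpha> (apply_bcontfun f x))"
    using a by (simp add: fun_eq_iff nonlin_eq_pnl)
  ultimately show ?thesis by (simp add: C0_def pnl_def)
qed

lemma nonlin_oddC0: "0 < \<alpha> \<Longrightarrow> f \<in> oddC0 \<Longrightarrow> nonlin \<alpha> f \<in> oddC0"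
  by (auto simp: oddC0_def nonlin_C0 nonlin_eq_pnl pnl_def)

lemma bounded_linear_cscale: "bounded_linear (cscale c :: ((real^'n) \<Rightarrow>\<^sub>C complex) \<Rightarrow> _)"
proof (rule bounded_linear_intro[where K = "norm c"])
  show "norm (cscale c f) \<le> norm f * norm c" for f :: "(real^'n) \<Rightarrow>\<^sub>C complex"
    by (rule norm_bound) (simp add: apply_cscale norm_mult mult.commute[of "norm c"] mult_right_mono norm_bounded)
qed (auto intro!: bcontfun_eqI simp: apply_cscale apply_bcontfun_simps algebra_simps)

lemma norm_cscale_le: "norm (cscale c f) \<le> norm c * norm (f :: (real^'n) \<Rightarrow>\<^sub>C complex)"
  by (rule norm_bound) (simp add: apply_cscale norm_mult mult_left_mono norm_bounded)

lemma cscale_oddC0: "f \<in> oddC0 \<Longrightarrow> cscale c f \<in> oddC0"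
  by (auto simp: oddC0_def C0_def apply_cscale[abs_def] intro: tendsto_mult_right_zero)

text \<open>At a maximum point \<open>s0\<close> of \<open>exp (- 2 * L * s) * \<phi> s\<close>, the
  integral inequality gives \<open>\<phi> s0 \<le> \<phi> s0 / 2\<close>. Hence the maximum is zero,
  and so is \<phi>.\<close>

lemma gronwall_zero:
  fixes \<phi> :: "real \<Rightarrow> real"
  assumes c: "continuous_on {0..T} \<phi>" and T: "0 \<le> T" and pos: "\<And>s. s \<in> {0..T} \<Longrightarrow> 0 \<le> \<phi> s"
    and le: "\<And>s. s \<in> {0..T} \<Longrightarrow> \<phi> s \<le> L * integral {0..s} \<phi>" and L: "L > 0" and s: "s \<in> {0..T}"
  shows "\<phi> s = 0"
proof -
  have "continuous_on {0..T} (\<lambda>s. exp (- 2 * L * s) * \<phi> s)" by (intro continuous_intros c)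
  then obtain s0 where s0: "s0 \<in> {0..T}" "\<And>s. s \<in> {0..T} \<Longrightarrow> exp (- 2 * L * s) * \<phi> s \<le> exp (- 2 * L * s0) * \<phi> s0"
    using continuous_attains_sup[of "{0..T}" "\<lambda>s. exp (- 2 * L * s) * \<phi> s"] T by (auto simp del: mult_minus_left)
  have ee: "exp (2 * L * r) * (exp (- 2 * L * r) * x) = x" for r x
    by (simp flip: mult.assoc exp_add)
  define m where "m = exp (- 2 * L * s0) * \<phi> s0"
  have m: "m \<ge> 0" using pos[OF s0(1)] by (simp add: m_def)
  have b: "\<phi> s \<le> m * exp (2 * L * s)" if "s \<in> {0..T}" for s
  proof -
    have "exp (2 * L * s) * (exp (- 2 * L * s) * \<phi> s) \<le> exp (2 * L * s) * m"
      using s0(2)[OF that] by (intro mult_left_mono) (auto simp: m_def)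
    then show ?thesis unfolding ee by (simp only: mult.commute)
  qed
  have i: "((\<lambda>s. m * exp (2 * L * s)) has_integral (m * exp (2 * L * s0) / (2 * L) - m * exp (2 * L * 0) / (2 * L))) {0..s0}"
    using s0(1) L by (intro fundamental_theorem_of_calculus)
      (auto intro!: derivative_eq_intros simp: has_real_derivative_iff_has_vector_derivative[symmetric])
  have "\<phi> s0 \<le> L * integral {0..s0} \<phi>" by (rule le[OF s0(1)])
  also have "\<dots> \<le> L * (m * exp (2 * L * s0) / (2 * L) - m * exp (2 * L * 0) / (2 * L))"
  proof (intro mult_left_mono)
    have "integral {0..s0} \<phi> \<le> integral {0..s0} (\<lambda>s. m * exp (2 * L * s))"
    proof (rule integral_le)
      show "\<phi> integrable_on {0..s0}"
        using s0(1) by (intro integrable_continuous_real continuous_on_subset[OF c]) auto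
      show "(\<lambda>s. m * exp (2 * L * s)) integrable_on {0..s0}" using i by blast
    qed (use s0(1) b in auto)
    then show "integral {0..s0} \<phi> \<le> m * exp (2 * L * s0) / (2 * L) - m * exp (2 * L * 0) / (2 * L)"
      using integral_unique[OF i] by simp
  qed (use L in simp)
  also have "\<dots> \<le> m * exp (2 * L * s0) / 2" using L m by (simp add: field_simps)
  also have "m * exp (2 * L * s0) = \<phi> s0"
    unfolding m_def mult.commute[of _ "exp (2 * L * s0)"] ee ..
  finally have "\<phi> s0 \<le> 0" by simp
  then have "m \<le> 0" by (simp add: m_def mult_nonneg_nonpos)
  then show ?thesis using b[OF s] pos[OF s] m by (simp add: antisym)
qed

lemma duhamel_integrand_cont:
  fixes u :: "real \<Rightarrow> ((real^'n) \<Rightarrow>\<^sub>C complex)"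
  assumes a: "0 < \<alpha>" "\<alpha> < 1" and u: "continuous_on {0..t} u" "\<And>s. s \<in> {0..t} \<Longrightarrow> u s \<in> C0"
  shows "continuous_on {0..t} (\<lambda>\<sigma>. heat (t - \<sigma>) (nonlin \<alpha> (u \<sigma>)))"
proof -
  \<comment> \<open>\<open>heat_continuous_on\<close> asks for a time function that is nonnegative
    everywhere; on \<open>{0..t}\<close> the maximum changes nothing.\<close>
  have "continuous_on {0..t} (\<lambda>\<sigma>. heat (max 0 (t - \<sigma>)) (nonlin \<alpha> (u \<sigma>)))"
    by (intro heat_continuous_on nonlin_continuous_on a u(1) nonlin_C0 u(2) continuous_intros) auto
  then show ?thesis by (rule continuous_on_eq) auto
qed

text \<open>The heat flow is a contraction and the nonlinearity is Lipschitz on the ball of radius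
  \<open>R\<close>. Both uniqueness and the fixed point argument rest on this estimate.\<close>

lemma duhamel_diff_le:
  fixes u v :: "real \<Rightarrow> ((real^'n) \<Rightarrow>\<^sub>C complex)"
  assumes a: "0 < \<alpha>" "\<alpha> < 1" and t: "0 \<le> t"
    and u: "continuous_on {0..t} u" "\<And>s. s \<in> {0..t} \<Longrightarrow> u s \<in> C0" "\<And>s. s \<in> {0..t} \<Longrightarrow> norm (u s) \<le> R"
    and v: "continuous_on {0..t} v" "\<And>s. s \<in> {0..t} \<Longrightarrow> v s \<in> C0" "\<And>s. s \<in> {0..t} \<Longrightarrow> norm (v s) \<le> R"
  shows "norm (cscale lam (integral {0..t} (\<lambda>\<sigma>. heat (t - \<sigma>) (nonlin \<alpha> (u \<sigma>))))
      - cscale lam (integral {0..t} (\<lambda>\<sigma>. heat (t - \<sigma>) (nonlin \<alpha> (v \<sigma>)))))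
    \<le> norm lam * (2 * R powr \<alpha>) * integral {0..t} (\<lambda>\<sigma>. norm (u \<sigma> - v \<sigma>))"
proof -
  let ?hu = "\<lambda>\<sigma>. heat (t - \<sigma>) (nonlin \<alpha> (u \<sigma>))" and ?hv = "\<lambda>\<sigma>. heat (t - \<sigma>) (nonlin \<alpha> (v \<sigma>))"
  have iu: "?hu integrable_on {0..t}" by (rule integrable_continuous_real[OF duhamel_integrand_cont[OF a u(1,2)]])
  have iv: "?hv integrable_on {0..t}" by (rule integrable_continuous_real[OF duhamel_integrand_cont[OF a v(1,2)]])
  have "cscale lam (integral {0..t} ?hu) - cscale lam (integral {0..t} ?hv) = cscale lam (integral {0..t} (\<lambda>\<sigma>. ?hu \<sigma> - ?hv \<sigma>))"
    by (simp add: Henstock_Kurzweil_Integration.integral_diff[OF iu iv] linear_diff[OF bounded_linear.linear[OF bounded_linear_cscale]])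
  also have "norm \<dots> \<le> norm lam * norm (integral {0..t} (\<lambda>\<sigma>. ?hu \<sigma> - ?hv \<sigma>))" by (rule norm_cscale_le)
  also have "norm (integral {0..t} (\<lambda>\<sigma>. ?hu \<sigma> - ?hv \<sigma>)) \<le> integral {0..t} (\<lambda>\<sigma>. 2 * R powr \<alpha> * norm (u \<sigma> - v \<sigma>))"
  proof (rule Henstock_Kurzweil_Integration.integral_norm_bound_integral)
    show "(\<lambda>\<sigma>. ?hu \<sigma> - ?hv \<sigma>) integrable_on {0..t}" by (rule integrable_diff[OF iu iv])
    show "(\<lambda>\<sigma>. 2 * R powr \<alpha> * norm (u \<sigma> - v \<sigma>)) integrable_on {0..t}"
      by (intro integrable_continuous_real continuous_intros u(1) v(1))
    fix \<sigma> assume s: "\<sigma> \<in> {0..t}"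
    have "norm (?hu \<sigma> - ?hv \<sigma>) \<le> norm (nonlin \<alpha> (u \<sigma>) - nonlin \<alpha> (v \<sigma>))" using s by (intro heat_diff_le) auto
    also have "\<dots> \<le> 2 * R powr \<alpha> * norm (u \<sigma> - v \<sigma>)" by (rule nonlin_lipschitz[OF a u(3)[OF s] v(3)[OF s]])
    finally show "norm (?hu \<sigma> - ?hv \<sigma>) \<le> 2 * R powr \<alpha> * norm (u \<sigma> - v \<sigma>)" .
  qed
  finally show ?thesis by (simp add: mult_left_mono mult.assoc)
qed

lemma mild_solutionD:
  assumes "mild_solution lam \<alpha> u0 T u" "0 \<le> t" "ereal t < T"
  shows "continuous_on {0..t} u" "\<And>s. s \<in> {0..t} \<Longrightarrow> u s \<in> C0"
    "\<And>s. s \<in> {0..t} \<Longrightarrow> u s = heat s u0 + cscale lam (integral {0..s} (\<lambda>\<sigma>. heat (s - \<sigma>) (nonlin \<alpha> (u \<sigma>))))"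
proof -
  have le: "ereal s < T" if "s \<le> t" for s using le_less_trans[OF _ assms(3), of "ereal s"] that by simp
  show "continuous_on {0..t} u"
    using assms le unfolding mild_solution_def by (auto elim!: continuous_on_subset)
  show "u s \<in> C0" "u s = heat s u0 + cscale lam (integral {0..s} (\<lambda>\<sigma>. heat (s - \<sigma>) (nonlin \<alpha> (u \<sigma>))))" if "s \<in> {0..t}" for s
    using assms le that unfolding mild_solution_def by auto
qed

lemma mild_solution_unique:
  fixes u0 :: "(real^'n) \<Rightarrow>\<^sub>C complex"
  assumes a: "0 < \<alpha>" "\<alpha> < 1" and u: "mild_solution lam \<alpha> u0 T u" and v: "mild_solution lam \<alpha> u0 T' v"
    and t: "0 \<le> t" "ereal t < T" "ereal t < T'"
  shows "u t = v t"
proof -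
  note U = mild_solutionD[OF u t(1,2)] and V = mild_solutionD[OF v t(1,3)]
  have "bounded (u ` {0..t})" "bounded (v ` {0..t})"
    by (auto intro!: compact_imp_bounded compact_continuous_image U(1) V(1))
  then obtain Ru Rv where Ru: "\<And>s. s \<in> {0..t} \<Longrightarrow> norm (u s) \<le> Ru" and Rv: "\<And>s. s \<in> {0..t} \<Longrightarrow> norm (v s) \<le> Rv"
    unfolding bounded_iff by blast
  define R where "R = max Ru Rv"
  have R: "norm (u s) \<le> R" "norm (v s) \<le> R" if "s \<in> {0..t}" for s
    using Ru[OF that] Rv[OF that] by (auto simp: R_def)
  \<comment> \<open>The added 1 keeps the constant positive when \<open>lam\<close> or
    \<open>R\<close> is zero.\<close>
  let ?L = "norm lam * (2 * R powr \<alpha>) + 1"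
  have "norm (u t - v t) = 0"
  proof (rule gronwall_zero[where \<phi> = "\<lambda>s. norm (u s - v s)" and T = t and L = ?L])
    show "continuous_on {0..t} (\<lambda>s. norm (u s - v s))" by (intro continuous_intros U(1) V(1))
    fix s assume s: "s \<in> {0..t}"
    have sub: "r \<in> {0..t}" if "r \<in> {0..s}" for r using that s by auto
    have cu: "continuous_on {0..s} u" and cv: "continuous_on {0..s} v"
      using U(1) V(1) s by (auto elim!: continuous_on_subset)
    have "u s - v s = cscale lam (integral {0..s} (\<lambda>\<sigma>. heat (s - \<sigma>) (nonlin \<alpha> (u \<sigma>))))
      - cscale lam (integral {0..s} (\<lambda>\<sigma>. heat (s - \<sigma>) (nonlin \<alpha> (v \<sigma>))))"
      by (subst U(3)[OF s], subst V(3)[OF s]) simp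
    also have "norm \<dots> \<le> norm lam * (2 * R powr \<alpha>) * integral {0..s} (\<lambda>\<sigma>. norm (u \<sigma> - v \<sigma>))"
      by (rule duhamel_diff_le[OF a _ cu _ _ cv]) (use s sub U(2) V(2) R in auto)
    also have "\<dots> \<le> ?L * integral {0..s} (\<lambda>\<sigma>. norm (u \<sigma> - v \<sigma>))"
      by (intro mult_right_mono integral_nonneg integrable_continuous_real continuous_intros cu cv) auto
    finally show "norm (u s - v s) \<le> ?L * integral {0..s} (\<lambda>\<sigma>. norm (u \<sigma> - v \<sigma>))" .
  qed (use t in \<open>auto intro!: add_nonneg_pos\<close>)
  then show ?thesis by simp
qed

lemma integral_unit_interval:
  fixes f :: "real \<Rightarrow> 'a::banach"
  assumes "t \<ge> 0" "f integrable_on {0..t}"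
  shows "integral {0..t} f = t *\<^sub>R integral {0..1} (\<lambda>\<theta>. f (t * \<theta>))"
proof (cases "t = 0")
  case False
  then have t: "t > 0" using assms by simp
  have im: "(\<lambda>x. x / t) ` {0..t} = {0..1}"
  proof -
    have "x \<in> (\<lambda>x. x / t) ` {0..t}" if "x \<in> {0..1}" for x
      using that t by (intro image_eqI[of _ _ "x * t"]) (auto simp: mult_left_le_one_le)
    then show ?thesis using t by (auto simp: divide_le_eq)
  qed
  have "((\<lambda>\<theta>. f (t * \<theta>)) has_integral (1 / \<bar>t\<bar>) *\<^sub>R integral {0..t} f) {0..1}"
    using has_integral_stretch_real[OF integrable_integral[OF assms(2)] False] unfolding im .
  from integral_unique[OF this] show ?thesis using t by simp
qed simp

text \<open>The upper limit and the integrand both depend on \<open>t\<close>. Rescaling to the unit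
  interval moves all of the dependence into the integrand, where continuity in a parameter
  applies.\<close>

lemma duhamel_cont:
  fixes v :: "real \<Rightarrow> ((real^'n) \<Rightarrow>\<^sub>C complex)"
  assumes a: "0 < \<alpha>" "\<alpha> < 1" and v: "continuous_on UNIV v" "\<And>s. v s \<in> C0"
  shows "continuous_on {0..} (\<lambda>t. integral {0..t} (\<lambda>\<sigma>. heat (t - \<sigma>) (nonlin \<alpha> (v \<sigma>))))"
proof -
  let ?g = "\<lambda>t \<theta>. heat (max 0 (t - t * \<theta>)) (nonlin \<alpha> (v (t * \<theta>)))"
  have "continuous_on ({0..} \<times> cbox 0 1) (\<lambda>p. heat (max 0 (fst p - fst p * snd p)) (nonlin \<alpha> (v (fst p * snd p))))"
    by (intro heat_continuous_on nonlin_continuous_on[OF a] continuous_on_compose2[OF v(1)] nonlin_C0 a v(2) continuous_intros) auto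
  then have "continuous_on {0..} (\<lambda>t. t *\<^sub>R integral (cbox 0 1) (?g t))"
    by (intro continuous_intros integral_continuous_on_param) (simp add: case_prod_beta)
  then show ?thesis
  proof (rule continuous_on_eq)
    fix t :: real assume t: "t \<in> {0..}"
    have c: "continuous_on {0..t} v" using v(1) by (rule continuous_on_subset) simp
    have "integral {0..t} (\<lambda>\<sigma>. heat (t - \<sigma>) (nonlin \<alpha> (v \<sigma>))) = t *\<^sub>R integral {0..1} (\<lambda>\<theta>. heat (t - t * \<theta>) (nonlin \<alpha> (v (t * \<theta>))))"
      using t by (intro integral_unit_interval integrable_continuous_real duhamel_integrand_cont[OF a c v(2)]) auto
    also have "integral {0..1} (\<lambda>\<theta>. heat (t - t * \<theta>) (nonlin \<alpha> (v (t * \<theta>)))) = integral {0..1} (?g t)"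
    proof (rule Henstock_Kurzweil_Integration.integral_cong)
      fix \<theta> :: real assume "\<theta> \<in> {0..1}"
      then have "t * \<theta> \<le> t" using t by (simp add: mult_left_le)
      then show "heat (t - t * \<theta>) (nonlin \<alpha> (v (t * \<theta>))) = ?g t \<theta>" by (simp add: max_def)
    qed
    finally show "t *\<^sub>R integral (cbox 0 1) (?g t) = integral {0..t} (\<lambda>\<sigma>. heat (t - \<sigma>) (nonlin \<alpha> (v \<sigma>)))" by simp
  qed
qed

text \<open>Banach's fixed point theorem in the ball of radius \<open>R\<close> among odd-valued
  curves. Time is clipped to \<open>[0, \<tau>]\<close> so that these curves are bounded continuous
  functions on the whole line, a complete space.\<close>

lemma local_existence:
  fixes u0 :: "(real^'n) \<Rightarrow>\<^sub>C complex"
  assumes a: "0 < \<alpha>" "\<alpha> < 1" and u0: "u0 \<in> oddC0"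
  shows "\<exists>\<tau>>0. \<exists>u. mild_solution lam \<alpha> u0 (ereal \<tau>) u \<and> (\<forall>t. u t \<in> oddC0)"
proof -
  define R where "R = norm u0 + 1"
  \<comment> \<open>With \<open>\<tau> = 1 / q\<close> one gets
    \<open>norm lam * R powr \<alpha> * R * \<tau> \<le> 1 / 4\<close>. The Duhamel term then stays
    below 1, the slack in \<open>R\<close>, and the contraction factor
    \<open>2 * norm lam * R powr \<alpha> * \<tau>\<close> is at most 1/2 because
    \<open>R \<ge> 1\<close>.\<close>
  define q where "q = 4 * (norm lam + 1) * (R powr \<alpha> * R)"
  define \<tau> where "\<tau> = 1 / q"
  have R: "R \<ge> 1" by (simp add: R_def)
  have Ra: "R powr \<alpha> \<ge> 1" using R a by (intro ge_one_powr_ge_zero) auto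
  have q: "q > 0" using R Ra by (auto simp: q_def intro!: mult_pos_pos add_nonneg_pos)
  have \<tau>: "\<tau> > 0" using q by (simp add: \<tau>_def)
  have lt: "norm lam * (R powr \<alpha> * R) * \<tau> \<le> 1 / 4"
  proof -
    have "4 * (norm lam * (R powr \<alpha> * R)) \<le> q" using R Ra by (auto simp: q_def intro!: mult_right_mono)
    then show ?thesis using q by (simp add: \<tau>_def field_simps)
  qed
  have lt': "norm lam * R powr \<alpha> * \<tau> \<le> 1 / 4"
  proof -
    have "norm lam * R powr \<alpha> * 1 \<le> norm lam * R powr \<alpha> * R" using R by (intro mult_left_mono) auto
    then have "norm lam * R powr \<alpha> * \<tau> \<le> norm lam * R powr \<alpha> * R * \<tau>" using \<tau> by (intro mult_right_mono) auto
    then show ?thesis using lt by (simp add: mult.assoc)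
  qed
  let ?c = "\<lambda>t. max 0 (min t \<tau>)"
  let ?W = "\<lambda>(v :: real \<Rightarrow> (real^'n) \<Rightarrow>\<^sub>C complex) t. integral {0..t} (\<lambda>\<sigma>. heat (t - \<sigma>) (nonlin \<alpha> (v \<sigma>)))"
  let ?P = "\<lambda>(v :: real \<Rightarrow> (real^'n) \<Rightarrow>\<^sub>C complex) t. heat (?c t) u0 + cscale lam (?W v (?c t))"
  define Z where "Z = {v :: real \<Rightarrow>\<^sub>C (real^'n) \<Rightarrow>\<^sub>C complex. \<forall>t. apply_bcontfun v t \<in> oddC0 \<inter> cball 0 R}"
  define \<Phi> where "\<Phi> v = Bcontfun (?P (apply_bcontfun v))" for v :: "real \<Rightarrow>\<^sub>C (real^'n) \<Rightarrow>\<^sub>C complex"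
  have C0s: "oddC0 \<subseteq> C0" by (auto simp: oddC0_def)
  have ct: "0 \<le> ?c t" "?c t \<le> \<tau>" for t using \<tau> by auto
  have vZ: "apply_bcontfun v t \<in> C0" "apply_bcontfun v t \<in> oddC0" "norm (apply_bcontfun v t) \<le> R" if "v \<in> Z" for v t
    using that C0s by (auto simp: Z_def)
  have vc: "continuous_on A (apply_bcontfun v)" for A and v :: "real \<Rightarrow>\<^sub>C (real^'n) \<Rightarrow>\<^sub>C complex" by simp
  have pb: "norm (?P (apply_bcontfun v) t) \<le> R" if v: "v \<in> Z" for v t
  proof -
    have "norm (cscale lam (?W (apply_bcontfun v) (?c t))) \<le> norm lam * norm (?W (apply_bcontfun v) (?c t))" by (rule norm_cscale_le)
    also have "norm (?W (apply_bcontfun v) (?c t)) \<le> R powr \<alpha> * R * (?c t - 0)"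
    proof (rule integral_bound[OF ct(1)])
      show "continuous_on {0..?c t} (\<lambda>\<sigma>. heat (?c t - \<sigma>) (nonlin \<alpha> (apply_bcontfun v \<sigma>)))"
        by (rule duhamel_integrand_cont[OF a vc vZ(1)[OF v]])
      fix \<sigma> assume s: "\<sigma> \<in> {0..?c t}"
      have "norm (heat (?c t - \<sigma>) (nonlin \<alpha> (apply_bcontfun v \<sigma>))) \<le> norm (nonlin \<alpha> (apply_bcontfun v \<sigma>))"
        using s by (intro norm_heat_le) auto
      also have "\<dots> \<le> R powr \<alpha> * R"
      proof (rule norm_bound)
        fix x
        have "norm (apply_bcontfun (apply_bcontfun v \<sigma>) x) \<le> R" using vZ(3)[OF v, of \<sigma>] norm_bounded order_trans by blast
        then show "norm (apply_bcontfun (nonlin \<alpha> (apply_bcontfun v \<sigma>)) x) \<le> R powr \<alpha> * R"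
          using a by (auto simp: apply_nonlin intro!: mult_mono powr_mono2)
      qed
      finally show "norm (heat (?c t - \<sigma>) (nonlin \<alpha> (apply_bcontfun v \<sigma>))) \<le> R powr \<alpha> * R" .
    qed
    also have "norm lam * (R powr \<alpha> * R * (?c t - 0)) \<le> norm lam * (R powr \<alpha> * R * \<tau>)"
      using ct R by (intro mult_left_mono) auto
    also have "\<dots> \<le> 1" using lt by (simp add: mult.assoc)
    finally have "norm (cscale lam (?W (apply_bcontfun v) (?c t))) \<le> 1" by (simp add: mult_left_mono)
    moreover have "norm (heat (?c t) u0) \<le> norm u0" by (rule norm_heat_le[OF ct(1)])
    ultimately show ?thesis unfolding R_def
      using norm_triangle_ineq[of "heat (?c t) u0" "cscale lam (?W (apply_bcontfun v) (?c t))"] by linarith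
  qed
  have app: "apply_bcontfun (\<Phi> v) = ?P (apply_bcontfun v)" if v: "v \<in> Z" for v
  proof -
    have "continuous_on UNIV (\<lambda>t. ?W (apply_bcontfun v) (?c t))"
      by (rule continuous_on_compose2[OF duhamel_cont[OF a vc vZ(1)[OF v]]]) (auto intro!: continuous_intros)
    then have "continuous_on UNIV (\<lambda>t. cscale lam (?W (apply_bcontfun v) (?c t)))"
      by (rule bounded_linear.continuous_on[OF bounded_linear_cscale])
    moreover have "continuous_on UNIV (\<lambda>t. heat (?c t) u0)"
      by (intro heat_continuous_on continuous_intros) (use u0 C0s ct in auto)
    ultimately have "continuous_on UNIV (?P (apply_bcontfun v))" by (intro continuous_on_add)
    then have "?P (apply_bcontfun v) \<in> bcontfun" by (rule bcontfun_normI) (rule pb[OF v])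
    then show ?thesis unfolding \<Phi>_def by (rule Bcontfun_inverse)
  qed
  have "\<exists>!v. v \<in> Z \<and> \<Phi> v = v"
  proof (rule Banach_fix[where c = "1/2"])
    have "Z = PiC UNIV (\<lambda>_. oddC0 \<inter> cball 0 R)" unfolding Z_def by (auto simp: mem_PiC_iff Pi_iff)
    moreover have "closed (PiC UNIV (\<lambda>_::real. oddC0 \<inter> cball 0 R :: ((real^'n) \<Rightarrow>\<^sub>C complex) set))"
      by (intro closed_PiC closed_Int closed_oddC0 closed_cball)
    ultimately show "complete Z" by (simp add: complete_eq_closed)
    have "0 \<in> Z" using R subspace_0[OF subspace_oddC0] by (auto simp: Z_def apply_bcontfun_simps)
    then show "Z \<noteq> {}" by blast
    show "\<Phi> ` Z \<subseteq> Z"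
    proof
      fix w assume "w \<in> \<Phi> ` Z"
      then obtain v where v: "v \<in> Z" "w = \<Phi> v" by blast
      have "?W (apply_bcontfun v) (?c t) \<in> oddC0" for t
      proof (rule integral_in_closed_subspace[OF subspace_oddC0 closed_oddC0])
        show "(\<lambda>\<sigma>. heat (?c t - \<sigma>) (nonlin \<alpha> (apply_bcontfun v \<sigma>))) integrable_on {0..?c t}"
          by (rule integrable_continuous_real[OF duhamel_integrand_cont[OF a vc vZ(1)[OF v(1)]]])
        show "heat (?c t - \<sigma>) (nonlin \<alpha> (apply_bcontfun v \<sigma>)) \<in> oddC0" if "\<sigma> \<in> {0..?c t}" for \<sigma>
          using that by (intro heat_oddC0 nonlin_oddC0 a vZ(2)[OF v(1)]) auto
      qed
      then have "?P (apply_bcontfun v) t \<in> oddC0" for t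
        by (intro subspace_add[OF subspace_oddC0] cscale_oddC0 heat_oddC0[OF u0 ct(1)])
      then show "w \<in> Z" using pb[OF v(1)] by (simp add: Z_def v(2) app[OF v(1)])
    qed
    fix v w assume v: "v \<in> Z" and w: "w \<in> Z"
    show "dist (\<Phi> v) (\<Phi> w) \<le> 1/2 * dist v w"
    proof (rule dist_bound)
      fix t
      have "dist (apply_bcontfun (\<Phi> v) t) (apply_bcontfun (\<Phi> w) t) = norm (cscale lam (?W (apply_bcontfun v) (?c t)) - cscale lam (?W (apply_bcontfun w) (?c t)))"
        unfolding app[OF v] app[OF w] dist_norm by simp
      also have "\<dots> \<le> norm lam * (2 * R powr \<alpha>) * integral {0..?c t} (\<lambda>\<sigma>. norm (apply_bcontfun v \<sigma> - apply_bcontfun w \<sigma>))"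
        by (rule duhamel_diff_le[OF a ct(1) vc vZ(1)[OF v] vZ(3)[OF v] vc vZ(1)[OF w] vZ(3)[OF w]])
      also have "\<dots> \<le> norm lam * (2 * R powr \<alpha>) * (dist v w * \<tau>)"
      proof (rule mult_left_mono)
        have "norm (integral {0..?c t} (\<lambda>\<sigma>. norm (apply_bcontfun v \<sigma> - apply_bcontfun w \<sigma>))) \<le> dist v w * (?c t - 0)"
        proof (rule integral_bound[OF ct(1)])
          show "continuous_on {0..?c t} (\<lambda>\<sigma>. norm (apply_bcontfun v \<sigma> - apply_bcontfun w \<sigma>))" by (intro continuous_intros vc)
          show "norm (norm (apply_bcontfun v \<sigma> - apply_bcontfun w \<sigma>)) \<le> dist v w" for \<sigma>
            using dist_bounded[of v \<sigma> w] by (simp add: dist_norm)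
        qed
        also have "\<dots> \<le> dist v w * \<tau>" using ct by (intro mult_left_mono) auto
        finally show "integral {0..?c t} (\<lambda>\<sigma>. norm (apply_bcontfun v \<sigma> - apply_bcontfun w \<sigma>)) \<le> dist v w * \<tau>" by simp
      qed simp
      also have "\<dots> = 2 * (norm lam * R powr \<alpha> * \<tau>) * dist v w" by simp
      also have "\<dots> \<le> 2 * (1 / 4) * dist v w" using lt' by (intro mult_right_mono mult_left_mono) auto
      finally show "dist (apply_bcontfun (\<Phi> v) t) (apply_bcontfun (\<Phi> w) t) \<le> 1/2 * dist v w" by simp
    qed
  qed auto
  then obtain v where v: "v \<in> Z" "\<Phi> v = v" by blast
  have "mild_solution lam \<alpha> u0 (ereal \<tau>) (apply_bcontfun v)"
    unfolding mild_solution_def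
  proof (intro conjI allI impI)
    fix t assume t: "0 \<le> t \<and> ereal t < ereal \<tau>"
    then have "?c t = t" by simp
    then show "apply_bcontfun v t = heat t u0 + cscale lam (?W (apply_bcontfun v) t)"
      using fun_cong[OF app[OF v(1)], of t] unfolding v(2) by simp
  qed (use \<tau> vc vZ(1)[OF v(1)] in auto)
  then show ?thesis using \<tau> vZ(2)[OF v(1)] by blast
qed

text \<open>By uniqueness any two solutions agree where both exist, so they glue to one solution up
  to the supremum of all existence times.\<close>

lemma maximal_solution_exists:
  fixes u0 :: "(real^'n) \<Rightarrow>\<^sub>C complex"
  assumes a: "0 < \<alpha>" "\<alpha> < 1" and ex: "mild_solution lam \<alpha> u0 T0 w"
  shows "\<exists>T u. maximal_solution lam \<alpha> u0 T u"
proof -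
  define S where "S = {T. \<exists>v. mild_solution lam \<alpha> u0 T v}"
  define T where "T = Sup S"
  \<comment> \<open>The chosen solution may vary with \<open>t\<close>, but its value at
    \<open>t\<close> does not depend on the choice.\<close>
  define V where "V = (\<lambda>t. SOME v. \<exists>T'. mild_solution lam \<alpha> u0 T' v \<and> ereal t < T')"
  define u where "u t = V t t" for t
  have ueq: "u t = v t" if "mild_solution lam \<alpha> u0 T' v" "0 \<le> t" "ereal t < T'" for T' v t
  proof -
    have "\<exists>v T'. mild_solution lam \<alpha> u0 T' v \<and> ereal t < T'" using that by blast
    from someI_ex[OF this] have "\<exists>T'. mild_solution lam \<alpha> u0 T' (V t) \<and> ereal t < T'" unfolding V_def .
    then show ?thesis unfolding u_def using mild_solution_unique[OF a _ that(1,2)] that by blast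
  qed
  have "mild_solution lam \<alpha> u0 T u"
    unfolding mild_solution_def
  proof (intro conjI allI impI)
    have "T0 \<le> T" unfolding T_def S_def using ex by (intro Sup_upper) blast
    then show "0 < T" using ex unfolding mild_solution_def by auto
    have loc: "\<exists>T' v. mild_solution lam \<alpha> u0 T' v \<and> ereal t < T'" if "ereal t < T" for t
      using that unfolding T_def less_Sup_iff S_def by blast
    show "continuous_on {t. 0 \<le> t \<and> ereal t < T} u"
      unfolding continuous_on_def
    proof
      fix t assume t: "t \<in> {t. 0 \<le> t \<and> ereal t < T}"
      then obtain T' v where v: "mild_solution lam \<alpha> u0 T' v" "ereal t < T'" using loc by blast
      then obtain r where r: "t < r" "ereal r < T'" using ereal_dense2[OF v(2)] by auto
      have "continuous_on {0..r} v" using mild_solutionD(1)[OF v(1) _ r(2)] t r by simp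
      then have "(v \<longlongrightarrow> v t) (at t within {0..r})" using t r by (simp add: continuous_on_def)
      then have "(u \<longlongrightarrow> v t) (at t within {0..r})"
      proof (rule Lim_transform_within[OF _ zero_less_one])
        fix s assume "s \<in> {0..r}"
        then have "ereal s < T'" "0 \<le> s" using le_less_trans[OF _ r(2), of "ereal s"] by auto
        then show "v s = u s" using ueq[OF v(1)] by simp
      qed
      moreover have "u t = v t" using ueq[OF v(1)] t v(2) by simp
      \<comment> \<open>Near \<open>t\<close> the domain of \<open>u\<close> and
        \<open>{0..r}\<close> coincide, including the one-sided case \<open>t = 0\<close>.\<close>
      moreover have "at t within {t. 0 \<le> t \<and> ereal t < T} = at t within {0..r}"
      proof (rule at_within_nhd[of t "{..<r}"])
        have "ereal r < T" using r(2) v(1) unfolding T_def S_def less_Sup_iff by blast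
        then have "ereal s < T" if "s < r" for s using le_less_trans[of "ereal s" "ereal r" T] that by simp
        then show "{t. 0 \<le> t \<and> ereal t < T} \<inter> {..<r} - {t} = {0..r} \<inter> {..<r} - {t}" by auto
      qed (use r in auto)
      ultimately show "(u \<longlongrightarrow> u t) (at t within {t. 0 \<le> t \<and> ereal t < T})" by simp
    qed
    fix t assume t: "0 \<le> t \<and> ereal t < T"
    then obtain T' v where v: "mild_solution lam \<alpha> u0 T' v" "ereal t < T'" using loc by blast
    note D = mild_solutionD[OF v(1) _ v(2)]
    have e: "u s = v s" if "s \<in> {0..t}" for s
      using ueq[OF v(1), of s] that le_less_trans[OF _ v(2), of "ereal s"] by simp
    show "u t \<in> C0" using D(2)[of t] e[of t] t by auto
    have "integral {0..t} (\<lambda>\<sigma>. heat (t - \<sigma>) (nonlin \<alpha> (u \<sigma>))) = integral {0..t} (\<lambda>\<sigma>. heat (t - \<sigma>) (nonlin \<alpha> (v \<sigma>)))"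
      by (rule Henstock_Kurzweil_Integration.integral_cong) (simp add: e)
    then show "u t = heat t u0 + cscale lam (integral {0..t} (\<lambda>\<sigma>. heat (t - \<sigma>) (nonlin \<alpha> (u \<sigma>))))"
      using D(3)[of t] e[of t] t by auto
  qed
  moreover have "T' \<le> T" if "mild_solution lam \<alpha> u0 T' v" for T' v
    unfolding T_def S_def using that by (intro Sup_upper) blast
  moreover have "v t = u t" if "mild_solution lam \<alpha> u0 T' v" "0 \<le> t" "ereal t < T'" for T' v t
    using ueq[OF that] by simp
  ultimately show ?thesis unfolding maximal_solution_def by blast
qed

section \<open>The initial value\<close>

text \<open>\<open>bump 0\<close> is the classical flat function \<open>exp (- 1 / s)\<close>. The
  powers of \<open>inverse s\<close> make the family closed under differentiation up to linear
  combinations.\<close>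

definition bump :: "nat \<Rightarrow> real \<Rightarrow> real" where
  "bump n s = (if s > 0 then inverse s ^ n * exp (- inverse s) else 0)"

lemma bump_tendsto_0: "(bump n \<longlongrightarrow> 0) (at 0)"
proof (rule filterlim_split_at)
  show "(bump n \<longlongrightarrow> 0) (at_left 0)"
    by (rule tendsto_eventually) (auto simp: eventually_at_filter bump_def)
  have "((\<lambda>s. inverse s ^ n / exp (inverse s)) \<longlongrightarrow> 0) (at_right (0::real))"
    by (rule filterlim_compose[OF tendsto_power_div_exp_0 filterlim_inverse_at_top_right])
  then show "(bump n \<longlongrightarrow> 0) (at_right 0)"
    by (rule Lim_transform_eventually) (auto simp: eventually_at_filter bump_def exp_minus divide_inverse)
qed

lemma bump_deriv: "(bump n has_real_derivative (bump (n + 2) s - real n * bump (n + 1) s)) (at s)"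
proof (cases s "0 :: real" rule: linorder_cases)
  case less
  have "(bump n has_real_derivative 0) (at s)"
    by (rule has_field_derivative_transform_within_open[OF DERIV_const, where S = "{..<0}"])
       (use less in \<open>auto simp: bump_def\<close>)
  then show ?thesis using less by (simp add: bump_def)
next
  case equal
  \<comment> \<open>The difference quotient of \<open>bump n\<close> at 0 is
    \<open>bump (n + 1)\<close>.\<close>
  have "((\<lambda>y. (bump n y - bump n 0) / (y - 0)) \<longlongrightarrow> 0) (at 0)"
    by (rule Lim_transform_eventually[OF bump_tendsto_0[of "n + 1"]])
       (auto simp: eventually_at_filter bump_def divide_inverse)
  then show ?thesis using equal by (simp add: has_field_derivative_iff bump_def)
next
  case greater
  have "((\<lambda>s. inverse s ^ n * exp (- inverse s)) has_real_derivative
      (inverse s ^ (n + 2) * exp (- inverse s) - real n * (inverse s ^ (n + 1) * exp (- inverse s)))) (at s)"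
  proof -
    have i: "(inverse has_real_derivative - (inverse s * inverse s)) (at s)"
      using DERIV_inverse[of s] greater by simp
    have e: "((\<lambda>s. exp (- inverse s)) has_real_derivative exp (- inverse s) * (inverse s * inverse s)) (at s)"
      by (rule DERIV_cong[OF DERIV_fun_exp[OF DERIV_minus[OF i]]]) simp
    show ?thesis
      by (rule DERIV_cong[OF DERIV_mult[OF DERIV_power[OF i, of n] e]]) (cases n; simp add: algebra_simps)
  qed
  then have "(bump n has_real_derivative
      (inverse s ^ (n + 2) * exp (- inverse s) - real n * (inverse s ^ (n + 1) * exp (- inverse s)))) (at s)"
    by (rule has_field_derivative_transform_within_open[where S = "{0<..}"]) (use greater in \<open>auto simp: bump_def\<close>)
  then show ?thesis using greater by (simp add: bump_def)
qed

text \<open>A class of functions that contains the initial value and is closed under differentiation.\<close>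

inductive smooth :: "(real^'n \<Rightarrow> real) \<Rightarrow> bool" where
  smooth_const: "smooth (\<lambda>_. c)"
| smooth_inner: "smooth (\<lambda>x. x \<bullet> v)"
| smooth_bump: "smooth (\<lambda>x. bump n (1 - x \<bullet> x))"
| smooth_add: "smooth f \<Longrightarrow> smooth g \<Longrightarrow> smooth (\<lambda>x. f x + g x)"
| smooth_mult: "smooth f \<Longrightarrow> smooth g \<Longrightarrow> smooth (\<lambda>x. f x * g x)"

lemma smooth_has_derivative:
  assumes "smooth f"
  shows "\<exists>f'. (\<forall>x. (f has_derivative (\<lambda>v. f' v x)) (at x)) \<and> (\<forall>v. smooth (f' v))"
  using assms
proof induction
  case (smooth_const c)
  show ?case by (rule exI[of _ "\<lambda>v x. 0"]) (auto intro: smooth.intros)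
next
  case (smooth_inner v)
  show ?case by (rule exI[of _ "\<lambda>w x. w \<bullet> v"]) (auto intro!: smooth.intros derivative_eq_intros)
next
  case (smooth_bump n)
  let ?f' = "\<lambda>v x. (bump (n + 2) (1 - x \<bullet> x) + (- real n) * bump (n + 1) (1 - x \<bullet> x)) * (-2 * (x \<bullet> v))"
  have "((\<lambda>x. bump n (1 - x \<bullet> x)) has_derivative (\<lambda>v. ?f' v x)) (at x)" for x :: "real^'n"
  proof -
    have "((\<lambda>x. 1 - x \<bullet> x) has_derivative (\<lambda>v. -2 * (x \<bullet> v))) (at x)"
      by (auto intro!: derivative_eq_intros simp: inner_commute)
    from has_derivative_compose[OF this bump_deriv[of n "1 - x \<bullet> x", unfolded has_field_derivative_def]]
    show ?thesis by simp
  qed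
  then show ?case by (intro exI[of _ ?f'] conjI allI smooth.intros) auto
next
  case (smooth_add f g)
  then obtain f' g' where "\<And>x. (f has_derivative (\<lambda>v. f' v x)) (at x)" "\<And>v. smooth (f' v)"
    "\<And>x. (g has_derivative (\<lambda>v. g' v x)) (at x)" "\<And>v. smooth (g' v)" by blast
  then show ?case
    by (intro exI[of _ "\<lambda>v x. f' v x + g' v x"]) (auto intro!: smooth.intros has_derivative_add)
next
  case (smooth_mult f g)
  then obtain f' g' where "\<And>x. (f has_derivative (\<lambda>v. f' v x)) (at x)" "\<And>v. smooth (f' v)"
    "\<And>x. (g has_derivative (\<lambda>v. g' v x)) (at x)" "\<And>v. smooth (g' v)" by blast
  then show ?case
    by (intro exI[of _ "\<lambda>v x. f x * g' v x + f' v x * g x"])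
       (use smooth_mult in \<open>auto intro!: smooth.intros has_derivative_mult\<close>)
qed

lemma smooth_frechet:
  assumes "smooth f"
  shows "(f has_derivative frechet_derivative f (at x)) (at x)" "smooth (\<lambda>x. frechet_derivative f (at x) v)"
proof -
  obtain f' where f': "\<And>x. (f has_derivative (\<lambda>v. f' v x)) (at x)" "\<And>v. smooth (f' v)"
    using smooth_has_derivative[OF assms] by blast
  have e: "frechet_derivative f (at x) = (\<lambda>v. f' v x)" for x
    using frechet_derivative_at[OF f'(1)] by simp
  show "(f has_derivative frechet_derivative f (at x)) (at x)" "smooth (\<lambda>x. frechet_derivative f (at x) v)"
    unfolding e by (auto intro: f')
qed

lemma smooth_continuous: "smooth f \<Longrightarrow> continuous_on A f"
  by (intro continuous_at_imp_continuous_on ballI has_derivative_continuous[OF smooth_frechet(1)])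

lemma smooth_dir_deriv:
  assumes "smooth f"
  shows "dir_deriv v (\<lambda>x. complex_of_real (f x)) (\<lambda>x. complex_of_real (frechet_derivative f (at x) v))"
  unfolding dir_deriv_def
proof
  fix x
  have "((\<lambda>h. x + h *\<^sub>R v) has_derivative (\<lambda>h. h *\<^sub>R v)) (at 0)" by (auto intro!: derivative_eq_intros)
  from has_derivative_compose[OF this, of f] smooth_frechet(1)[OF assms, of x]
  have "((\<lambda>h. f (x + h *\<^sub>R v)) has_derivative (\<lambda>h. frechet_derivative f (at x) (h *\<^sub>R v))) (at 0)" by simp
  also have "(\<lambda>h. frechet_derivative f (at x) (h *\<^sub>R v)) = (\<lambda>h. h *\<^sub>R frechet_derivative f (at x) v)"
    using linear_scale[OF has_derivative_linear[OF smooth_frechet(1)[OF assms]]] by blast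
  finally have "((\<lambda>h. f (x + h *\<^sub>R v)) has_vector_derivative frechet_derivative f (at x) v) (at 0)"
    by (simp add: has_vector_derivative_def)
  then show "((\<lambda>h. complex_of_real (f (x + h *\<^sub>R v))) has_vector_derivative complex_of_real (frechet_derivative f (at x) v)) (at 0)"
    by (rule bounded_linear.has_vector_derivative[OF bounded_linear_of_real])
qed

lemma Ck_smooth: "smooth f \<Longrightarrow> Ck m (\<lambda>x. complex_of_real (f x))"
proof (induction m arbitrary: f)
  case 0
  then show ?case by (auto intro!: continuous_intros smooth_continuous)
next
  case (Suc m)
  have "continuous_on UNIV (\<lambda>x. complex_of_real (f x))" by (intro continuous_intros smooth_continuous Suc.prems)
  then show ?case
    using Suc.IH[OF smooth_frechet(2)[OF Suc.prems]] dir_deriv_partial[OF smooth_dir_deriv[OF Suc.prems]] by simp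
qed

text \<open>The head of the list is the direction differentiated last, in accordance with
  \<open>E (v # vs)\<close> in the locale.\<close>

primrec iterated_deriv :: "(real^'n \<Rightarrow> real) \<Rightarrow> (real^'n) list \<Rightarrow> real^'n \<Rightarrow> real" where
  "iterated_deriv f [] = f"
| "iterated_deriv f (v # vs) = (\<lambda>x. frechet_derivative (iterated_deriv f vs) (at x) v)"

lemma smooth_iterated_deriv: "smooth f \<Longrightarrow> smooth (iterated_deriv f vs)"
  by (induction vs) (auto intro: smooth_frechet)

lemma iterated_deriv_support:
  assumes "\<And>x. norm x > 1 \<Longrightarrow> f x = 0" "norm x > 1"
  shows "iterated_deriv f vs x = 0"
  using assms(2)
proof (induction vs arbitrary: x)
  case (Cons v vs)
  have "open {x :: real^'n. norm x > 1}" by (intro open_Collect_less continuous_intros)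
  then have "(iterated_deriv f vs has_derivative (\<lambda>_. 0)) (at x)"
    by (rule has_derivative_transform_within_open[OF has_derivative_const[of 0]]) (use Cons in auto)
  from frechet_derivative_at[OF this] show ?case by (simp add: fun_eq_iff)
qed (use assms in simp)

lemma iterated_deriv_bounded:
  assumes "smooth f" "\<And>x. norm x > 1 \<Longrightarrow> f x = 0"
  shows "\<exists>B. \<forall>x. norm (complex_of_real (iterated_deriv f vs x)) \<le> B"
proof -
  have "bounded (iterated_deriv f vs ` cball 0 1)"
    by (intro compact_imp_bounded compact_continuous_image smooth_continuous smooth_iterated_deriv assms(1)) auto
  then obtain B where "\<forall>y\<in>iterated_deriv f vs ` cball 0 1. norm y \<le> B" unfolding bounded_iff by blast
  then have B: "\<bar>iterated_deriv f vs x\<bar> \<le> B" if "x \<in> cball 0 1" for x using that by force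
  have "\<bar>iterated_deriv f vs x\<bar> \<le> \<bar>B\<bar>" for x
    using B[of x] iterated_deriv_support[of f x vs] assms(2) by (cases "norm x \<le> 1") auto
  then show ?thesis by auto
qed

text \<open>A linear function times a radial cut-off is odd. The factor \<open>exp 1\<close> offsets
  \<open>bump 0 1 = exp (- 1)\<close> and makes the derivative at the origin equal to 1.\<close>

definition datum :: "'n \<Rightarrow> real^'n \<Rightarrow> real" where
  "datum k x = (exp 1 * (x \<bullet> axis k 1)) * bump 0 (1 - x \<bullet> x)"

lemma smooth_datum: "smooth (datum k)"
  unfolding datum_def[abs_def] by (intro smooth.intros)

lemma datum_support: "norm x > 1 \<Longrightarrow> datum k x = 0"
proof -
  assume "norm x > 1"
  then have "1 < norm x * norm x" by (simp add: less_1_mult)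
  then have "1 - x \<bullet> x < 0" by (simp add: dot_square_norm power2_eq_square)
  then show ?thesis by (simp add: datum_def bump_def)
qed

lemma datum_deriv_0:
  fixes k :: "'n::finite"
  shows "iterated_deriv (datum k) [axis k 1] 0 = 1"
proof -
  obtain g where g: "((\<lambda>x :: real^'n. bump 0 (1 - x \<bullet> x)) has_derivative g) (at 0)"
    using smooth_frechet(1)[OF smooth_bump] by blast
  have "((\<lambda>x :: real^'n. exp 1 * (x \<bullet> axis k 1)) has_derivative (\<lambda>h. exp 1 * (h \<bullet> axis k 1))) (at 0)"
    by (auto intro!: derivative_eq_intros)
  from has_derivative_mult[OF this g]
  have "(datum k has_derivative (\<lambda>h. exp 1 * (h \<bullet> axis k 1) * bump 0 1)) (at 0)"
    by (simp add: datum_def[abs_def])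
  from frechet_derivative_at[OF this, symmetric] show ?thesis
    by (simp add: bump_def inner_axis_axis exp_minus)
qed

definition u_init :: "'n \<Rightarrow> (real^'n) \<Rightarrow>\<^sub>C complex" where
  "u_init k = Bcontfun (\<lambda>x. complex_of_real (datum k x))"

lemma apply_u_init: "apply_bcontfun (u_init k) = (\<lambda>x. complex_of_real (datum k x))"
proof -
  obtain B where "\<And>x. norm (complex_of_real (datum k x)) \<le> B"
    using iterated_deriv_bounded[OF smooth_datum datum_support, of k "[]"] by auto
  then show ?thesis unfolding u_init_def
    by (intro Bcontfun_inverse bcontfun_normI) (auto intro!: continuous_intros smooth_continuous smooth_datum)
qed

lemma u_init_smooth: "u_init k \<in> Cc_infinity"
proof -
  have "{x. complex_of_real (datum k x) \<noteq> 0} \<subseteq> cball 0 1" using datum_support[of _ k] by force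
  then have "bounded {x. complex_of_real (datum k x) \<noteq> 0}" by (rule bounded_subset[OF bounded_cball])
  then show ?thesis
    unfolding Cc_infinity_def by (simp add: apply_u_init Ck_smooth[OF smooth_datum] compact_closure)
qed

lemma u_init_odd: "u_init k \<in> oddC0"
proof -
  have "((\<lambda>x. complex_of_real (datum k x)) \<longlongrightarrow> 0) at_infinity"
  proof (rule tendsto_eventually)
    have "datum k x = 0" if "norm x \<ge> 2" for x using datum_support[of x k] that by simp
    then show "eventually (\<lambda>x. complex_of_real (datum k x) = 0) at_infinity"
      unfolding eventually_at_infinity by auto
  qed
  then show ?thesis by (simp add: oddC0_def C0_def apply_u_init datum_def)
qed

text \<open>Evaluation at a point is bounded and linear, so it commutes with the Banach-space
  integral. Substituting the lag for the source time then gives the pointwise Volterra form, and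
  freezing the solution outside \<open>[0, T1]\<close> makes it globally bounded and
  continuous.\<close>

lemma mild_solution_duhamel:
  fixes k :: "'n::finite"
  assumes a: "0 < \<alpha>" "\<alpha> < 1" and u: "mild_solution lam \<alpha> (u_init k) T u" and T1: "0 \<le> T1" "ereal T1 < T"
  shows "\<exists>M. duhamel \<alpha> lam T1 M (\<lambda>t. apply_bcontfun (u (max 0 (min t T1)))) (\<lambda>vs x. complex_of_real (iterated_deriv (datum k) vs x))"
proof -
  note D = mild_solutionD[OF u T1]
  let ?c = "\<lambda>t. max 0 (min t T1)"
  let ?U = "\<lambda>t. apply_bcontfun (u (?c t))"
  let ?E = "\<lambda>vs x. complex_of_real (iterated_deriv (datum k) vs x)"
  have c: "?c t \<in> {0..T1}" for t using T1 by auto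
  have uc: "continuous_on UNIV (\<lambda>t. u (?c t))"
    by (rule continuous_on_compose2[OF D(1)]) (use c in \<open>auto intro!: continuous_intros\<close>)
  have "bounded (u ` {0..T1})" by (intro compact_imp_bounded compact_continuous_image D(1)) auto
  then obtain M where M: "\<And>t. t \<in> {0..T1} \<Longrightarrow> norm (u t) \<le> M" unfolding bounded_iff by blast
  have "duhamel \<alpha> lam T1 M ?U ?E"
  proof
    show "continuous_on UNIV (\<lambda>(t, x). ?U t x)"
      unfolding continuous_on_def
    proof
      fix p :: "real \<times> (real^'n)" assume "p \<in> UNIV"
      obtain t x where p: "p = (t, x)" by (cases p)
      have f: "(fst \<longlongrightarrow> t) (at p)" "(snd \<longlongrightarrow> x) (at p)" using tendsto_fst[OF tendsto_ident_at[of p UNIV]] tendsto_snd[OF tendsto_ident_at[of p UNIV]] by (auto simp: p)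
      have "isCont (\<lambda>t. u (?c t)) t" using uc by (simp add: continuous_on_eq_continuous_at)
      from isCont_tendsto_compose[OF this f(1)] have l: "((\<lambda>q. u (?c (fst q))) \<longlongrightarrow> u (?c t)) (at p)" .
      have "isCont (?U t) x" using continuous_on_apply_bcontfun[of UNIV "u (?c t)"] continuous_on_eq_continuous_at[OF open_UNIV] by blast
      from isCont_tendsto_compose[OF this f(2)] have l2: "((\<lambda>q. ?U t (snd q)) \<longlongrightarrow> ?U t x) (at p)" .
      \<comment> \<open>The sup norm controls a change of time uniformly in the point, which leaves
        only continuity of one fixed slice.\<close>
      have "((\<lambda>q. ?U (fst q) (snd q) - ?U t (snd q)) \<longlongrightarrow> 0) (at p)"
      proof (rule Lim_null_comparison)
        show "eventually (\<lambda>q. norm (?U (fst q) (snd q) - ?U t (snd q)) \<le> norm (u (?c (fst q)) - u (?c t))) (at p)"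
          by (intro always_eventually allI) (simp only: apply_bcontfun_simps(1)[symmetric] norm_bounded)
        show "((\<lambda>q. norm (u (?c (fst q)) - u (?c t))) \<longlongrightarrow> 0) (at p)"
          using tendsto_norm[OF tendsto_diff[OF l tendsto_const[of "u (?c t)"]]] by simp
      qed
      from tendsto_add[OF this l2] show "((\<lambda>(t, x). ?U t x) \<longlongrightarrow> (\<lambda>(t, x). ?U t x) p) (at p)"
        by (simp add: p split_def)
    qed
    show "norm (?U t x) \<le> M" for t x using M[OF c[of t]] norm_bounded order_trans by blast
    show "?U t = ?U (?c t)" for t using T1 by simp
    show "?U t x = gconv kern (?E []) t x + lam * volterra (\<lambda>\<tau> s. gconv kern (\<lambda>z. pnl \<alpha> (?U s z)) \<tau>) t x"
      if t: "0 \<le> t" "t \<le> T1" for t x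
    proof -
      have ct: "?c s = s" if "s \<in> {0..t}" for s using that t by auto
      have cu: "continuous_on {0..t} u" using t by (intro continuous_on_subset[OF D(1)]) auto
      have uC0: "u s \<in> C0" if "s \<in> {0..t}" for s using D(2)[of s] that t by auto
      let ?h = "\<lambda>\<sigma>. heat (t - \<sigma>) (nonlin \<alpha> (u \<sigma>))"
      have hc: "continuous_on {0..t} ?h" by (rule duhamel_integrand_cont[OF a cu uC0])
      have hx: "continuous_on {0..t} (\<lambda>\<sigma>. apply_bcontfun (?h \<sigma>) x)"
        by (rule bounded_linear.continuous_on[OF bounded_linear_apply_bcontfun hc])
      have "apply_bcontfun (integral {0..t} ?h) x = integral {0..t} (\<lambda>\<sigma>. apply_bcontfun (?h \<sigma>) x)"
        using integral_linear[OF integrable_continuous_real[OF hc] bounded_linear_apply_bcontfun[of x]] by (simp add: o_def)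
      also have "\<dots> = integral {0<..<t} (\<lambda>\<sigma>. apply_bcontfun (?h \<sigma>) x)"
        by (rule integral_unique[symmetric]) (use integrable_integral[OF integrable_continuous_real[OF hx]] in \<open>simp add: has_integral_Icc_iff_Ioo\<close>)
      also have "\<dots> = (\<integral>\<sigma>. indicator {0<..<t} \<sigma> *\<^sub>R apply_bcontfun (?h \<sigma>) x \<partial>lborel)"
      proof -
        have "set_integrable lborel {0<..<t} (\<lambda>\<sigma>. apply_bcontfun (?h \<sigma>) x)"
          unfolding set_integrable_def by (rule Ioo_integrable[OF hx])
        from set_borel_integral_eq_integral(2)[OF this] show ?thesis by (simp add: set_lebesgue_integral_def)
      qed
      also have "\<dots> = (\<integral>\<tau>. indicator {0<..<t} (t + - 1 * \<tau>) *\<^sub>R apply_bcontfun (?h (t + - 1 * \<tau>)) x \<partial>lborel)"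
        using lborel_integral_real_affine[of "-1" "\<lambda>\<sigma>. indicator {0<..<t} \<sigma> *\<^sub>R apply_bcontfun (?h \<sigma>) x" t] by simp
      also have "\<dots> = volterra (\<lambda>\<tau> s. gconv kern (\<lambda>z. pnl \<alpha> (?U s z)) \<tau>) t x"
        unfolding volterra_def
      proof (rule Bochner_Integration.integral_cong)
        fix \<tau>
        show "indicator {0<..<t} (t + - 1 * \<tau>) *\<^sub>R apply_bcontfun (?h (t + - 1 * \<tau>)) x =
            indicator {0<..<t} \<tau> *\<^sub>R gconv kern (\<lambda>z. pnl \<alpha> (?U (t - \<tau>) z)) \<tau> x"
        proof (cases "\<tau> \<in> {0<..<t}")
          case True
          then have "?c (t - \<tau>) = t - \<tau>" using t by auto
          moreover have "apply_bcontfun (nonlin \<alpha> f) = (\<lambda>z. pnl \<alpha> (apply_bcontfun f z))" for f :: "(real^'n) \<Rightarrow>\<^sub>C complex"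
            using a by (simp add: fun_eq_iff nonlin_eq_pnl)
          ultimately show ?thesis using True by (simp add: heat_eq_gconv)
        next
          case False
          then have "t + - 1 * \<tau> \<notin> {0<..<t}" by auto
          then show ?thesis using False by simp
        qed
      qed simp
      finally have i: "apply_bcontfun (integral {0..t} ?h) x = volterra (\<lambda>\<tau> s. gconv kern (\<lambda>z. pnl \<alpha> (?U s z)) \<tau>) t x" .
      have "?U t x = apply_bcontfun (u t) x" using ct[of t] t by simp
      also have "\<dots> = apply_bcontfun (heat t (u_init k) + cscale lam (integral {0..t} ?h)) x" using D(3)[of t] t by simp
      also have "\<dots> = gconv kern (?E []) t x + lam * volterra (\<lambda>\<tau> s. gconv kern (\<lambda>z. pnl \<alpha> (?U s z)) \<tau>) t x"
        using t by (simp add: apply_bcontfun_simps apply_cscale i heat_eq_gconv apply_u_init)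
      finally show ?thesis .
    qed
    show "dir_deriv v (?E vs) (?E (v # vs))" for vs v
      using smooth_dir_deriv[OF smooth_iterated_deriv[OF smooth_datum]] by simp
    show "continuous_on UNIV (?E vs)" for vs
      by (intro continuous_intros smooth_continuous smooth_iterated_deriv smooth_datum)
    show "\<exists>B. \<forall>x. norm (?E vs x) \<le> B" for vs by (rule iterated_deriv_bounded[OF smooth_datum datum_support])
    show "?E [v] x = (\<Sum>i\<in>UNIV. (v $ i) *\<^sub>R ?E [axis i 1] x)" for v x
    proof -
      have l: "linear (frechet_derivative (datum k) (at x))"
        by (rule has_derivative_linear[OF smooth_frechet(1)[OF smooth_datum]])
      have v: "v = (\<Sum>i\<in>UNIV. (v $ i) *\<^sub>R axis i 1)"
        using basis_expansion[of v] by (simp add: scalar_mult_eq_scaleR)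
      have "frechet_derivative (datum k) (at x) v = (\<Sum>i\<in>UNIV. (v $ i) *\<^sub>R frechet_derivative (datum k) (at x) (axis i 1))"
        by (subst v) (simp only: linear_sum[OF l] linear_scale[OF l])
      then show ?thesis by (simp add: scaleR_conv_of_real)
    qed
  qed (use a T1 in auto)
  then show ?thesis by blast
qed

theorem theorem1p1:
  fixes \<alpha> :: real and lam :: complex
    and k :: "'n::finite"
  assumes "0 < \<alpha>" and "\<alpha> < 1" and "lam \<noteq> 0"
  shows "\<exists>u0 :: (real^'n) \<Rightarrow>\<^sub>C complex. u0 \<in> Cc_infinity \<and>
    (\<exists>T u. maximal_solution lam \<alpha> u0 T u \<and>
      (\<forall>t. 0 \<le> t \<and> ereal t < T \<longrightarrow> Ck 3 (apply_bcontfun (u t))) \<and>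
      (\<exists>t0. 0 < t0 \<and> ereal t0 < T \<and>
        (\<forall>\<beta> s t. \<alpha> < \<beta> \<and> \<beta> \<le> 1 \<and> 0 \<le> s \<and> s < t \<and> t < t0 \<longrightarrow>
          (\<integral>\<^sup>+\<sigma>\<in>{s..t}.
             holder_seminorm \<beta> (partial k (laplacian (apply_bcontfun (u \<sigma>)))) \<partial>lborel) = \<infinity>)))"
proof -
  note a = assms(1,2)
  obtain \<tau> w where w: "\<tau> > 0" "mild_solution lam \<alpha> (u_init k) (ereal \<tau>) w" "\<And>t. w t \<in> oddC0"
    using local_existence[OF a u_init_odd] by blast
  obtain T u where m: "maximal_solution lam \<alpha> (u_init k) T u"
    using maximal_solution_exists[OF a w(2)] by blast
  then have u: "mild_solution lam \<alpha> (u_init k) T u" by (simp add: maximal_solution_def)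
  have T: "ereal \<tau> \<le> T" and wu: "\<And>t. 0 \<le> t \<Longrightarrow> t < \<tau> \<Longrightarrow> w t = u t"
    using m w(2) unfolding maximal_solution_def by auto
  \<comment> \<open>Regularity is wanted on all of \<open>[0, T)\<close>, so the locale is used with
    each \<open>t\<close> as its end time.\<close>
  have Ck3: "Ck 3 (apply_bcontfun (u t))" if t: "0 \<le> t" "ereal t < T" for t
  proof -
    obtain M where "duhamel \<alpha> lam t M (\<lambda>s. apply_bcontfun (u (max 0 (min s t)))) (\<lambda>vs x. complex_of_real (iterated_deriv (datum k) vs x))"
      using mild_solution_duhamel[OF a u t] by blast
    from duhamel.Ck3_U[OF this, of t] show ?thesis using t by simp
  qed
  define T1 where "T1 = \<tau> / 2"
  have T1: "0 < T1" "T1 < \<tau>" "ereal T1 < T"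
    using w(1) T less_le_trans[of "ereal T1" "ereal \<tau>" T] by (auto simp: T1_def)
  let ?U = "\<lambda>s. apply_bcontfun (u (max 0 (min s T1)))"
  obtain M where d: "duhamel \<alpha> lam T1 M ?U (\<lambda>vs x. complex_of_real (iterated_deriv (datum k) vs x))"
    using mild_solution_duhamel[OF a u _ T1(3)] T1 by auto
  have U0: "?U \<sigma> 0 = 0" for \<sigma>
  proof -
    let ?s = "max 0 (min \<sigma> T1)"
    have "\<forall>x. apply_bcontfun (w ?s) (- x) = - apply_bcontfun (w ?s) x" using w(3)[of ?s] by (simp add: oddC0_def)
    from spec[OF this, of 0] have "apply_bcontfun (w ?s) 0 = 0" by simp
    then show ?thesis using wu[of ?s] T1 by simp
  qed
  have E1: "complex_of_real (iterated_deriv (datum k) [axis k 1] 0) = 1" by (simp only: datum_deriv_0 of_real_1)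
  obtain t0 where t0: "0 < t0" "t0 \<le> T1" "\<And>\<beta> s t. \<alpha> < \<beta> \<Longrightarrow> \<beta> \<le> 1 \<Longrightarrow> 0 \<le> s \<Longrightarrow> s < t \<Longrightarrow> t < t0 \<Longrightarrow>
    (\<integral>\<^sup>+\<sigma>\<in>{s..t}. holder_seminorm \<beta> (partial k (laplacian (?U \<sigma>))) \<partial>lborel) = \<infinity>"
    using duhamel.seminorm_integral_infinite[OF d T1(1) assms(3) U0 E1] by blast
  have "(\<integral>\<^sup>+\<sigma>\<in>{s..t}. holder_seminorm \<beta> (partial k (laplacian (apply_bcontfun (u \<sigma>)))) \<partial>lborel) = \<infinity>"
    if "\<alpha> < \<beta>" "\<beta> \<le> 1" "0 \<le> s" "s < t" "t < t0" for \<beta> s t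
  proof -
    have "(\<integral>\<^sup>+\<sigma>\<in>{s..t}. holder_seminorm \<beta> (partial k (laplacian (apply_bcontfun (u \<sigma>)))) \<partial>lborel) =
      (\<integral>\<^sup>+\<sigma>\<in>{s..t}. holder_seminorm \<beta> (partial k (laplacian (?U \<sigma>))) \<partial>lborel)"
      by (rule nn_integral_cong) (use that t0(2) in \<open>auto simp: indicator_def\<close>)
    then show ?thesis using t0(3)[OF that] by simp
  qed
  moreover have "ereal t0 < T" using le_less_trans[of "ereal t0" "ereal T1" T] t0(2) T1(3) by simp
  ultimately show ?thesis using u_init_smooth m Ck3 t0(1) by blast
qed

end
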